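(* There exists a constant $c_n>0$ such that for all Hilbert geometries $(\mathcal{C},d_{\mathcal{C}})$ with $\mathcal{C}\subset\mathbb{R}^n$, for any point $x\in\mathcal{C}$ and any real number $r>0$, if $\mathrm{Vol}_{\mathcal{C}}$ denotes the Busemann volume of $\mathcal{C}$, then: (1) $\mathrm{Vol}_{\mathcal{C}}\bigl(B_{\mathcal{C}}(x,r)\bigr)\ge c_n r^n$. (2) The asymptotic volume is finite if and only if $\mathcal{C}$ is a polytope. (3) If $\mathcal{C}$ is a polytope with $k$ vertices, then $$\underline{\mathrm{Asvol}}(\mathcal{C})=\liminf_{r\to+\infty}\frac{\mathrm{Vol}_{\mathcal{C}}\bigl(B_{\mathcal{C}}(x,r)\bigr)}{r^n}\ge c_n k.$$ Therefore, in each dimension, there is only a finite number of families of polytopal Hilbert geometries which may have an asymptotic volume less than that of the simplex.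
   Context: A Hilbert geometry $(\mathcal{C},d_{\mathcal{C}})$ in $\mathbb{R}^n$ is a nonempty open convex set $\mathcal{C}\subset\mathbb{R}^n$ that contains no whole line, endowed with the Hilbert distance: $d_{\mathcal{C}}(p,p)=0$, and for distinct $p,q\in\mathcal{C}$, if the line $pq$ meets $\partial\mathcal{C}$ at $a,b$ with $a,p,q,b$ in this order on the line, $$d_{\mathcal{C}}(p,q)=\frac12\ln\left(\frac{\|q-a\|}{\|p-a\|}\cdot\frac{\|p-b\|}{\|q-b\|}\right),$$ where $\|\cdot\|$ is the Euclidean norm; if $a$ or $b$ is at infinity the corresponding ratio is taken equal to $1$. $B_{\mathcal{C}}(x,r)$ is the metric ball of radius $r$ centred at $x$ for $d_{\mathcal{C}}$. Finsler metric: for $p\in\mathcal{C}$ and $v\in\mathbb{R}^n\setminus\{0\}$, let $t^+,t^->0$ be such that $p+t^+v\in\partial\mathcal{C}$ and $p-t^-v\in\partial\mathcal{C}$ (with $1/t^\pm=0$ if the corresponding boundary point is at infinity); set $F_{\mathcal{C}}(p,v)=\frac12\left(\frac1{t^+}+\frac1{t^-}\right)$ and $F_{\mathcal{C}}(p,0)=0$. Busemann volume: let $\beta_{\mathcal{C}}(p)=\{v\in\mathbb{R}^n : F_{\mathcal{C}}(p,v)<1\}$, let $\mathrm{Leb}$ be Lebesgue measure, and let $\omega_n$ be the Euclidean volume of the Euclidean unit ball of $\mathbb{R}^n$. For a Borel set $A\subset\mathcal{C}$, $\mathrm{Vol}_{\mathcal{C}}(A)=\int_A \frac{\omega_n}{\mathrm{Leb}(\beta_{\mathcal{C}}(p))}\,d\mathrm{Leb}(p)$.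 The asymptotic volume of $\mathcal{C}$ is $\underline{\mathrm{Asvol}}(\mathcal{C})=\liminf_{r\to+\infty}\mathrm{Vol}_{\mathcal{C}}(B_{\mathcal{C}}(x,r))/r^n\in[0,+\infty]$. A polytopal Hilbert geometry is one for which $\mathcal{C}$ is a polytope (being open, $\mathcal{C}$ is the interior of a convex polytope); "the simplex" refers to the Hilbert geometry of the open $n$-simplex.
   Formalization: "C is a polytope" is read up to projective transformation, counting vertices at infinity, since for unbounded C (e.g. the open orthant, whose asymptotic volume is finite) claim (2) fails literally; for bounded C it is the literal notion. "Families" are combinatorial types. *)

theory Defs
  imports "HOL-Analysis.Analysis"
begin

definition hilbert_geometry :: "'a::euclidean_space set \<Rightarrow> bool" where
  "hilbert_geometry C \<longleftrightarrow> C \<noteq> {} \<and> open C \<and> convex C \<and>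
     \<not> (\<exists>p v. v \<noteq> 0 \<and> range (\<lambda>t::real. p + t *\<^sub>R v) \<subseteq> C)"

(* For distinct p, q in C: the ratio |p - b| / |q - b|, where b is the boundary point that the ray
   from p through q meets beyond q; 1 if there is none, i.e. b is at infinity.
   Convexity of the open set C makes b unique. *)
definition exit_ratio :: "'a::euclidean_space set \<Rightarrow> 'a \<Rightarrow> 'a \<Rightarrow> real" where
  "exit_ratio C p q =
     (if \<exists>b. b \<in> frontier C \<and> q \<in> open_segment p b
      then let b = (THE b. b \<in> frontier C \<and> q \<in> open_segment p b) in norm (p - b) / norm (q - b)
      else 1)"

definition hilbert_dist :: "'a::euclidean_space set \<Rightarrow> 'a \<Rightarrow> 'a \<Rightarrow> real" where
  "hilbert_dist C p q = (if p = q then 0 else ln (exit_ratio C q p * exit_ratio C p q) / 2)"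

definition hilbert_ball :: "'a::euclidean_space set \<Rightarrow> 'a \<Rightarrow> real \<Rightarrow> 'a set" where
  "hilbert_ball C x r = {y \<in> C. hilbert_dist C x y < r}"

(* 1 / t where t > 0 is such that p + t v is on the boundary; 0 if there is no such t. *)
definition inv_exit_time :: "'a::euclidean_space set \<Rightarrow> 'a \<Rightarrow> 'a \<Rightarrow> real" where
  "inv_exit_time C p v =
     (if \<exists>t>0. p + t *\<^sub>R v \<in> frontier C
      then 1 / (THE t. t > 0 \<and> p + t *\<^sub>R v \<in> frontier C)
      else 0)"

definition finsler :: "'a::euclidean_space set \<Rightarrow> 'a \<Rightarrow> 'a \<Rightarrow> real" where
  "finsler C p v = (if v = 0 then 0 else (inv_exit_time C p v + inv_exit_time C p (- v)) / 2)"

definition tangent_ball :: "'a::euclidean_space set \<Rightarrow> 'a \<Rightarrow> 'a set" where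
  "tangent_ball C p = {v. finsler C p v < 1}"

definition busemann_vol :: "'a::euclidean_space set \<Rightarrow> 'a set \<Rightarrow> ennreal" where
  "busemann_vol C A =
     (\<integral>\<^sup>+p\<in>A. emeasure lborel (ball (0::'a) 1) / emeasure lborel (tangent_ball C p) \<partial>lborel)"

(* The value does not depend on the base point x in C; it is kept as an argument so that no point
   has to be chosen. *)
definition asvol :: "'a::euclidean_space set \<Rightarrow> 'a \<Rightarrow> ennreal" where
  "asvol C x =
     Liminf at_top (\<lambda>r::real. busemann_vol C (hilbert_ball C x r) / ennreal (r ^ DIM('a)))"

(* The projective transformation given in homogeneous coordinates by L, in the affine chart
   where the last coordinate is 1. *)
definition proj_map :: "('a::euclidean_space \<times> real \<Rightarrow> 'a \<times> real) \<Rightarrow> 'a \<Rightarrow> 'a" where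
  "proj_map L y = fst (L (y, 1)) /\<^sub>R snd (L (y, 1))"

(* C is the interior of the convex polytope P, up to a projective transformation that sends no
   point of the interior of P to infinity.  A Hilbert geometry may be unbounded, and then it has
   boundary points at infinity.  The open positive orthant, for example, is the image of an open
   simplex under a projective transformation, which is an isometry of Hilbert geometries, so its
   asymptotic volume is finite; it has one finite vertex and n vertices at infinity.
   The faces and vertices of C are therefore read off from the polytope P.  For bounded C the
   lemma polytopal_bounded_iff shows that the transformation may be taken to be the identity. *)
definition polytopal :: "'a::euclidean_space set \<Rightarrow> 'a set \<Rightarrow> bool" where
  "polytopal C P \<longleftrightarrow> polytope P \<and>
     (\<exists>L. linear L \<and> bij L \<and> (\<forall>y\<in>interior P. snd (L (y, 1)) > 0) \<and> C = proj_map L ` interior P)"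

definition vertices :: "'a::euclidean_space set \<Rightarrow> 'a set" where
  "vertices P = {v. v extreme_point_of P}"

(* Isomorphism of face posets. *)
definition combinatorially_equivalent ::
  "'a::euclidean_space set \<Rightarrow> 'a set \<Rightarrow> bool" where
  "combinatorially_equivalent P Q \<longleftrightarrow>
     (\<exists>\<phi>. bij_betw \<phi> {F. F face_of P} {G. G face_of Q} \<and>
          (\<forall>F F'. F face_of P \<longrightarrow> F' face_of P \<longrightarrow> (F \<subseteq> F' \<longleftrightarrow> \<phi> F \<subseteq> \<phi> F')))"

lemma polytopal_interior:
  assumes "polytope P"
  shows "polytopal (interior P) P"
proof -
  have "interior P = proj_map id ` interior P"
    by (simp add: proj_map_def)
  then show ?thesis
    unfolding polytopal_def using assms by (intro conjI exI[of _ id]) (auto simp: linear_id)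
qed

lemma polytopal_bounded:
  fixes C :: "'a::euclidean_space set"
  assumes C: "hilbert_geometry C" "bounded C" and P: "polytopal C P"
  obtains Q where "polytope Q" "C = interior Q" "card (vertices Q) = card (vertices P)"
proof -
  obtain L where L: "linear L" "bij L" "\<And>y. y \<in> interior P \<Longrightarrow> snd (L (y, 1)) > 0"
      "C = proj_map L ` interior P" and polyP: "polytope P"
    using P unfolding polytopal_def by blast
  define N D f where "N = (\<lambda>y. fst (L (y, 1)))" and "D = (\<lambda>y. snd (L (y, 1)))"
    and "f = proj_map L"
  have f: "f y = N y /\<^sub>R D y" for y
    by (simp add: f_def N_def D_def proj_map_def)
  have Lcomb: "L ((1 - u) *\<^sub>R x + u *\<^sub>R y, 1) = (1 - u) *\<^sub>R L (x, 1) + u *\<^sub>R L (y, 1)" for u x y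
  proof -
    have "((1 - u) *\<^sub>R x + u *\<^sub>R y, 1::real) = (1 - u) *\<^sub>R (x, 1) + u *\<^sub>R (y, 1)"
      by simp
    then show ?thesis
      using L(1) by (simp only: linear_add linear_cmul)
  qed
  have Ncomb: "N ((1 - u) *\<^sub>R x + u *\<^sub>R y) = (1 - u) *\<^sub>R N x + u *\<^sub>R N y"
    and Dcomb: "D ((1 - u) *\<^sub>R x + u *\<^sub>R y) = (1 - u) * D x + u * D y" for u x y
    by (simp_all add: N_def D_def Lcomb)
  have contL: "continuous_on UNIV L"
    using L(1) by (simp add: linear_continuous_on linear_conv_bounded_linear)
  have contLy: "continuous_on S (\<lambda>y. L (y, 1))" for S
    by (rule continuous_on_compose2[OF contL]) (auto intro!: continuous_intros)
  have contN: "continuous_on S N" and contD: "continuous_on S D" for S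
    unfolding N_def D_def by (auto intro!: continuous_intros contLy)
  have convP: "convex P" and compP: "compact P"
    using polyP polytope_imp_convex polytope_imp_compact by auto
  have intP: "interior P \<noteq> {}"
    using C L(4) by (auto simp: hilbert_geometry_def)
  have clP: "closure (interior P) = P"
    using convex_closure_interior[OF convP intP] compact_imp_closed[OF compP] by simp
  obtain B where B: "\<And>z. z \<in> C \<Longrightarrow> norm z \<le> B"
    using C(2) unfolding bounded_iff by blast
  have "interior P \<subseteq> {y. norm (N y) \<le> B * D y \<and> 0 \<le> D y}"
  proof
    fix y assume y: "y \<in> interior P"
    then have "norm (f y) \<le> B"
      using B L(4) f_def by blast
    moreover have "D y > 0"
      using L(3)[OF y] by (simp add: D_def)
    ultimately show "y \<in> {y. norm (N y) \<le> B * D y \<and> 0 \<le> D y}"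
      by (simp add: f field_simps)
  qed
  moreover have "closed {y. norm (N y) \<le> B * D y \<and> 0 \<le> D y}"
    by (intro closed_Collect_conj closed_Collect_le continuous_intros contN contD)
  ultimately have P_sub: "P \<subseteq> {y. norm (N y) \<le> B * D y \<and> 0 \<le> D y}"
    using closure_minimal clP by metis
  have L0: "L (0, 0) = (0, 0)"
    using linear_0[OF L(1)] by (simp add: zero_prod_def)
  have Dpos: "D y > 0" if "y \<in> P" for y
  proof (rule ccontr)
    assume "\<not> D y > 0"
    then have D0: "D y = 0" using P_sub that by force
    then have "N y = 0" using P_sub that by force
    with D0 have "L (y, 1) = L (0, 0)"
      unfolding L0 by (simp add: N_def D_def prod_eq_iff)
    then have "(y, 1::real) = (0, 0)"
      using L(2) by (meson bij_def injD)
    then show False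
      by simp
  qed
  have inj: "inj_on f P"
  proof (rule inj_onI)
    fix x y assume x: "x \<in> P" and y: "y \<in> P" and e: "f x = f y"
    have h: "L (x /\<^sub>R D x, 1 / D x) = (f x, 1)" if "x \<in> P" for x
    proof -
      have "(x /\<^sub>R D x, 1 / D x) = (1 / D x) *\<^sub>R (x, 1::real)"
        by (simp add: divide_inverse)
      then have "L (x /\<^sub>R D x, 1 / D x) = (1 / D x) *\<^sub>R L (x, 1)"
        using L(1) by (simp only: linear_cmul)
      then show ?thesis
        using Dpos[OF that] by (simp add: f N_def D_def prod_eq_iff divide_inverse)
    qed
    have "(x /\<^sub>R D x, 1 / D x) = (y /\<^sub>R D y, 1 / D y)"
      using h[OF x] h[OF y] e L(2) by (metis bij_def injD)
    then show "x = y"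
      using Dpos[OF y] by auto
  qed
  have contf: "continuous_on P f"
    unfolding f using Dpos by (intro continuous_intros contN contD) force
  have compQ: "compact (f ` P)"
    using compact_continuous_image contf compP by blast
  have Q: "f ` P = closure C"
  proof
    show "f ` P \<subseteq> closure C"
      using closure_minimal image_closure_subset[of "interior P" f "closure C"] contf
      by (simp add: clP L(4) f_def closure_subset)
    show "closure C \<subseteq> f ` P"
      using compact_imp_closed[OF compQ] L(4) interior_subset[of P]
      by (intro closure_minimal) (auto simp: f_def)
  qed
  have convC: "convex C" "open C"
    using C by (auto simp: hilbert_geometry_def)
  have convQ: "convex (f ` P)"
    unfolding Q by (rule convex_closure[OF convC(1)])
  have intQ: "C = interior (f ` P)"
    unfolding Q using convex_interior_closure[OF convC(1)] convC(2) by (simp add: interior_open)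
  have comb: "f ((1 - u) *\<^sub>R x + u *\<^sub>R y)
      = (1 - u * D y / ((1 - u) * D x + u * D y)) *\<^sub>R f x + (u * D y / ((1 - u) * D x + u * D y)) *\<^sub>R f y"
    if "x \<in> P" "y \<in> P" "0 < u" "u < 1" for x y u
  proof -
    define E where "E = (1 - u) * D x + u * D y"
    have pos: "D x > 0" "D y > 0" "E > 0"
      using Dpos that by (auto simp: E_def intro!: add_pos_pos)
    have "1 - u * D y / E = (1 - u) * D x / E"
      using pos(3) by (simp add: E_def field_simps)
    then have c1: "(1 - u * D y / E) * inverse (D x) = inverse E * (1 - u)"
      using pos by (simp only:) (simp add: field_simps)
    have c2: "(u * D y / E) * inverse (D y) = inverse E * u"
      using pos by (simp add: field_simps)
    show ?thesis
      unfolding f Ncomb Dcomb E_def[symmetric]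
      by (simp only: scaleR_add_right scaleR_scaleR c1 c2)
  qed
  have seg: "f v \<in> open_segment (f x) (f y) \<longleftrightarrow> v \<in> open_segment x y"
    if xyv: "x \<in> P" "y \<in> P" "v \<in> P" for x y v
  proof
    assume "v \<in> open_segment x y"
    then obtain u where u: "x \<noteq> y" "0 < u" "u < 1" "v = (1 - u) *\<^sub>R x + u *\<^sub>R y"
      by (auto simp: in_segment)
    have "D x > 0" "D y > 0" using Dpos xyv by auto
    then have "0 < (1 - u) * D x" "0 < u * D y" using u by auto
    then have "0 < u * D y / ((1 - u) * D x + u * D y)" "u * D y / ((1 - u) * D x + u * D y) < 1"
      by (auto simp: divide_less_eq)
    moreover have "f x \<noteq> f y" using inj u xyv by (auto simp: inj_on_def)
    ultimately show "f v \<in> open_segment (f x) (f y)"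
      using comb[OF xyv(1,2) u(2,3)] u(4) unfolding in_segment by blast
  next
    assume "f v \<in> open_segment (f x) (f y)"
    then obtain s where s: "f x \<noteq> f y" "0 < s" "s < 1" "f v = (1 - s) *\<^sub>R f x + s *\<^sub>R f y"
      by (auto simp: in_segment)
    have D: "D x > 0" "D y > 0" using Dpos xyv by auto
    define E where "E = s * D x + (1 - s) * D y"
    define u where "u = s * D x / E"
    have sD: "0 < s * D x" "0 < (1 - s) * D y" using D s by auto
    then have E: "E > 0" by (simp add: E_def)
    have u: "0 < u" "u < 1" using sD E by (auto simp: u_def divide_less_eq E_def)
    have u1: "1 - u = (1 - s) * D y / E" using E by (simp add: u_def E_def field_simps)
    have 1: "(1 - u) * D x + u * D y = D x * D y / E"
      unfolding u1 unfolding u_def by (simp add: add_divide_distrib[symmetric] algebra_simps)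
    have 2: "u * D y / ((1 - u) * D x + u * D y) = s"
      unfolding 1 unfolding u_def using D E by (simp add: field_simps)
    have "f ((1 - u) *\<^sub>R x + u *\<^sub>R y) = f v"
      using comb[OF xyv(1,2) u] s(4) unfolding 2 by simp
    moreover have "(1 - u) *\<^sub>R x + u *\<^sub>R y \<in> P"
      using convexD[OF convP xyv(1,2), of "1 - u" u] u by simp
    ultimately have "(1 - u) *\<^sub>R x + u *\<^sub>R y = v"
      using inj xyv(3) by (auto simp: inj_on_def)
    then show "v \<in> open_segment x y"
      using u s(1) unfolding in_segment by blast
  qed
  have vert: "vertices (f ` P) = f ` vertices P"
    using seg by (auto simp: vertices_def extreme_point_of_def)
  have injv: "inj_on f (vertices P)"
    by (rule inj_on_subset[OF inj]) (auto simp: vertices_def extreme_point_of_def)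
  have finv: "finite (vertices P)"
    using finite_polyhedron_extreme_points[OF polytope_imp_polyhedron[OF polyP]]
    by (simp add: vertices_def)
  have "f ` P = convex hull (vertices (f ` P))"
    using Krein_Milman_Minkowski[OF compQ convQ] by (simp add: vertices_def)
  then have "polytope (f ` P)"
    unfolding polytope_def vert using finv by blast
  then show thesis
    using that intQ vert card_image[OF injv] by metis
qed

lemma polytopal_bounded_iff:
  fixes C :: "'a::euclidean_space set"
  assumes "hilbert_geometry C" "bounded C"
  shows "(\<exists>P. polytopal C P \<and> card (vertices P) = k) \<longleftrightarrow>
         (\<exists>P. polytope P \<and> C = interior P \<and> card (vertices P) = k)"
  using polytopal_bounded[OF assms] polytopal_interior by metis

end

theory Submission
  imports Defs
begin

text \<open>
  The Hilbert metric can be read off from the positive affine functions on the convex set C. The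
  exit ratio of p and q is the maximum of f p / f q over these functions
  (\<open>exit_ratio_bound\<close>, \<open>exit_ratio_attained\<close>), so the Hilbert distance
  is half the logarithm of the largest cross ratio f p g q / (f q g p). The triangle inequality
  and the invariance under projective transformations follow at once.

  The volume enters only locally. The unit tangent ball at p lies between the Macbeath region M
  = (C - p) \<open>\<inter>\<close> (p - C) and its double, so the Busemann density is the
  inverse of the Lebesgue measure of M, up to a factor that depends on the dimension. If
  positive affine functions vary by a bounded factor on a set, the Macbeath regions at its
  points are comparable, and their measure cancels in the volume. Hence there is a lower bound
  for the volume of a neighbourhood of every point
  (\<open>busemann_vol_ge_disjoint_macbeath\<close>) and an upper bound for the volume of every
  set on which positive affine functions vary by a bounded factor
  (\<open>busemann_vol_le_cover\<close>), both the same in all Hilbert geometries of a given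
  dimension. What remains is to count points and pieces. Counting is compatible with isometries,
  in particular with projective transformations.

  The lower bound is an induction on the dimension (\<open>packing_of_sections\<close>). Let f
  support C at a boundary point b, and let y j be the point at distance about j from x on the
  segment towards b. The sections of C parallel to the supporting hyperplane through the y j are
  at distance at least 1 from each other. In the section through y j there are, by induction,
  about (m - j)\<open>^\<close>(d - 1) separated points at distance m - j from y j. The sum over
  j gives m\<open>^\<close>d separated points at distance m from x. If C is bounded and b is an
  exposed point of its closure, the sections contract to b, so the points can be taken near b
  and different exposed points contribute disjoint families: k exposed points give k times the
  volume (\<open>asvol_ge_exposed_points\<close>). An unbounded C becomes bounded by a
  projective transformation, because it contains no line. The vertices of a polytope are
  exposed. Conversely, if there are only finitely many exposed points, their convex hull is the
  closure of C, because points at maximal distance from a given point are exposed; so a geometry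
  of finite asymptotic volume is polytopal.

  For the upper bound let C be the interior of a polytope of dimension d with k vertices. By
  Caratheodory's theorem a point is a convex combination of d + 1 vertices, and one of the
  weights is at least 1 / (d + 1). Recording the logarithms of the other d weights up to bounded
  errors, with a cutoff at exp (-2 r), distributes a ball of radius r over at most a constant
  times r\<open>^\<close>d pieces, and positive affine functions vary by a bounded factor on
  each of them (\<open>polytope_ball_cover\<close>). The leading constant depends on d and k
  only. In particular all simplices have asymptotic volume below a common bound; by the lower
  bound a polytope with smaller asymptotic volume has boundedly many vertices, and there are
  finitely many face posets of such polytopes.
\<close>

section \<open>Positive affine functions and the Hilbert distance\<close>

definition pos_aff :: "'a::euclidean_space set \<Rightarrow> ('a \<Rightarrow> real) set" where
  "pos_aff C = {f. (\<exists>a w. \<forall>y. f y = a + w \<bullet> y) \<and> (\<forall>y\<in>C. 0 < f y)}"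

lemma pos_affE:
  assumes "f \<in> pos_aff C"
  obtains a w where "\<And>y. f y = a + w \<bullet> y" "\<And>y. y \<in> C \<Longrightarrow> 0 < a + w \<bullet> y"
  using assms unfolding pos_aff_def by force

lemma pos_affD: "f \<in> pos_aff C \<Longrightarrow> y \<in> C \<Longrightarrow> 0 < f y"
  by (auto simp: pos_aff_def)

lemma pos_affI: "(\<And>y. y \<in> C \<Longrightarrow> 0 < a + w \<bullet> y) \<Longrightarrow> (\<lambda>y. a + w \<bullet> y) \<in> pos_aff C"
  by (auto simp: pos_aff_def)

lemma one_in_pos_aff: "(\<lambda>_. 1) \<in> pos_aff C"
  using pos_affI[of C 1 0] by simp

lemma pos_aff_line:
  assumes "f \<in> pos_aff C"
  shows "f (x + t *\<^sub>R (y - x)) = (1 - t) * f x + t * f y"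
  using assms by (elim pos_affE) (simp add: algebra_simps inner_simps)

lemma pos_aff_closure_nonneg:
  assumes "f \<in> pos_aff C" "b \<in> closure C"
  shows "0 \<le> f b"
proof -
  obtain a w where f: "\<And>y. f y = a + w \<bullet> y"
    using assms(1) pos_affE by blast
  have "C \<subseteq> {y. 0 \<le> a + w \<bullet> y}"
    using assms(1) f by (auto simp: pos_aff_def less_imp_le)
  moreover have "closed {y. 0 \<le> a + w \<bullet> y}"
    by (intro closed_Collect_le continuous_intros)
  ultimately have "closure C \<subseteq> {y. 0 \<le> a + w \<bullet> y}"
    by (rule closure_minimal)
  then show ?thesis
    using assms(2) f by auto
qed

text \<open>
  Separate y from C by a hyperplane; since C is open, its points lie strictly on one side.
\<close>

lemma pos_aff_separates:
  fixes C :: "'a::euclidean_space set"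
  assumes "open C" "convex C" "C \<noteq> {}" "y \<notin> C"
  obtains f where "f \<in> pos_aff C" "f y \<le> 0"
proof -
  obtain a b where ab: "a \<noteq> 0" "\<And>x. x \<in> {y} \<Longrightarrow> a \<bullet> x \<le> b" "\<And>x. x \<in> C \<Longrightarrow> b \<le> a \<bullet> x"
    using separating_hyperplane_sets[of "{y}" C] assms by auto
  have "b < a \<bullet> x" if "x \<in> C" for x
  proof -
    obtain e where e: "e > 0" "ball x e \<subseteq> C"
      using openE[OF assms(1) \<open>x \<in> C\<close>] by blast
    \<comment> \<open>Openness makes the inequality strict: move a little against the normal vector.\<close>
    have "x - (e / (2 * norm a)) *\<^sub>R a \<in> ball x e"
      using ab(1) e by (simp add: dist_norm)
    then have "b \<le> a \<bullet> (x - (e / (2 * norm a)) *\<^sub>R a)"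
      using ab(3) e by blast
    moreover have "(e / (2 * norm a)) * (a \<bullet> a) > 0"
      using ab(1) e by simp
    ultimately show ?thesis
      by (simp add: inner_diff_right)
  qed
  then have "(\<lambda>x. - b + a \<bullet> x) \<in> pos_aff C"
    by (intro pos_affI) simp
  then show thesis
    using that ab(2)[of y] by simp
qed

lemma mem_iff_pos_aff:
  fixes C :: "'a::euclidean_space set"
  assumes "open C" "convex C" "C \<noteq> {}"
  shows "y \<in> C \<longleftrightarrow> (\<forall>f\<in>pos_aff C. 0 < f y)"
  using pos_aff_separates[OF assms] pos_affD by (metis linorder_not_le)

lemma pos_aff_supports:
  fixes C :: "'a::euclidean_space set"
  assumes "open C" "convex C" "C \<noteq> {}" "b \<in> frontier C"
  obtains f where "f \<in> pos_aff C" "f b = 0"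
proof -
  have "b \<notin> C" "b \<in> closure C"
    using assms by (auto simp: frontier_def interior_open)
  then show thesis
    using pos_aff_separates[OF assms(1-3)] pos_aff_closure_nonneg that by (metis antisym)
qed

text \<open>
  An open segment from a point of C to a point of the closure lies in C, so a ray that leaves C
  meets the frontier once and never returns. Both the exit ratio and the exit time in the
  Finsler metric are defined by a choice of such a frontier point; this dichotomy evaluates
  them.
\<close>

lemma ray_dichotomy:
  fixes C :: "'a::euclidean_space set"
  assumes "open C" "convex C" "p \<in> C"
  obtains
    (infinite) "\<And>t. t \<ge> 0 \<Longrightarrow> p + t *\<^sub>R v \<in> C"
  | (finite) T where "T > 0" "\<And>t. t > 0 \<Longrightarrow> p + t *\<^sub>R v \<in> C \<longleftrightarrow> t < T"
      "\<And>t. t > 0 \<Longrightarrow> p + t *\<^sub>R v \<in> frontier C \<longleftrightarrow> t = T"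
proof (cases "\<forall>t\<ge>0. p + t *\<^sub>R v \<in> C")
  case True
  then show thesis by (intro infinite) auto
next
  case False
  then obtain s where s: "s \<ge> 0" "p + s *\<^sub>R v \<notin> C"
    by auto
  let ?S = "(\<lambda>t. p + t *\<^sub>R v) ` {0..s}"
  have "connected ?S"
    by (intro connected_continuous_image continuous_intros) auto
  moreover have "p \<in> ?S"
    using s by (force intro: image_eqI[of _ _ 0])
  moreover have "p + s *\<^sub>R v \<in> ?S"
    using s by auto
  ultimately have "?S \<inter> frontier C \<noteq> {}"
    using s assms by (intro connected_Int_frontier) auto
  then obtain T where T: "T \<ge> 0" "p + T *\<^sub>R v \<in> frontier C"
    by auto
  have notC: "z \<notin> C" if "z \<in> frontier C" for z
    using that assms by (simp add: frontier_def interior_open)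
  have "T \<noteq> 0"
    using T notC assms by fastforce
  then have "T > 0" and "v \<noteq> 0"
    using T assms(3) notC[of p] by (auto simp: less_le)
  have before: "p + t *\<^sub>R v \<in> C" if "p + u *\<^sub>R v \<in> closure C" "0 < t" "t < u" for t u
  proof -
    have "p + t *\<^sub>R v = (1 - t/u) *\<^sub>R p + (t/u) *\<^sub>R (p + u *\<^sub>R v)"
      using that by (simp add: algebra_simps)
    moreover have "p \<noteq> p + u *\<^sub>R v"
      using that \<open>v \<noteq> 0\<close> by auto
    ultimately have "p + t *\<^sub>R v \<in> open_segment p (p + u *\<^sub>R v)"
      unfolding in_segment using that by (intro conjI exI[of _ "t/u"]) auto
    then show ?thesis
      using in_interior_closure_convex_segment[OF assms(2) _ that(1), of p] assms interior_open
      by blast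
  qed
  have cl: "p + T *\<^sub>R v \<in> closure C"
    using T by (simp add: frontier_def)
  have 1: "p + t *\<^sub>R v \<in> C \<longleftrightarrow> t < T" if "t > 0" for t
  proof
    assume C: "p + t *\<^sub>R v \<in> C"
    show "t < T"
    proof (rule ccontr)
      assume "\<not> t < T"
      then have "t = T \<or> T < t" by auto
      moreover have "p + t *\<^sub>R v \<in> closure C"
        using C closure_subset by blast
      ultimately have "p + T *\<^sub>R v \<in> C"
        using C before \<open>T > 0\<close> by blast
      then show False
        using T(2) notC by blast
    qed
  qed (use before[OF cl] that in blast)
  have 2: "p + t *\<^sub>R v \<in> frontier C \<longleftrightarrow> t = T" if "t > 0" for t
  proof
    assume fr: "p + t *\<^sub>R v \<in> frontier C"
    then have "\<not> t < T"
      using 1[OF that] notC by blast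
    moreover have "\<not> T < t"
    proof
      assume "T < t"
      moreover have "p + t *\<^sub>R v \<in> closure C"
        using fr by (simp add: frontier_def)
      ultimately have "p + T *\<^sub>R v \<in> C"
        using before \<open>T > 0\<close> by blast
      then show False
        using T(2) notC by blast
    qed
    ultimately show "t = T" by simp
  qed (use T in simp)
  show thesis
    by (rule finite[OF \<open>T > 0\<close> 1 2])
qed

lemma beyond_segment_iff:
  fixes p q :: "'a::euclidean_space"
  assumes "p \<noteq> q"
  shows "q \<in> open_segment p b \<longleftrightarrow> (\<exists>t>1. b = p + t *\<^sub>R (q - p))"
proof
  assume "q \<in> open_segment p b"
  then obtain u where u: "0 < u" "u < 1" "q = (1 - u) *\<^sub>R p + u *\<^sub>R b"
    by (auto simp: in_segment)
  have "q - p = u *\<^sub>R (b - p)"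
    using u by (simp add: algebra_simps)
  then have "b = p + (1/u) *\<^sub>R (q - p)"
    using u by simp
  then show "\<exists>t>1. b = p + t *\<^sub>R (q - p)"
    using u by (intro exI[of _ "1/u"]) auto
next
  assume "\<exists>t>1. b = p + t *\<^sub>R (q - p)"
  then obtain t where t: "t > 1" "b = p + t *\<^sub>R (q - p)"
    by auto
  have "(1/t) *\<^sub>R b = (1/t) *\<^sub>R p + (q - p)"
    using t by (simp add: scaleR_add_right)
  then have "q = (1 - 1/t) *\<^sub>R p + (1/t) *\<^sub>R b"
    by (simp add: algebra_simps)
  moreover have "p \<noteq> b"
    using t assms by simp
  ultimately show "q \<in> open_segment p b"
    unfolding in_segment using t by (intro conjI exI[of _ "1/t"]) auto
qed

lemma exit_ratio_self: "exit_ratio C p p = 1"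
proof -
  have "p \<notin> open_segment p b" for b
    by (simp add: open_segment_def)
  then show ?thesis by (simp add: exit_ratio_def)
qed

text \<open>
  The frontier point beyond q is written as p + T (q - p). The case T =
  \<open>\<infinity>\<close>, where the ratio is 1 by convention, is separate.
\<close>

lemma exit_ratio_cases:
  fixes C :: "'a::euclidean_space set"
  assumes C: "open C" "convex C" and pq: "p \<in> C" "q \<in> C"
  obtains
    (trivial) "exit_ratio C p q = 1" "\<And>t. t \<ge> 0 \<Longrightarrow> p + t *\<^sub>R (q - p) \<in> C"
  | (boundary) T where "T > 1" "p + T *\<^sub>R (q - p) \<in> frontier C" "exit_ratio C p q = T / (T - 1)"
proof (cases "p = q")
  case True
  then show thesis
    using trivial[unfolded True] pq exit_ratio_self[of C q] by simp
next
  case False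
  show thesis
    using C pq(1)
  proof (cases rule: ray_dichotomy[where v = "q - p"])
    case infinite
    then have "\<not> (\<exists>b. b \<in> frontier C \<and> q \<in> open_segment p b)"
      using C unfolding beyond_segment_iff[OF False] frontier_def interior_open[OF C(1)] by force
    then have "exit_ratio C p q = 1"
      unfolding exit_ratio_def by (rule if_not_P)
    then show ?thesis
      using infinite by (intro trivial) auto
  next
    case (finite T)
    have "T > 1"
      using finite(2)[of 1] pq by simp
    let ?b = "p + T *\<^sub>R (q - p)"
    have b: "(b \<in> frontier C \<and> q \<in> open_segment p b) \<longleftrightarrow> b = ?b" for b
      using finite(3) \<open>T > 1\<close> unfolding beyond_segment_iff[OF False] by force
    have "q - ?b = (1 - T) *\<^sub>R (q - p)"
      by (simp add: algebra_simps)
    then have "norm (q - ?b) = (T - 1) * norm (q - p)"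
      using \<open>T > 1\<close> by simp
    moreover have "norm (p - ?b) = T * norm (q - p)"
      using \<open>T > 1\<close> by simp
    ultimately have "exit_ratio C p q = T / (T - 1)"
      unfolding exit_ratio_def b using False by simp
    then show ?thesis
      using boundary \<open>T > 1\<close> b by blast
  qed
qed

text \<open>
  Together with \<open>exit_ratio_attained\<close> this says that the exit ratio of p and q is
  the maximum of f p / f q over the positive affine functions f. For a frontier point b beyond
  q, f b is nonnegative and f is affine along the line; if there is none, f is positive on a
  whole ray and so does not decrease along it.
\<close>

lemma exit_ratio_bound:
  fixes C :: "'a::euclidean_space set"
  assumes C: "open C" "convex C" and pq: "p \<in> C" "q \<in> C" and f: "f \<in> pos_aff C"
  shows "f p \<le> exit_ratio C p q * f q"
  using C pq
proof (cases rule: exit_ratio_cases)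
  case trivial
  have "f p \<le> f q"
  proof (rule ccontr)
    assume *: "\<not> f p \<le> f q"
    have "0 < f p" using f pq pos_affD by blast
    \<comment> \<open>At this parameter a function that decreases from p to q has the value 0.\<close>
    then have "0 < f (p + (f p / (f p - f q)) *\<^sub>R (q - p))"
      using * trivial(2) f by (intro pos_affD[OF f]) auto
    also have "\<dots> = f p + (f p / (f p - f q)) * (f q - f p)"
      unfolding pos_aff_line[OF f] by (simp add: algebra_simps diff_divide_distrib)
    also have "f p / (f p - f q) * (f q - f p) = - f p"
      using * by (simp add: field_simps)
    also have "f p + - f p = 0"
      by simp
    finally show False by simp
  qed
  then show ?thesis
    using trivial by simp
next
  case (boundary T)
  have "0 \<le> f (p + T *\<^sub>R (q - p))"
    using pos_aff_closure_nonneg[OF f] boundary by (simp add: frontier_def)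
  then have "(T - 1) * f p \<le> T * f q"
    unfolding pos_aff_line[OF f] by (simp add: algebra_simps)
  then have "f p \<le> T / (T - 1) * f q"
    using boundary(1) by (simp add: field_simps)
  then show ?thesis
    using boundary(3) by simp
qed

text \<open>
  A function that supports C at the exit point attains the maximum; for an exit point at
  infinity a constant does.
\<close>

lemma exit_ratio_attained:
  fixes C :: "'a::euclidean_space set"
  assumes C: "open C" "convex C" and pq: "p \<in> C" "q \<in> C"
  obtains f where "f \<in> pos_aff C" "f p = exit_ratio C p q * f q"
  using C pq
proof (cases rule: exit_ratio_cases)
  case trivial
  then show ?thesis
    using that one_in_pos_aff by force
next
  case (boundary T)
  obtain f where f: "f \<in> pos_aff C" "f (p + T *\<^sub>R (q - p)) = 0"
    using pos_aff_supports[OF C _ boundary(2)] pq by auto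
  then have "(T - 1) * f p = T * f q"
    unfolding pos_aff_line[OF f(1)] by (simp add: algebra_simps)
  then have "f p = T / (T - 1) * f q"
    using boundary(1) by (simp add: field_simps)
  then show ?thesis
    using f that boundary(3) by simp
qed

lemma exit_ratio_ge_1:
  fixes C :: "'a::euclidean_space set"
  assumes C: "open C" "convex C" and pq: "p \<in> C" "q \<in> C"
  shows "1 \<le> exit_ratio C p q"
  using exit_ratio_bound[OF assms one_in_pos_aff] by simp

lemma exit_ratio_le:
  fixes C :: "'a::euclidean_space set"
  assumes C: "open C" "convex C" and pq: "p \<in> C" "q \<in> C"
    and "\<And>f. f \<in> pos_aff C \<Longrightarrow> f p \<le> A * f q"
  shows "exit_ratio C p q \<le> A"
proof -
  obtain f where f: "f \<in> pos_aff C" "f p = exit_ratio C p q * f q"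
    using exit_ratio_attained[OF C pq] .
  then have "exit_ratio C p q * f q \<le> A * f q"
    using assms(5)[of f] by simp
  then show ?thesis
    using pos_affD[OF f(1) pq(2)] by simp
qed

lemma hilbert_dist_eq: "hilbert_dist C p q = ln (exit_ratio C q p * exit_ratio C p q) / 2"
proof (cases "p = q")
  case True
  then show ?thesis by (simp add: hilbert_dist_def exit_ratio_def)
qed (simp add: hilbert_dist_def)

lemma hilbert_dist_commute: "hilbert_dist C p q = hilbert_dist C q p"
  by (simp add: hilbert_dist_eq mult.commute)

lemma hilbert_dist_self [simp]: "hilbert_dist C p p = 0"
  by (simp add: hilbert_dist_def)

lemma hilbert_dist_le:
  fixes C :: "'a::euclidean_space set"
  assumes C: "open C" "convex C" and pq: "p \<in> C" "q \<in> C"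
    and A: "\<And>f. f \<in> pos_aff C \<Longrightarrow> f p \<le> A * f q"
    and B: "\<And>f. f \<in> pos_aff C \<Longrightarrow> f q \<le> B * f p"
  shows "hilbert_dist C p q \<le> ln (A * B) / 2"
proof -
  have ge: "1 \<le> exit_ratio C p q" "1 \<le> exit_ratio C q p"
    using exit_ratio_ge_1 assms by blast+
  have "exit_ratio C q p \<le> B" "exit_ratio C p q \<le> A"
    using exit_ratio_le[OF C pq A] exit_ratio_le[OF C pq(2,1) B] by auto
  then have "exit_ratio C q p * exit_ratio C p q \<le> A * B"
    using ge by (subst mult.commute) (intro mult_mono, auto)
  moreover have "0 < exit_ratio C q p * exit_ratio C p q"
    using ge by (intro mult_pos_pos) auto
  ultimately show ?thesis
    unfolding hilbert_dist_eq by simp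
qed

text \<open>
  The Hilbert distance is half the logarithm of the largest cross ratio f p g q / (f q g p) of
  two positive affine functions. This lemma and \<open>hilbert_dist_le\<close> turn estimates of
  positive affine functions into estimates of the distance.
\<close>

lemma hilbert_dist_ge:
  fixes C :: "'a::euclidean_space set"
  assumes C: "open C" "convex C" and pq: "p \<in> C" "q \<in> C"
    and f: "f \<in> pos_aff C" and g: "g \<in> pos_aff C"
  shows "ln (f p / f q * (g q / g p)) / 2 \<le> hilbert_dist C p q"
proof -
  have pos: "0 < f p" "0 < f q" "0 < g p" "0 < g q"
    using f g pq pos_affD by blast+
  have "f p / f q \<le> exit_ratio C p q" "g q / g p \<le> exit_ratio C q p"
    using exit_ratio_bound[OF C pq f] exit_ratio_bound[OF C pq(2,1) g] pos
    by (simp_all add: field_simps)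
  moreover have "0 \<le> exit_ratio C p q"
    using exit_ratio_ge_1[OF C pq] by simp
  ultimately have "f p / f q * (g q / g p) \<le> exit_ratio C p q * exit_ratio C q p"
    using pos by (intro mult_mono) auto
  moreover have "0 < f p / f q * (g q / g p)"
    using pos by simp
  ultimately show ?thesis
    unfolding hilbert_dist_eq by (simp add: mult.commute)
qed

lemma pos_aff_le_exp_dist:
  fixes C :: "'a::euclidean_space set"
  assumes C: "open C" "convex C" and pq: "p \<in> C" "q \<in> C" and f: "f \<in> pos_aff C"
  shows "f p \<le> exp (2 * hilbert_dist C p q) * f q"
proof -
  have pos: "0 < f p" "0 < f q"
    using f pq pos_affD by blast+
  have "ln (f p / f q) \<le> 2 * hilbert_dist C p q"
    using hilbert_dist_ge[OF C pq f one_in_pos_aff] by simp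
  then have "f p / f q \<le> exp (2 * hilbert_dist C p q)"
    using pos by (metis divide_pos_pos exp_le_cancel_iff exp_ln)
  then show ?thesis
    using pos by (simp add: field_simps)
qed

text \<open>
  The maximal quotients f p / f q are submultiplicative.
\<close>

lemma hilbert_dist_triangle:
  fixes C :: "'a::euclidean_space set"
  assumes C: "open C" "convex C" and pqr: "p \<in> C" "q \<in> C" "r \<in> C"
  shows "hilbert_dist C p r \<le> hilbert_dist C p q + hilbert_dist C q r"
proof -
  have *: "f a \<le> exit_ratio C a b * exit_ratio C b c * f c"
    if "a \<in> C" "b \<in> C" "c \<in> C" "f \<in> pos_aff C" for f a b c
  proof -
    have "f a \<le> exit_ratio C a b * f b"
      using exit_ratio_bound[OF C] that by blast
    also have "\<dots> \<le> exit_ratio C a b * (exit_ratio C b c * f c)"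
      using exit_ratio_bound[OF C that(2,3,4)] exit_ratio_ge_1[OF C that(1,2)]
      by (intro mult_left_mono) auto
    finally show ?thesis
      by (simp add: mult.assoc)
  qed
  have ge: "1 \<le> exit_ratio C p q" "1 \<le> exit_ratio C q p" "1 \<le> exit_ratio C q r" "1 \<le> exit_ratio C r q"
    using exit_ratio_ge_1[OF C] pqr by blast+
  have "hilbert_dist C p r \<le>
      ln (exit_ratio C p q * exit_ratio C q r * (exit_ratio C r q * exit_ratio C q p)) / 2"
    by (rule hilbert_dist_le[OF C]) (use * pqr in auto)
  also have "\<dots> = hilbert_dist C p q + hilbert_dist C q r"
    unfolding hilbert_dist_eq using ge by (simp add: ln_mult_pos field_simps)
  finally show ?thesis .
qed

lemma pos_aff_shift:
  assumes "f \<in> pos_aff C"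
  shows "f (p + c *\<^sub>R v) = f p + c * (f (p + v) - f p)"
  using assms by (elim pos_affE) (simp add: algebra_simps inner_simps)

lemma pos_aff_reflect:
  assumes "f \<in> pos_aff C"
  shows "f (p - v) = 2 * f p - f (p + v)"
  using assms by (elim pos_affE) (simp add: algebra_simps inner_simps)

section \<open>Macbeath regions and unit tangent balls\<close>

text \<open>
  The vectors x for which such a bound holds form a subspace that contains B.
\<close>

lemma abs_inner_le_sum_of_span:
  fixes x :: "'a::euclidean_space"
  assumes "finite B" "x \<in> span B"
  shows "\<exists>K\<ge>0. \<forall>y. \<bar>x \<bullet> y\<bar> \<le> K * (\<Sum>w\<in>B. \<bar>w \<bullet> y\<bar>)"
  using assms(2)
proof (induction rule: span_induct)
  case base
  show ?case
    unfolding subspace_def Ball_def mem_Collect_eq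
  proof (intro conjI allI impI; (elim exE conjE)?)
    show "\<exists>K\<ge>0. \<forall>y. \<bar>0 \<bullet> y\<bar> \<le> K * (\<Sum>w\<in>B. \<bar>w \<bullet> y\<bar>)"
      by (intro exI[of _ 0]) simp
  next
    fix x x' :: 'a and K K' :: real
    assume K: "0 \<le> K" "\<forall>y. \<bar>x \<bullet> y\<bar> \<le> K * (\<Sum>w\<in>B. \<bar>w \<bullet> y\<bar>)"
      and "0 \<le> K'" and K': "\<forall>y. \<bar>x' \<bullet> y\<bar> \<le> K' * (\<Sum>w\<in>B. \<bar>w \<bullet> y\<bar>)"
    have "\<bar>(x + x') \<bullet> y\<bar> \<le> (K + K') * (\<Sum>w\<in>B. \<bar>w \<bullet> y\<bar>)" for y
    proof -
      have "\<bar>(x + x') \<bullet> y\<bar> \<le> \<bar>x \<bullet> y\<bar> + \<bar>x' \<bullet> y\<bar>"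
        by (simp add: inner_add_left)
      then show ?thesis
        using K(2)[rule_format, of y] K'[rule_format, of y] by (simp add: distrib_right)
    qed
    then show "\<exists>K\<ge>0. \<forall>y. \<bar>(x + x') \<bullet> y\<bar> \<le> K * (\<Sum>w\<in>B. \<bar>w \<bullet> y\<bar>)"
      using K(1) \<open>0 \<le> K'\<close> by (intro exI[of _ "K + K'"]) auto
  next
    fix c :: real and x :: 'a and K :: real
    assume K: "0 \<le> K" "\<forall>y. \<bar>x \<bullet> y\<bar> \<le> K * (\<Sum>w\<in>B. \<bar>w \<bullet> y\<bar>)"
    have "\<bar>(c *\<^sub>R x) \<bullet> y\<bar> \<le> \<bar>c\<bar> * K * (\<Sum>w\<in>B. \<bar>w \<bullet> y\<bar>)" for y
      using mult_left_mono[OF K(2)[rule_format, of y], of "\<bar>c\<bar>"] by (simp add: abs_mult mult.assoc)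
    then show "\<exists>K\<ge>0. \<forall>y. \<bar>(c *\<^sub>R x) \<bullet> y\<bar> \<le> K * (\<Sum>w\<in>B. \<bar>w \<bullet> y\<bar>)"
      using K by (intro exI[of _ "\<bar>c\<bar> * K"]) auto
  qed
next
  case (step x)
  have "\<bar>x \<bullet> y\<bar> \<le> (\<Sum>w\<in>B. \<bar>w \<bullet> y\<bar>)" for y
    using step assms(1) by (intro member_le_sum) auto
  then show ?case
    by (intro exI[of _ 1]) auto
qed

text \<open>
  This is how the absence of lines enters. If the linear parts of the positive affine functions
  did not span the space, a vector u orthogonal to all of them would give a line p + t u on
  which every such function is constant, hence a line in C. So finitely many positive affine
  functions control all coordinates, and a + w \<open>\<bullet>\<close> y is their sum plus a
  constant. The condition that a is nonzero makes (y, s) \<open>\<mapsto>\<close> (y, a s + w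
  \<open>\<bullet>\<close> y) invertible, which \<open>projectively_bounded\<close> needs.
\<close>

lemma hilbert_geometry_pos_aff_dominates_norm:
  fixes C :: "'a::euclidean_space set"
  assumes C: "hilbert_geometry C"
  shows "\<exists>a w K. a \<noteq> 0 \<and> (\<forall>y\<in>C. 0 < a + w \<bullet> y \<and> norm y \<le> K * (a + w \<bullet> y))"
proof -
  define W where "W = {w. \<exists>a. (\<lambda>y. a + w \<bullet> y) \<in> pos_aff C}"
  have C': "open C" "convex C" "C \<noteq> {}"
    using C by (auto simp: hilbert_geometry_def)
  have "span W = UNIV"
  proof (rule ccontr)
    assume "span W \<noteq> UNIV"
    then obtain u where u: "u \<noteq> 0" "\<And>w. w \<in> W \<Longrightarrow> u \<bullet> w = 0"
      using span_not_UNIV_orthogonal[of W] by (meson span_base)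
    obtain p where p: "p \<in> C" using C' by auto
    have "p + t *\<^sub>R u \<in> C" for t
      unfolding mem_iff_pos_aff[OF C']
    proof
      fix f assume f: "f \<in> pos_aff C"
      then obtain a w where aw: "\<And>y. f y = a + w \<bullet> y" using pos_affE by blast
      then have "f = (\<lambda>y. a + w \<bullet> y)" by blast
      then have "w \<in> W" using f unfolding W_def by blast
      then have "f (p + t *\<^sub>R u) = f p"
        using u(2)[of w] by (simp add: aw inner_simps inner_commute)
      then show "0 < f (p + t *\<^sub>R u)" using f p pos_affD by fastforce
    qed
    then show False using C u(1) unfolding hilbert_geometry_def by blast
  qed
  then obtain B where B: "B \<subseteq> W" "independent B" "span B = UNIV"
    using basis_exists[of W] by (metis span_mono span_span top.extremum_uniqueI)
  have finB: "finite B" using B(2) by (rule independent_imp_finite)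
  have "\<forall>i. \<exists>k\<ge>0. \<forall>y. \<bar>i \<bullet> y\<bar> \<le> k * (\<Sum>w\<in>B. \<bar>w \<bullet> y\<bar>)"
    using abs_inner_le_sum_of_span[OF finB] B(3) by blast
  then obtain k where k: "\<And>i. k i \<ge> 0" "\<And>i y. \<bar>i \<bullet> y\<bar> \<le> k i * (\<Sum>w\<in>B. \<bar>w \<bullet> y\<bar>)"
    by metis
  have norm_le: "norm y \<le> sum k Basis * (\<Sum>w\<in>B. \<bar>w \<bullet> y\<bar>)" for y
  proof -
    have "norm y \<le> (\<Sum>i\<in>Basis. \<bar>y \<bullet> i\<bar>)" by (rule norm_le_l1)
    also have "\<dots> \<le> (\<Sum>i\<in>Basis. k i * (\<Sum>w\<in>B. \<bar>w \<bullet> y\<bar>))"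
      by (intro sum_mono) (metis k(2) inner_commute)
    finally show ?thesis by (simp add: sum_distrib_right)
  qed
  have "\<forall>w\<in>B. \<exists>a. (\<lambda>y. a + w \<bullet> y) \<in> pos_aff C"
    using B(1) W_def by blast
  then obtain a where a: "\<And>w. w \<in> B \<Longrightarrow> (\<lambda>y. a w + w \<bullet> y) \<in> pos_aff C"
    by metis
  define A where "A = (\<Sum>w\<in>B. \<bar>a w\<bar>)"
  have A0: "A \<ge> 0" by (simp add: A_def sum_nonneg)
  \<comment> \<open>At least 1, chosen so that the constant term of the sum is nonzero.\<close>
  define k0 :: real where "k0 = (if 1 + sum a B = 0 then 2 else 1)"
  have k0: "k0 \<ge> 1" "k0 + sum a B \<noteq> 0" by (auto simp: k0_def)
  define D where "D y = k0 + sum a B + (\<Sum>B) \<bullet> y" for y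
  have Dsum: "D y = k0 + (\<Sum>w\<in>B. a w + w \<bullet> y)" for y
    by (simp add: D_def sum.distrib inner_sum_left)
  have D1: "1 + (\<Sum>w\<in>B. a w + w \<bullet> y) \<le> D y" "0 \<le> (\<Sum>w\<in>B. a w + w \<bullet> y)" if "y \<in> C" for y
  proof -
    show "0 \<le> (\<Sum>w\<in>B. a w + w \<bullet> y)"
      by (intro sum_nonneg) (use a pos_affD[OF _ that] in force)
    show "1 + (\<Sum>w\<in>B. a w + w \<bullet> y) \<le> D y"
      unfolding Dsum using k0 by simp
  qed
  have bound: "(\<Sum>w\<in>B. \<bar>w \<bullet> y\<bar>) \<le> (1 + A) * D y" if "y \<in> C" for y
  proof -
    have "(\<Sum>w\<in>B. \<bar>w \<bullet> y\<bar>) \<le> (\<Sum>w\<in>B. (a w + w \<bullet> y) + \<bar>a w\<bar>)"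
    proof (intro sum_mono)
      fix w assume "w \<in> B"
      then have "0 < a w + w \<bullet> y" using a pos_affD[OF _ that] by force
      then show "\<bar>w \<bullet> y\<bar> \<le> (a w + w \<bullet> y) + \<bar>a w\<bar>" by linarith
    qed
    also have "\<dots> = (\<Sum>w\<in>B. a w + w \<bullet> y) + A" by (simp add: sum.distrib A_def)
    also have "\<dots> \<le> D y + A * D y"
      using D1[OF that] A0 mult_left_mono[of 1 "D y" A] by linarith
    finally show ?thesis by (simp add: algebra_simps)
  qed
  show ?thesis
  proof (rule exI[of _ "k0 + sum a B"], rule exI[of _ "\<Sum>B"],
      rule exI[of _ "sum k Basis * (1 + A)"], intro conjI ballI)
    show "k0 + sum a B \<noteq> 0" by (rule k0)
    fix y assume y: "y \<in> C"
    show "0 < k0 + sum a B + (\<Sum>B) \<bullet> y" using D1[OF y] by (simp add: D_def)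
    have "norm y \<le> sum k Basis * ((1 + A) * D y)"
      using norm_le[of y] mult_left_mono[OF bound[OF y], of "sum k Basis"] k(1)
      by (meson order_trans sum_nonneg)
    then show "norm y \<le> sum k Basis * (1 + A) * (k0 + sum a B + (\<Sum>B) \<bullet> y)"
      by (simp add: D_def mult.assoc)
  qed
qed

text \<open>
  The Macbeath region of C at p, translated to the origin: the largest subset of C - p that is
  symmetric about 0.
\<close>

definition macbeath :: "'a::euclidean_space set \<Rightarrow> 'a \<Rightarrow> 'a set" where
  "macbeath C p = {v. p + v \<in> C \<and> p - v \<in> C}"

lemma macbeath_zero: "p \<in> C \<Longrightarrow> 0 \<in> macbeath C p"
  by (simp add: macbeath_def)

lemma open_translated_preimage:
  fixes C :: "'a::euclidean_space set"
  shows "open C \<Longrightarrow> open {v. p + c *\<^sub>R v \<in> C}"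
  using open_vimage[of C "\<lambda>v. p + c *\<^sub>R v"] by (simp add: vimage_def continuous_intros)

lemma open_macbeath: "open C \<Longrightarrow> open (macbeath C p)"
  using open_translated_preimage[of C p 1] open_translated_preimage[of C p "-1"]
  by (simp add: macbeath_def open_Collect_conj)

text \<open>
  If p + v and p - v both lie in C, a positive affine function is at p + v at most twice its
  value at p; apply this to the function that dominates the norm.
\<close>

lemma bounded_macbeath:
  fixes C :: "'a::euclidean_space set"
  assumes "hilbert_geometry C" "p \<in> C"
  shows "bounded (macbeath C p)"
proof -
  obtain a w K where D: "\<And>y. y \<in> C \<Longrightarrow> 0 < a + w \<bullet> y"
    "\<And>y. y \<in> C \<Longrightarrow> norm y \<le> K * (a + w \<bullet> y)"
    using hilbert_geometry_pos_aff_dominates_norm[OF assms(1)] by blast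
  have "norm v \<le> \<bar>K\<bar> * (2 * (a + w \<bullet> p)) + norm p" if "v \<in> macbeath C p" for v
  proof -
    have v: "p + v \<in> C" "p - v \<in> C" using that by (auto simp: macbeath_def)
    have "norm (p + v) \<le> K * (a + w \<bullet> (p + v))" using D(2) v by blast
    also have "\<dots> \<le> \<bar>K\<bar> * (a + w \<bullet> (p + v))"
      using D(1)[OF v(1)] by (intro mult_right_mono) auto
    also have "\<dots> \<le> \<bar>K\<bar> * (2 * (a + w \<bullet> p))"
      using D(1)[OF v(2)] by (intro mult_left_mono) (auto simp: inner_simps)
    finally show ?thesis
      using norm_triangle_ineq4[of "p + v" p] by simp
  qed
  then show ?thesis unfolding bounded_iff by blast
qed

text \<open>
  A vector v is in the Macbeath region at q exactly if every positive affine function f changes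
  by less than f q along v. Hence a comparison of the values f q and f p compares the regions.
\<close>

lemma macbeath_scale:
  fixes C :: "'a::euclidean_space set"
  assumes C: "open C" "convex C" "C \<noteq> {}" and A: "A > 0"
    and le: "\<And>f. f \<in> pos_aff C \<Longrightarrow> f q \<le> A * f p" and v: "v \<in> macbeath C q"
  shows "(1 / A) *\<^sub>R v \<in> macbeath C p"
proof -
  have *: "0 < f (p + c *\<^sub>R v)" if f: "f \<in> pos_aff C" and c: "\<bar>c\<bar> = 1 / A" for f c
  proof -
    have "0 < f (q + v)" "0 < f (q - v)"
      using v pos_affD[OF f] by (auto simp: macbeath_def)
    then have "\<bar>f (q + v) - f q\<bar> < f q"
      using pos_aff_reflect[OF f, of q v] by linarith
    also have "\<dots> \<le> A * f p" using le f by blast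
    finally have "\<bar>c * (f (q + v) - f q)\<bar> < f p"
      using A unfolding abs_mult c by (simp add: field_simps)
    moreover have "f (q + v) - f q = f (p + v) - f p"
      using f by (elim pos_affE) (simp add: inner_simps)
    ultimately have "\<bar>c * (f (p + v) - f p)\<bar> < f p" by simp
    then show ?thesis unfolding pos_aff_shift[OF f] by (simp add: abs_less_iff)
  qed
  have "p + (1 / A) *\<^sub>R v \<in> C" "p + (- (1 / A)) *\<^sub>R v \<in> C"
    unfolding mem_iff_pos_aff[OF C] using *[of _ "1 / A"] *[of _ "- (1 / A)"] A by auto
  then show ?thesis by (simp add: macbeath_def)
qed

lemma inv_exit_time_less_iff:
  fixes C :: "'a::euclidean_space set"
  assumes "open C" "convex C" "p \<in> C" "a > 0"
  shows "inv_exit_time C p v < a \<longleftrightarrow> p + (1 / a) *\<^sub>R v \<in> C"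
  using assms(1-3)
proof (cases rule: ray_dichotomy[where v = v])
  case infinite
  then have "\<not> (\<exists>t>0. p + t *\<^sub>R v \<in> frontier C)"
    using assms by (auto simp: frontier_def interior_open)
  then have "inv_exit_time C p v = 0"
    unfolding inv_exit_time_def by (rule if_not_P)
  then show ?thesis using infinite[of "1 / a"] assms by simp
next
  case (finite T)
  then have "(t > 0 \<and> p + t *\<^sub>R v \<in> frontier C) \<longleftrightarrow> t = T" for t
    by blast
  then have inv: "inv_exit_time C p v = 1 / T"
    unfolding inv_exit_time_def by auto
  have "p + (1 / a) *\<^sub>R v \<in> C \<longleftrightarrow> 1 / a < T"
    using finite(2)[of "1 / a"] assms by simp
  then show ?thesis
    unfolding inv using assms finite(1) by (simp add: field_simps)
qed

lemma inv_exit_time_nonneg: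
  fixes C :: "'a::euclidean_space set"
  assumes "open C" "convex C" "p \<in> C"
  shows "0 \<le> inv_exit_time C p v"
  using assms
proof (cases rule: ray_dichotomy[where v = v])
  case infinite
  then have "\<not> (\<exists>t>0. p + t *\<^sub>R v \<in> frontier C)"
    using assms by (auto simp: frontier_def interior_open)
  then have "inv_exit_time C p v = 0"
    unfolding inv_exit_time_def by (rule if_not_P)
  then show ?thesis by simp
next
  case (finite T)
  then have "(t > 0 \<and> p + t *\<^sub>R v \<in> frontier C) \<longleftrightarrow> t = T" for t
    by blast
  then show ?thesis
    unfolding inv_exit_time_def using finite(1) by auto
qed

text \<open>
  The sum of the inverse exit times in the directions v and -v is less than 2 exactly if there
  are bounds a and b for them with a + b \<open>\<le>\<close> 2. This exhibits the tangent ball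
  as a union of open sets, so that it is measurable.
\<close>

lemma tangent_ball_eq:
  fixes C :: "'a::euclidean_space set"
  assumes C: "open C" "convex C" "p \<in> C"
  shows "tangent_ball C p =
    (\<Union>(a, b)\<in>{(a, b). 0 < a \<and> 0 < b \<and> a + b \<le> 2}.
       {v. p + (1 / a) *\<^sub>R v \<in> C} \<inter> {v. p + (- 1 / b) *\<^sub>R v \<in> C})"
    (is "_ = ?U")
proof (intro set_eqI)
  fix v
  have U: "v \<in> ?U \<longleftrightarrow> (\<exists>a b. 0 < a \<and> 0 < b \<and> a + b \<le> 2 \<and>
      inv_exit_time C p v < a \<and> inv_exit_time C p (- v) < b)"
  proof -
    have "v \<in> ?U \<longleftrightarrow> (\<exists>a b. 0 < a \<and> 0 < b \<and> a + b \<le> 2 \<and>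
        p + (1 / a) *\<^sub>R v \<in> C \<and> p + (1 / b) *\<^sub>R (- v) \<in> C)"
      by simp
    then show ?thesis
      by (simp add: inv_exit_time_less_iff[OF C] cong: conj_cong)
  qed
  show "v \<in> tangent_ball C p \<longleftrightarrow> v \<in> ?U"
  proof (cases "v = 0")
    case True
    then show ?thesis
      using C(3) by (auto simp: tangent_ball_def finsler_def intro!: exI[of _ 1])
  next
    case False
    have nn: "0 \<le> inv_exit_time C p v" "0 \<le> inv_exit_time C p (- v)"
      using inv_exit_time_nonneg[OF C] by auto
    have "v \<in> tangent_ball C p \<longleftrightarrow> inv_exit_time C p v + inv_exit_time C p (- v) < 2"
      using False by (simp add: tangent_ball_def finsler_def)
    also have "\<dots> \<longleftrightarrow> v \<in> ?U"
      unfolding U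
    proof
      assume *: "inv_exit_time C p v + inv_exit_time C p (- v) < 2"
      define e where "e = (2 - (inv_exit_time C p v + inv_exit_time C p (- v))) / 2"
      have "e > 0" using * by (simp add: e_def)
      moreover have "(inv_exit_time C p v + e) + (inv_exit_time C p (- v) + e) = 2"
        by (simp add: e_def field_simps)
      ultimately show "\<exists>a b. 0 < a \<and> 0 < b \<and> a + b \<le> 2 \<and>
          inv_exit_time C p v < a \<and> inv_exit_time C p (- v) < b"
        using nn by - (rule exI[of _ "inv_exit_time C p v + e"], rule exI[of _ "inv_exit_time C p (- v) + e"], auto)
    next
      assume "\<exists>a b. 0 < a \<and> 0 < b \<and> a + b \<le> 2 \<and>
          inv_exit_time C p v < a \<and> inv_exit_time C p (- v) < b"
      then show "inv_exit_time C p v + inv_exit_time C p (- v) < 2"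
        by (elim exE conjE) linarith
    qed
    finally show ?thesis .
  qed
qed

lemma open_tangent_ball:
  fixes C :: "'a::euclidean_space set"
  assumes "open C" "convex C" "p \<in> C"
  shows "open (tangent_ball C p)"
  unfolding tangent_ball_eq[OF assms]
  by (intro open_UN ballI) (simp only: split_beta, intro open_Int open_translated_preimage assms)

lemma macbeath_subset_tangent_ball:
  fixes C :: "'a::euclidean_space set"
  assumes "open C" "convex C" "p \<in> C"
  shows "macbeath C p \<subseteq> tangent_ball C p"
  unfolding tangent_ball_eq[OF assms] macbeath_def by (auto intro!: exI[of _ 1])

text \<open>
  If the sum of two nonnegative numbers is less than 2, so is each of them. With
  \<open>macbeath_subset_tangent_ball\<close>, the tangent ball lies between the Macbeath region
  and its double; therefore the Busemann density agrees with the inverse volume of the Macbeath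
  region up to a factor that depends only on the dimension.
\<close>

lemma tangent_ball_subset_macbeath:
  fixes C :: "'a::euclidean_space set"
  assumes C: "open C" "convex C" "p \<in> C" and v: "v \<in> tangent_ball C p"
  shows "(1 / 2) *\<^sub>R v \<in> macbeath C p"
proof (cases "v = 0")
  case True
  then show ?thesis using C by (simp add: macbeath_def)
next
  case False
  then have "inv_exit_time C p v < 2" "inv_exit_time C p (- v) < 2"
    using v inv_exit_time_nonneg[OF C, of v] inv_exit_time_nonneg[OF C, of "- v"]
    by (auto simp: tangent_ball_def finsler_def)
  then show ?thesis
    using inv_exit_time_less_iff[OF C, of 2] by (simp add: macbeath_def)
qed

section \<open>From the Busemann volume to counting\<close>

lemma inverse_antimono_ennreal: "a \<le> b \<Longrightarrow> inverse b \<le> inverse (a::ennreal)"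
  unfolding less_eq_ennreal.rep_eq inverse_ennreal.rep_eq by (intro ereal_inverse_antimono) auto

lemma emeasure_homothety:
  fixes S :: "'a::euclidean_space set"
  assumes "open S" "c > 0"
  shows "emeasure lborel ((\<lambda>v. p + c *\<^sub>R v) ` S) = ennreal (c ^ DIM('a)) * emeasure lborel S"
proof -
  have "open ((\<lambda>v. p + c *\<^sub>R v) ` S)"
    using assms by (intro open_affinity) auto
  then have "emeasure lborel ((\<lambda>v. p + c *\<^sub>R v) ` S) = emeasure lebesgue ((\<lambda>v. c *\<^sub>R v + p) ` S)"
    by (simp add: add.commute)
  also have "\<dots> = ennreal (c ^ DIM('a)) * emeasure lborel S"
    using emeasure_lebesgue_affine[of c p S] assms by (simp add: ennreal_power)
  finally show ?thesis .
qed

lemma emeasure_macbeath: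
  fixes C :: "'a::euclidean_space set"
  assumes C: "hilbert_geometry C" and p: "p \<in> C"
  shows "emeasure lborel (macbeath C p) = ennreal (measure lborel (macbeath C p))"
    and "0 < measure lborel (macbeath C p)"
proof -
  have fin: "emeasure lborel (macbeath C p) < \<infinity>"
    using bounded_macbeath[OF assms] by (rule emeasure_bounded_finite)
  then show eq: "emeasure lborel (macbeath C p) = ennreal (measure lborel (macbeath C p))"
    by (intro emeasure_eq_ennreal_measure) auto
  have op: "open (macbeath C p)"
    using C by (intro open_macbeath) (simp add: hilbert_geometry_def)
  obtain e where e: "e > 0" "ball 0 e \<subseteq> macbeath C p"
    using openE[OF op macbeath_zero[OF p]] by blast
  have "0 < emeasure lborel (ball (0::'a) e)"
    using e by (simp add: emeasure_ball)
  also have "\<dots> \<le> emeasure lborel (macbeath C p)"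
    using e op by (intro emeasure_mono) auto
  finally show "0 < measure lborel (macbeath C p)"
    unfolding eq by simp
qed

text \<open>
  The tangent ball at q lies in the homothetic image of the Macbeath region at p with factor 2
  A.
\<close>

lemma density_lower_bound:
  fixes C :: "'a::euclidean_space set"
  assumes C: "hilbert_geometry C" and pq: "p \<in> C" "q \<in> C" and A: "A > 0"
    and le: "\<And>f. f \<in> pos_aff C \<Longrightarrow> f q \<le> A * f p"
  shows "ennreal (unit_ball_vol (real DIM('a)) / ((2 * A) ^ DIM('a) * measure lborel (macbeath C p)))
    \<le> emeasure lborel (ball (0::'a) 1) / emeasure lborel (tangent_ball C q)"
proof -
  let ?\<mu> = "measure lborel (macbeath C p)"
  have C': "open C" "convex C" "C \<noteq> {}"
    using C by (auto simp: hilbert_geometry_def)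
  have pos: "0 < ?\<mu>" using emeasure_macbeath[OF C pq(1)] by simp
  have "tangent_ball C q \<subseteq> (\<lambda>v. 0 + (2 * A) *\<^sub>R v) ` macbeath C p"
  proof
    fix v assume "v \<in> tangent_ball C q"
    then have "(1 / A) *\<^sub>R (1 / 2) *\<^sub>R v \<in> macbeath C p"
      using macbeath_scale[where q = q and p = p, OF C' A le] tangent_ball_subset_macbeath[OF C'(1,2) pq(2)] by blast
    then show "v \<in> (\<lambda>v. 0 + (2 * A) *\<^sub>R v) ` macbeath C p"
      using A by (intro image_eqI[of _ _ "(1 / A) *\<^sub>R (1 / 2) *\<^sub>R v"]) auto
  qed
  then have "emeasure lborel (tangent_ball C q)
      \<le> emeasure lborel ((\<lambda>v. 0 + (2 * A) *\<^sub>R v) ` macbeath C p)"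
    using A C' open_affinity[OF open_macbeath[OF C'(1), of p], of "2 * A" 0] by (intro emeasure_mono) auto
  also have "\<dots> = ennreal ((2 * A) ^ DIM('a) * ?\<mu>)"
    using emeasure_homothety[OF open_macbeath[OF C'(1)], of "2 * A" 0 p] A
      emeasure_macbeath(1)[OF C pq(1)] by (simp add: ennreal_mult)
  finally have le: "emeasure lborel (tangent_ball C q) \<le> ennreal ((2 * A) ^ DIM('a) * ?\<mu>)" .
  have "ennreal (unit_ball_vol (real DIM('a)) / ((2 * A) ^ DIM('a) * ?\<mu>))
      = ennreal (unit_ball_vol (real DIM('a))) / ennreal ((2 * A) ^ DIM('a) * ?\<mu>)"
    using A pos by (intro divide_ennreal[symmetric]) auto
  also have "\<dots> \<le> ennreal (unit_ball_vol (real DIM('a))) / emeasure lborel (tangent_ball C q)"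
    unfolding divide_ennreal_def using le by (intro mult_left_mono inverse_antimono_ennreal) auto
  finally show ?thesis by (simp add: emeasure_ball)
qed

text \<open>
  The tangent ball at q contains the Macbeath region at p scaled by 1 / A.
\<close>

lemma density_upper_bound:
  fixes C :: "'a::euclidean_space set"
  assumes C: "hilbert_geometry C" and pq: "p \<in> C" "q \<in> C" and A: "A > 0"
    and le: "\<And>f. f \<in> pos_aff C \<Longrightarrow> f p \<le> A * f q"
  shows "emeasure lborel (ball (0::'a) 1) / emeasure lborel (tangent_ball C q)
    \<le> ennreal (unit_ball_vol (real DIM('a)) * A ^ DIM('a) / measure lborel (macbeath C p))"
proof -
  let ?\<mu> = "measure lborel (macbeath C p)"
  have C': "open C" "convex C" "C \<noteq> {}"
    using C by (auto simp: hilbert_geometry_def)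
  have pos: "0 < ?\<mu>" using emeasure_macbeath[OF C pq(1)] by simp
  have "(\<lambda>v. 0 + (1 / A) *\<^sub>R v) ` macbeath C p \<subseteq> tangent_ball C q"
    using macbeath_scale[where q = p and p = q, OF C' A le] macbeath_subset_tangent_ball[OF C'(1,2) pq(2)] by auto
  then have "emeasure lborel ((\<lambda>v. 0 + (1 / A) *\<^sub>R v) ` macbeath C p)
      \<le> emeasure lborel (tangent_ball C q)"
    using open_tangent_ball[OF C'(1,2) pq(2)] by (intro emeasure_mono) auto
  then have le: "ennreal ((1 / A) ^ DIM('a) * ?\<mu>) \<le> emeasure lborel (tangent_ball C q)"
    using emeasure_homothety[OF open_macbeath[OF C'(1)], of "1 / A" 0 p] A
      emeasure_macbeath(1)[OF C pq(1)] by (simp add: ennreal_mult)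
  have "ennreal (unit_ball_vol (real DIM('a))) / emeasure lborel (tangent_ball C q)
      \<le> ennreal (unit_ball_vol (real DIM('a))) / ennreal ((1 / A) ^ DIM('a) * ?\<mu>)"
    unfolding divide_ennreal_def using le by (intro mult_left_mono inverse_antimono_ennreal) auto
  also have "\<dots> = ennreal (unit_ball_vol (real DIM('a)) / ((1 / A) ^ DIM('a) * ?\<mu>))"
    using A pos by (intro divide_ennreal) auto
  also have "unit_ball_vol (real DIM('a)) / ((1 / A) ^ DIM('a) * ?\<mu>)
      = unit_ball_vol (real DIM('a)) * A ^ DIM('a) / ?\<mu>"
    using A by (simp add: power_divide)
  finally show ?thesis by (simp add: emeasure_ball)
qed

text \<open>
  On p + k M, where M is the Macbeath region at p, positive affine functions differ from their
  value at p by a factor between 1 - k and 1 + k.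
\<close>

lemma macbeath_translate_comparison:
  fixes C :: "'a::euclidean_space set"
  assumes C: "open C" "convex C" "C \<noteq> {}" and k: "0 < k" "k < 1" and v: "v \<in> macbeath C p"
  shows "p + k *\<^sub>R v \<in> C"
    and "f \<in> pos_aff C \<Longrightarrow> f (p + k *\<^sub>R v) \<le> (1 + k) * f p"
    and "f \<in> pos_aff C \<Longrightarrow> (1 - k) * f p \<le> f (p + k *\<^sub>R v)"
    and "f \<in> pos_aff C \<Longrightarrow> 0 < f p"
proof -
  have *: "f (p + k *\<^sub>R v) \<le> (1 + k) * f p \<and> (1 - k) * f p \<le> f (p + k *\<^sub>R v) \<and> 0 < f p"
    if f: "f \<in> pos_aff C" for f
  proof -
    have "0 < f (p + v)" "0 < f (p - v)"
      using v pos_affD[OF f] by (auto simp: macbeath_def)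
    then have "\<bar>f (p + v) - f p\<bar> \<le> f p" "0 < f p"
      using pos_aff_reflect[OF f, of p v] by linarith+
    moreover from this have "\<bar>k * (f (p + v) - f p)\<bar> \<le> k * f p"
      using k by (simp add: abs_mult)
    ultimately show ?thesis
      unfolding pos_aff_shift[OF f] by (auto simp: algebra_simps)
  qed
  then show "f \<in> pos_aff C \<Longrightarrow> f (p + k *\<^sub>R v) \<le> (1 + k) * f p"
    and "f \<in> pos_aff C \<Longrightarrow> (1 - k) * f p \<le> f (p + k *\<^sub>R v)"
    and "f \<in> pos_aff C \<Longrightarrow> 0 < f p"
    by blast+
  have "0 < f (p + k *\<^sub>R v)" if "f \<in> pos_aff C" for f
  proof -
    have "0 < (1 - k) * f p" using *[OF that] k by simp
    then show ?thesis using *[OF that] by linarith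
  qed
  then show "p + k *\<^sub>R v \<in> C"
    unfolding mem_iff_pos_aff[OF C] by blast
qed

lemma hilbert_dist_macbeath_translate:
  fixes C :: "'a::euclidean_space set"
  assumes C: "open C" "convex C" "C \<noteq> {}" and p: "p \<in> C" and k: "0 < k" "k < 1"
    and v: "v \<in> macbeath C p"
  shows "hilbert_dist C p (p + k *\<^sub>R v) \<le> ln ((1 + k) / (1 - k)) / 2"
proof -
  note * = macbeath_translate_comparison[OF C k v]
  have "hilbert_dist C p (p + k *\<^sub>R v) \<le> ln ((1 / (1 - k)) * (1 + k)) / 2"
  proof (rule hilbert_dist_le[OF C(1,2) p *(1)])
    fix f assume f: "f \<in> pos_aff C"
    show "f p \<le> 1 / (1 - k) * f (p + k *\<^sub>R v)"
      using *(3)[OF f] k by (simp add: field_simps)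
    show "f (p + k *\<^sub>R v) \<le> (1 + k) * f p"
      by (rule *(2)[OF f])
  qed
  then show ?thesis by (simp add: mult.commute)
qed

text \<open>
  On p + k M the density is at least a constant divided by the volume of M, by
  \<open>density_lower_bound\<close> with A = 2, while the volume of p + k M is that of M times
  a power of k. The volume of M cancels, so each piece contributes the same amount. A measurable
  step function is placed below the integrand, since nothing is known about the measurability of
  the density.
\<close>

lemma busemann_vol_ge_disjoint_macbeath:
  fixes C :: "'a::euclidean_space set"
  assumes C: "hilbert_geometry C" and X: "finite X" "X \<subseteq> C" and k: "0 < k" "k < 1"
    and disj: "disjoint_family_on (\<lambda>p. (\<lambda>v. p + k *\<^sub>R v) ` macbeath C p) X"
    and sub: "\<And>p. p \<in> X \<Longrightarrow> (\<lambda>v. p + k *\<^sub>R v) ` macbeath C p \<subseteq> A"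
  shows "ennreal (real (card X) * (unit_ball_vol (real DIM('a)) * (k / 4) ^ DIM('a))) \<le> busemann_vol C A"
proof -
  let ?w = "unit_ball_vol (real DIM('a))"
  let ?U = "\<lambda>p. (\<lambda>v. p + k *\<^sub>R v) ` macbeath C p"
  let ?\<mu> = "\<lambda>p. measure lborel (macbeath C p)"
  let ?c = "\<lambda>p. ?w / (4 ^ DIM('a) * ?\<mu> p)"
  let ?d = "\<lambda>q. emeasure lborel (ball (0::'a) 1) / emeasure lborel (tangent_ball C q)"
  have C': "open C" "convex C" "C \<noteq> {}"
    using C by (auto simp: hilbert_geometry_def)
  have openU: "open (?U p)" for p
    using k C' by (intro open_affinity open_macbeath) auto
  have point: "(\<Sum>p\<in>X. ennreal (?c p) * indicator (?U p) q) \<le> ?d q * indicator A q" for q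
  proof (cases "\<exists>p\<in>X. q \<in> ?U p")
    case False
    then have "(\<Sum>p\<in>X. ennreal (?c p) * indicator (?U p) q) = 0"
      by (intro sum.neutral) auto
    then show ?thesis by simp
  next
    case True
    then obtain p v where p: "p \<in> X" "q \<in> ?U p" and v: "v \<in> macbeath C p" "q = p + k *\<^sub>R v"
      by auto
    have "indicator (?U p') q = (0::ennreal)" if "p' \<in> X - {p}" for p'
    proof -
      have "?U p' \<inter> ?U p = {}"
        using disj that p(1) unfolding disjoint_family_on_def by blast
      then show ?thesis using p(2) by (intro indicator_simps) blast
    qed
    then have "(\<Sum>p\<in>X. ennreal (?c p) * indicator (?U p) q) = ennreal (?c p)"
      using p X by (subst sum.remove[OF X(1) p(1)]) simp
    also have "\<dots> \<le> ?d q"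
    proof -
      have "ennreal (?w / ((2 * 2) ^ DIM('a) * ?\<mu> p)) \<le> ?d q"
      proof (rule density_lower_bound[OF C])
        show "p \<in> C" using p X by auto
        show "q \<in> C" using macbeath_translate_comparison(1)[OF C' k v(1)] v by simp
        fix f assume f: "f \<in> pos_aff C"
        have "f q \<le> (1 + k) * f p"
          using macbeath_translate_comparison(2)[OF C' k v(1) f] v by simp
        also have "\<dots> \<le> 2 * f p"
          using k macbeath_translate_comparison(4)[OF C' k v(1) f] by simp
        finally show "f q \<le> 2 * f p" .
      qed simp
      then show ?thesis by simp
    qed
    also have "\<dots> = ?d q * indicator A q"
    proof -
      have "q \<in> A" using sub[OF p(1)] p(2) by blast
      then show ?thesis by simp
    qed
    finally show ?thesis .
  qed
  have "ennreal (?c p) * emeasure lborel (?U p) = ennreal (?w * (k / 4) ^ DIM('a))" if "p \<in> X" for p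
  proof -
    have pC: "p \<in> C" using X that by blast
    have "ennreal (?c p) * emeasure lborel (?U p) = ennreal (?c p) * ennreal (k ^ DIM('a) * ?\<mu> p)"
      using emeasure_homothety[OF open_macbeath[OF C'(1)] k(1), of p p] k
      by (simp add: emeasure_macbeath(1)[OF C pC] ennreal_mult)
    also have "\<dots> = ennreal (?c p * (k ^ DIM('a) * ?\<mu> p))"
      using k emeasure_macbeath(2)[OF C pC] by (intro ennreal_mult[symmetric]) auto
    also have "?c p * (k ^ DIM('a) * ?\<mu> p) = ?w * (k / 4) ^ DIM('a)"
      using emeasure_macbeath(2)[OF C pC] by (simp add: power_divide)
    finally show ?thesis .
  qed
  then have "ennreal (real (card X) * (?w * (k / 4) ^ DIM('a)))
      = (\<Sum>p\<in>X. ennreal (?c p) * emeasure lborel (?U p))"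
    using k by (simp add: ennreal_mult ennreal_of_nat_eq_real_of_nat)
  also have "\<dots> = (\<Sum>p\<in>X. \<integral>\<^sup>+q. ennreal (?c p) * indicator (?U p) q \<partial>lborel)"
    using openU by (intro sum.cong refl nn_integral_cmult_indicator[symmetric]) auto
  also have "\<dots> = (\<integral>\<^sup>+q. (\<Sum>p\<in>X. ennreal (?c p) * indicator (?U p) q) \<partial>lborel)"
    using openU by (intro nn_integral_sum[symmetric]) auto
  also have "\<dots> \<le> busemann_vol C A"
    unfolding busemann_vol_def by (intro nn_integral_mono point)
  finally show ?thesis .
qed

text \<open>
  If positive affine functions vary by at most the factor A on K i and p is a point of K i, then
  K i lies in p + A M for the Macbeath region M at p, and on K i the density is at most a
  constant divided by the volume of M. Again the volume of M cancels.
\<close>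

lemma busemann_vol_le_cover:
  fixes C :: "'a::euclidean_space set"
  assumes C: "hilbert_geometry C" and I: "finite I" "S \<subseteq> (\<Union>i\<in>I. K i)" and K: "\<And>i. i \<in> I \<Longrightarrow> K i \<subseteq> C"
    and A: "A \<ge> 1"
    and le: "\<And>i p q f. i \<in> I \<Longrightarrow> p \<in> K i \<Longrightarrow> q \<in> K i \<Longrightarrow> f \<in> pos_aff C \<Longrightarrow> f p \<le> A * f q"
  shows "busemann_vol C S \<le> ennreal (real (card I) * (unit_ball_vol (real DIM('a)) * A ^ (2 * DIM('a))))"
proof -
  let ?w = "unit_ball_vol (real DIM('a))"
  let ?d = "\<lambda>q. emeasure lborel (ball (0::'a) 1) / emeasure lborel (tangent_ball C q)"
  have C': "open C" "convex C" "C \<noteq> {}"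
    using C by (auto simp: hilbert_geometry_def)
  define J where "J = {i\<in>I. K i \<noteq> {}}"
  have J: "finite J" "J \<subseteq> I" "S \<subseteq> (\<Union>i\<in>J. K i)"
    using I by (auto simp: J_def) blast
  have "\<forall>i\<in>J. \<exists>p. p \<in> K i" by (auto simp: J_def)
  then obtain p where p: "\<And>i. i \<in> J \<Longrightarrow> p i \<in> K i" by metis
  have pC: "p i \<in> C" if "i \<in> J" for i using p K J that by blast
  let ?U = "\<lambda>i. (\<lambda>v. p i + A *\<^sub>R v) ` macbeath C (p i)"
  let ?\<mu> = "\<lambda>i. measure lborel (macbeath C (p i))"
  let ?c = "\<lambda>i. ?w * A ^ DIM('a) / ?\<mu> i"
  have openU: "open (?U i)" for i
    using A C' by (intro open_affinity open_macbeath) auto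
  have KU: "K i \<subseteq> ?U i" if i: "i \<in> J" for i
  proof
    fix q assume q: "q \<in> K i"
    have iI: "i \<in> I" using i J by blast
    have *: "0 < f (p i + c *\<^sub>R (q - p i))" if f: "f \<in> pos_aff C" and c: "\<bar>c\<bar> = 1 / A" for f c
    proof -
      have pos: "0 < f (p i)" "0 < f q"
        using pos_affD[OF f] pC[OF i] K[OF iI] q by auto
      have 1: "f q \<le> A * f (p i)" by (rule le[OF iI q p[OF i] f])
      have "1 * f (p i) \<le> A * f (p i)"
        using A pos by (intro mult_right_mono) auto
      then have "\<bar>f q - f (p i)\<bar> < A * f (p i)" using 1 pos by linarith
      then have "\<bar>c * (f q - f (p i))\<bar> < f (p i)"
        unfolding abs_mult c using A by (simp add: field_simps)
      then have "0 < f (p i) + c * (f q - f (p i))" by (simp add: abs_less_iff)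
      then show ?thesis unfolding pos_aff_line[OF f] by (simp add: algebra_simps)
    qed
    have "p i + (1 / A) *\<^sub>R (q - p i) \<in> C" "p i + (- (1 / A)) *\<^sub>R (q - p i) \<in> C"
      unfolding mem_iff_pos_aff[OF C'] using *[of _ "1 / A"] *[of _ "- (1 / A)"] A by auto
    then have "(1 / A) *\<^sub>R (q - p i) \<in> macbeath C (p i)"
      by (simp add: macbeath_def)
    then show "q \<in> ?U i"
      using A by (intro image_eqI[of _ _ "(1 / A) *\<^sub>R (q - p i)"]) auto
  qed
  have point: "?d q * indicator S q \<le> (\<Sum>i\<in>J. ennreal (?c i) * indicator (?U i) q)" for q
  proof (cases "q \<in> S")
    case True
    then obtain i where i: "i \<in> J" "q \<in> K i" using J(3) by blast
    then have iI: "i \<in> I" using J by blast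
    have "?d q \<le> ennreal (?c i)"
      using density_upper_bound[OF C pC[OF i(1)], of q A] K[OF iI] i le[OF iI p[OF i(1)] i(2)] A
      by auto
    also have "\<dots> = ennreal (?c i) * indicator (?U i) q"
    proof -
      have "q \<in> ?U i" using KU[OF i(1)] i(2) by blast
      then show ?thesis by (simp only: indicator_simps mult_1_right)
    qed
    also have "\<dots> \<le> (\<Sum>i\<in>J. ennreal (?c i) * indicator (?U i) q)"
      using J i by (intro member_le_sum) auto
    finally show ?thesis using True by simp
  qed simp
  have vol: "ennreal (?c i) * emeasure lborel (?U i) = ennreal (?w * A ^ (2 * DIM('a)))" if "i \<in> J" for i
  proof -
    have "ennreal (?c i) * emeasure lborel (?U i) = ennreal (?c i) * ennreal (A ^ DIM('a) * ?\<mu> i)"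
      using emeasure_homothety[OF open_macbeath[OF C'(1)], of A "p i" "p i"] A
      by (simp add: emeasure_macbeath(1)[OF C pC[OF that]] ennreal_mult)
    also have "\<dots> = ennreal (?c i * (A ^ DIM('a) * ?\<mu> i))"
      using A emeasure_macbeath(2)[OF C pC[OF that]] by (intro ennreal_mult[symmetric]) auto
    also have "?c i * (A ^ DIM('a) * ?\<mu> i) = ?w * A ^ (2 * DIM('a))"
      using emeasure_macbeath(2)[OF C pC[OF that]] by (simp add: power_add mult_2)
    finally show ?thesis .
  qed
  have "busemann_vol C S \<le> (\<integral>\<^sup>+q. (\<Sum>i\<in>J. ennreal (?c i) * indicator (?U i) q) \<partial>lborel)"
    unfolding busemann_vol_def by (intro nn_integral_mono point)
  also have "\<dots> = (\<Sum>i\<in>J. \<integral>\<^sup>+q. ennreal (?c i) * indicator (?U i) q \<partial>lborel)"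
    using openU by (intro nn_integral_sum) auto
  also have "\<dots> = (\<Sum>i\<in>J. ennreal (?c i) * emeasure lborel (?U i))"
    using openU by (intro sum.cong refl nn_integral_cmult_indicator) auto
  also have "\<dots> = ennreal (real (card J) * (?w * A ^ (2 * DIM('a))))"
    using vol A by (simp add: ennreal_mult ennreal_of_nat_eq_real_of_nat)
  also have "\<dots> \<le> ennreal (real (card I) * (?w * A ^ (2 * DIM('a))))"
    using card_mono[OF I(1) J(2)] A by (intro ennreal_leI mult_right_mono) auto
  finally show ?thesis .
qed

section \<open>Separated points in a Hilbert ball\<close>

definition packing :: "'a::euclidean_space set \<Rightarrow> 'a \<Rightarrow> real \<Rightarrow> 'a set \<Rightarrow> bool" where
  "packing C x r X \<longleftrightarrow> finite X \<and> X \<subseteq> C \<and> (\<forall>p\<in>X. hilbert_dist C x p \<le> r) \<and>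
     (\<forall>p\<in>X. \<forall>q\<in>X. p \<noteq> q \<longrightarrow> 1 \<le> hilbert_dist C p q)"

lemma sum_binomial_diagonal: "(\<Sum>i\<le>m. (i + k) choose k) = Suc (m + k) choose Suc k"
  by (induction m) simp_all

text \<open>
  The sum over the sections in \<open>packing_of_sections\<close>: the section with index j
  still has the radius m - j at its disposal.
\<close>

lemma sum_binomial_diagonal_rev:
  assumes "n \<le> m"
  shows "(\<Sum>j\<in>{n..m}. (m - j + k) choose k) = Suc (m - n + k) choose Suc k"
proof -
  have "(\<Sum>j\<in>{n..m}. (m - j + k) choose k) = (\<Sum>i\<le>m - n. (i + k) choose k)"
    by (rule sum.reindex_bij_witness[of _ "\<lambda>i. m - i" "\<lambda>j. m - j"]) (use assms in auto)
  then show ?thesis by (simp add: sum_binomial_diagonal)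
qed

lemma hilbert_dist_ge_ln_ratio:
  fixes C :: "'a::euclidean_space set"
  assumes C: "open C" "convex C" and pq: "p \<in> C" "q \<in> C" and f: "f \<in> pos_aff C"
    and le: "exp 2 * f q \<le> f p"
  shows "1 \<le> hilbert_dist C p q"
proof -
  have pos: "0 < f q" "0 < f p" using pos_affD[OF f] pq by auto
  have "exp 2 \<le> f p / f q" using le pos by (simp add: field_simps)
  then have "2 \<le> ln (f p / f q)" using pos by (simp add: ln_ge_iff)
  then show ?thesis
    using hilbert_dist_ge[OF C pq f one_in_pos_aff] by simp
qed

text \<open>
  Moving from x towards a boundary point b divides a positive affine function by at most 1 / s;
  it multiplies it by at most R if R bounds g b / g x.
\<close>

lemma hilbert_dist_towards_boundary:
  fixes C :: "'a::euclidean_space set"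
  assumes C: "open C" "convex C" and x: "x \<in> C" and b: "b \<in> closure C" and R: "R \<ge> 1"
    and bR: "\<And>g. g \<in> pos_aff C \<Longrightarrow> g b \<le> R * g x" and s: "0 < s" "s \<le> 1"
  shows "b + s *\<^sub>R (x - b) \<in> C"
    and "hilbert_dist C x (b + s *\<^sub>R (x - b)) \<le> - ln s / 2 + ln R / 2"
proof -
  have ne: "C \<noteq> {}" using x by auto
  have eq: "g (b + s *\<^sub>R (x - b)) = (1 - s) * g b + s * g x" if "g \<in> pos_aff C" for g
    by (rule pos_aff_line[OF that])
  have nn: "0 \<le> (1 - s) * g b" "0 < g x" if "g \<in> pos_aff C" for g
    using pos_aff_closure_nonneg[OF that b] pos_affD[OF that x] s by auto
  show in_C: "b + s *\<^sub>R (x - b) \<in> C"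
    unfolding mem_iff_pos_aff[OF C ne]
  proof
    fix g assume g: "g \<in> pos_aff C"
    have "0 < s * g x" using s nn[OF g] by simp
    then show "0 < g (b + s *\<^sub>R (x - b))" unfolding eq[OF g] using nn[OF g] by linarith
  qed
  have "hilbert_dist C x (b + s *\<^sub>R (x - b)) \<le> ln (1 / s * R) / 2"
  proof (rule hilbert_dist_le[OF C x in_C])
    fix g assume g: "g \<in> pos_aff C"
    show "g x \<le> 1 / s * g (b + s *\<^sub>R (x - b))"
      unfolding eq[OF g] using nn[OF g] s by (simp add: field_simps)
    have "(1 - s) * g b \<le> (1 - s) * (R * g x)"
      using bR[OF g] s by (intro mult_left_mono) auto
    moreover have "s * (1 * g x) \<le> s * (R * g x)"
      using s R nn[OF g] by (intro mult_left_mono mult_right_mono) auto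
    ultimately show "g (b + s *\<^sub>R (x - b)) \<le> R * g x"
      unfolding eq[OF g] by (simp add: algebra_simps)
  qed
  also have "\<dots> = - ln s / 2 + ln R / 2"
    using s R by (simp add: ln_mult_pos ln_div)
  finally show "hilbert_dist C x (b + s *\<^sub>R (x - b)) \<le> - ln s / 2 + ln R / 2" .
qed

text \<open>
  The inductive step of the packing argument. The points y j at distance about j from x on the
  segment towards b lie on the parallel hyperplanes where f = exp (-2 j) f x. Points on
  different hyperplanes are at distance at least 1, because the values of f differ by a factor
  exp 2. Within the hyperplane section through y j the induction hypothesis gives separated
  points in a ball of radius m - j, and the binomial coefficients add up. Omitting the sections
  with j < n keeps all points where f is small, which localises the points near b if b is
  exposed by f.
\<close>

lemma packing_of_sections:
  fixes C :: "'a::euclidean_space set"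
  assumes C: "open C" "convex C" and x: "x \<in> C" and b: "b \<in> closure C" and R: "R \<ge> 1"
    and bR: "\<And>g. g \<in> pos_aff C \<Longrightarrow> g b \<le> R * g x"
    and f: "f \<in> pos_aff C" "f b = 0"
    and H: "affine H" "x \<in> H" "b \<in> H" "aff_dim H = int (Suc k)"
    and IH: "\<And>y H' m. y \<in> C \<Longrightarrow> affine H' \<Longrightarrow> y \<in> H' \<Longrightarrow> aff_dim H' = int k \<Longrightarrow>
      \<exists>X. packing C y (real (m + k)) X \<and> X \<subseteq> H' \<and> card X = (m + k) choose k"
    and n: "n \<le> m"
  shows "\<exists>X. packing C x (real (m + k) + ln R / 2) X \<and> X \<subseteq> H \<and> card X = Suc (m - n + k) choose Suc k \<and>
    (\<forall>p\<in>X. f p \<le> exp (- 2 * real n) * f x)"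
proof -
  obtain a w where aw: "\<And>y. f y = a + w \<bullet> y" using f(1) pos_affE by blast
  define s where "s j = exp (- 2 * real j)" for j
  define y where "y j = b + s j *\<^sub>R (x - b)" for j
  define H' where "H' j = H \<inter> {z. w \<bullet> z = s j * f x - a}" for j
  have s: "0 < s j" "s j \<le> 1" for j by (auto simp: s_def)
  have fx: "0 < f x" using pos_affD[OF f(1) x] .
  have y: "y j \<in> C" "hilbert_dist C x (y j) \<le> real j + ln R / 2" for j
    using hilbert_dist_towards_boundary[OF C x b R bR s, of j] by (simp_all add: y_def s_def)
  have fy: "f (y j) = s j * f x" for j
    unfolding y_def pos_aff_line[OF f(1)] f(2) by simp
  have yH: "y j \<in> H' j" for j
  proof -
    have "y j = (1 - s j) *\<^sub>R b + s j *\<^sub>R x" by (simp add: y_def algebra_simps)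
    then have "y j \<in> H" using H by (simp add: affine_alt)
    moreover have "w \<bullet> y j = s j * f x - a" using fy[of j] aw[of "y j"] by simp
    ultimately show ?thesis by (simp add: H'_def)
  qed
  have affH: "affine (H' j)" for j
    unfolding H'_def by (intro affine_Int H affine_hyperplane)
  have dimH: "aff_dim (H' j) = int k" for j
  proof -
    have "H \<inter> {z. w \<bullet> z = s j * f x - a} \<noteq> {}" using yH[of j] by (auto simp: H'_def)
    moreover have "s j * f x \<noteq> 0" using s[of j] fx by simp
    then have "b \<notin> {z. w \<bullet> z = s j * f x - a}" using aw[of b] f(2) by auto
    then have "\<not> H \<subseteq> {z. w \<bullet> z = s j * f x - a}" using H(3) by blast
    ultimately show ?thesis
      unfolding H'_def aff_dim_affine_Int_hyperplane[OF H(1)] by (simp add: H(4))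
  qed
  have "\<forall>j. \<exists>X. packing C (y j) (real (m - j + k)) X \<and> X \<subseteq> H' j \<and> card X = (m - j + k) choose k"
    using IH[OF y(1) affH yH dimH] by blast
  then obtain X where X: "\<And>j. packing C (y j) (real (m - j + k)) (X j)" "\<And>j. X j \<subseteq> H' j"
    "\<And>j. card (X j) = (m - j + k) choose k" by metis
  have fX: "f p = s j * f x" if "p \<in> X j" for p j
    using X(2)[of j] that aw by (auto simp: H'_def)
  have XC: "p \<in> C" if "p \<in> X j" for p j
    using X(1)[of j] that by (auto simp: packing_def)
  have sep: "1 \<le> hilbert_dist C p q" if "p \<in> X i" "q \<in> X j" "i < j" for p q i j
  proof (rule hilbert_dist_ge_ln_ratio[OF C XC[OF that(1)] XC[OF that(2)] f(1)])
    have "exp 2 * s j \<le> s i"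
      unfolding s_def exp_add[symmetric] using that(3) by simp
    then show "exp 2 * f q \<le> f p"
      unfolding fX[OF that(1)] fX[OF that(2)] using fx by (simp add: mult.assoc[symmetric])
  qed
  have disj: "X i \<inter> X j = {}" if "i < j" for i j
    using sep[of _ i _ j] that by fastforce
  define Y where "Y = (\<Union>j\<in>{n..m}. X j)"
  have "packing C x (real (m + k) + ln R / 2) Y"
    unfolding packing_def
  proof (intro conjI ballI impI)
    show "finite Y" "Y \<subseteq> C"
      using X(1) XC unfolding Y_def by (auto simp: packing_def)
  next
    fix p assume "p \<in> Y"
    then obtain j where j: "j \<in> {n..m}" "p \<in> X j" unfolding Y_def by blast
    have "hilbert_dist C x p \<le> hilbert_dist C x (y j) + hilbert_dist C (y j) p"
      by (rule hilbert_dist_triangle[OF C x y(1) XC[OF j(2)]])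
    also have "\<dots> \<le> (real j + ln R / 2) + real (m - j + k)"
      using y(2)[of j] X(1)[of j] j(2) by (intro add_mono) (auto simp: packing_def)
    also have "\<dots> = real (m + k) + ln R / 2" using j(1) by simp
    finally show "hilbert_dist C x p \<le> real (m + k) + ln R / 2" .
  next
    fix p q assume "p \<in> Y" "q \<in> Y" "p \<noteq> q"
    then obtain i j where ij: "p \<in> X i" "q \<in> X j" unfolding Y_def by blast
    show "1 \<le> hilbert_dist C p q"
    proof (cases i j rule: linorder_cases)
      case less then show ?thesis using sep ij by blast
    next
      case equal then show ?thesis using X(1)[of i] ij \<open>p \<noteq> q\<close> by (auto simp: packing_def)
    next
      case greater then show ?thesis using sep[OF ij(2,1)] by (simp add: hilbert_dist_commute)
    qed
  qed
  moreover have "Y \<subseteq> H" using X(2) by (auto simp: Y_def H'_def)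
  moreover have "card Y = Suc (m - n + k) choose Suc k"
  proof -
    have "card Y = (\<Sum>j\<in>{n..m}. card (X j))"
      unfolding Y_def
    proof (rule card_UN_disjoint)
      show "\<forall>i\<in>{n..m}. finite (X i)" using X(1) by (auto simp: packing_def)
      show "\<forall>i\<in>{n..m}. \<forall>j\<in>{n..m}. i \<noteq> j \<longrightarrow> X i \<inter> X j = {}"
        using disj by (metis Int_commute linorder_neqE_nat)
    qed simp
    then show ?thesis using sum_binomial_diagonal_rev[OF n] by (simp add: X(3))
  qed
  moreover have "f p \<le> exp (- 2 * real n) * f x" if "p \<in> Y" for p
  proof -
    obtain j where j: "j \<ge> n" "p \<in> X j" using \<open>p \<in> Y\<close> unfolding Y_def by auto
    then show ?thesis unfolding fX[OF j(2)] s_def using fx by simp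
  qed
  ultimately show ?thesis by blast
qed

text \<open>
  On a line through x choose the direction in which C ends first. Then the reflection of the
  exit point b in x is still in the closure, so that every positive affine function g satisfies
  g b \<open>\<le>\<close> 2 g x, which is the constant R = 2 in
  \<open>packing_of_sections\<close>.
\<close>

lemma balanced_exit_point:
  fixes C :: "'a::euclidean_space set"
  assumes C: "hilbert_geometry C" and x: "x \<in> C" and u: "u \<noteq> 0"
  shows "\<exists>T. x + T *\<^sub>R u \<in> frontier C \<and> x - T *\<^sub>R u \<in> closure C"
proof -
  have C': "open C" "convex C" using C by (auto simp: hilbert_geometry_def)
  have one: "\<exists>T. x + T *\<^sub>R v \<in> frontier C \<and> x - T *\<^sub>R v \<in> closure C"
    if T: "T > 0" "x + T *\<^sub>R v \<in> frontier C" and opp: "x + T *\<^sub>R (- v) \<in> closure C" for T v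
    using T opp by auto
  have flip: "\<exists>T. x + T *\<^sub>R u \<in> frontier C \<and> x - T *\<^sub>R u \<in> closure C"
    if opp: "\<exists>T. x + T *\<^sub>R (- u) \<in> frontier C \<and> x - T *\<^sub>R (- u) \<in> closure C"
  proof -
    obtain T where "x + T *\<^sub>R (- u) \<in> frontier C" "x - T *\<^sub>R (- u) \<in> closure C" using opp by blast
    then show ?thesis by (intro exI[of _ "- T"]) auto
  qed
  have cl: "y \<in> C \<Longrightarrow> y \<in> closure C" "y \<in> frontier C \<Longrightarrow> y \<in> closure C" for y
    using closure_subset by (auto simp: frontier_def)
  show ?thesis
    using C' x
  proof (cases rule: ray_dichotomy[where v = u])
    case infinite
    note inf = infinite
    show ?thesis
      using C' x
    proof (cases rule: ray_dichotomy[where v = "- u"])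
      case infinite
      have "x + t *\<^sub>R u \<in> C" for t
        using inf[of t] infinite[of "- t"] by (cases "t \<ge> 0") auto
      then have "range (\<lambda>t. x + t *\<^sub>R u) \<subseteq> C" by blast
      then show ?thesis using C u unfolding hilbert_geometry_def by blast
    next
      case (finite T)
      have "x + T *\<^sub>R u \<in> closure C" using inf[of T] finite(1) cl by simp
      then show ?thesis using finite(1) finite(3)[of T] by (intro flip, intro one[of T]) auto
    qed
  next
    case (finite T)
    note fin = finite
    show ?thesis
      using C' x
    proof (cases rule: ray_dichotomy[where v = "- u"])
      case infinite
      have "x + T *\<^sub>R (- u) \<in> closure C" using infinite[of T] fin(1) cl by simp
      then show ?thesis using fin(1) fin(3)[of T] by (intro one[of T]) auto
    next
      case (finite S)
      show ?thesis
      proof (cases "T \<le> S")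
        case True
        have "x + T *\<^sub>R (- u) \<in> closure C"
          using finite(2)[of T] finite(3)[of T] fin(1) True cl by (cases "T = S") auto
        then show ?thesis using fin(1) fin(3)[of T] by (intro one[of T]) auto
      next
        case False
        then have "x + S *\<^sub>R u \<in> closure C"
          using fin(2)[of S] finite(1) cl by auto
        then show ?thesis using finite(1) finite(3)[of S] by (intro flip, intro one[of S]) auto
      qed
    qed
  qed
qed

text \<open>
  The count is independent of C and of x: it only uses that every line through x leaves C in
  some direction.
\<close>

lemma packing_in_affine_section:
  fixes C :: "'a::euclidean_space set"
  assumes C: "hilbert_geometry C"
  shows "x \<in> C \<Longrightarrow> affine H \<Longrightarrow> x \<in> H \<Longrightarrow> aff_dim H = int k \<Longrightarrow>
    \<exists>X. packing C x (real (m + k)) X \<and> X \<subseteq> H \<and> card X = (m + k) choose k"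
proof (induction k arbitrary: x H m)
  case 0
  then show ?case by (intro exI[of _ "{x}"]) (auto simp: packing_def)
next
  case (Suc k)
  have C': "open C" "convex C" "C \<noteq> {}" using C by (auto simp: hilbert_geometry_def)
  have "H \<noteq> {x}" using Suc.prems(4) by auto
  then obtain z where z: "z \<in> H" "z \<noteq> x" using Suc.prems(3) by blast
  obtain T where T: "x + T *\<^sub>R (z - x) \<in> frontier C" "x - T *\<^sub>R (z - x) \<in> closure C"
    using balanced_exit_point[OF C Suc.prems(1), of "z - x"] z by auto
  define b where "b = x + T *\<^sub>R (z - x)"
  have b: "b \<in> frontier C" "b \<in> closure C" using T(1) by (auto simp: b_def frontier_def)
  obtain f where f: "f \<in> pos_aff C" "f b = 0" using pos_aff_supports[OF C' b(1)] .
  have bR: "g b \<le> 2 * g x" if g: "g \<in> pos_aff C" for g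
  proof -
    have "0 \<le> g (x - (b - x))"
      using pos_aff_closure_nonneg[OF g, of "x - (b - x)"] T(2) by (simp add: b_def)
    then show ?thesis using pos_aff_reflect[OF g, of x "b - x"] by simp
  qed
  have bH: "b \<in> H"
  proof -
    have "b = (1 - T) *\<^sub>R x + T *\<^sub>R z" by (simp add: b_def algebra_simps)
    then show ?thesis using Suc.prems(2,3) z(1) by (simp add: affine_alt)
  qed
  have "\<exists>X. packing C x (real (m + k) + ln 2 / 2) X \<and> X \<subseteq> H \<and>
      card X = Suc (m - 0 + k) choose Suc k \<and> (\<forall>p\<in>X. f p \<le> exp (- 2 * real 0) * f x)"
    by (rule packing_of_sections[OF C'(1,2) Suc.prems(1) b(2) _ bR f Suc.prems(2,3) bH Suc.prems(4) Suc.IH])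
      simp_all
  then obtain X where X: "packing C x (real (m + k) + ln 2 / 2) X" "X \<subseteq> H"
    "card X = Suc (m - 0 + k) choose Suc k"
    by blast
  have "ln 2 / 2 \<le> (1::real)" using ln_le_minus_one[of 2] by simp
  then have "packing C x (real (m + Suc k)) X" using X(1) by (force simp: packing_def)
  then show ?case using X by auto
qed

text \<open>
  With k = 1/4 the pieces p + k M have Hilbert radius less than 1/2, so the pieces at
  1-separated points are disjoint.
\<close>

lemma busemann_vol_ge_packing:
  fixes C :: "'a::euclidean_space set"
  assumes C: "hilbert_geometry C" and x: "x \<in> C" and X: "packing C x r X"
  shows "ennreal (real (card X) * (unit_ball_vol (real DIM('a)) * (1 / 16) ^ DIM('a)))
    \<le> busemann_vol C (hilbert_ball C x (r + 1))"
proof -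
  have C': "open C" "convex C" "C \<noteq> {}" using C by (auto simp: hilbert_geometry_def)
  have ln53: "ln ((1 + 1 / 4) / (1 - 1 / 4)) / 2 < (1 / 2 :: real)"
    using ln_add_one_self_less_self[of "2 / 3"] by simp
  have XC: "p \<in> C" if "p \<in> X" for p using X that by (auto simp: packing_def)
  have near: "p + (1 / 4) *\<^sub>R v \<in> C" "hilbert_dist C p (p + (1 / 4) *\<^sub>R v) < 1 / 2"
    if "p \<in> X" "v \<in> macbeath C p" for p v
  proof -
    show "p + (1 / 4) *\<^sub>R v \<in> C"
      using macbeath_translate_comparison(1)[OF C' _ _ that(2), of "1 / 4"] by simp
    show "hilbert_dist C p (p + (1 / 4) *\<^sub>R v) < 1 / 2"
      using hilbert_dist_macbeath_translate[OF C' XC[OF that(1)] _ _ that(2), of "1 / 4"] ln53 by simp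
  qed
  have "ennreal (real (card X) * (unit_ball_vol (real DIM('a)) * (1 / 4 / 4) ^ DIM('a)))
    \<le> busemann_vol C (hilbert_ball C x (r + 1))"
  proof (rule busemann_vol_ge_disjoint_macbeath[OF C])
    show "finite X" "X \<subseteq> C" using X by (auto simp: packing_def)
    show "disjoint_family_on (\<lambda>p. (\<lambda>v. p + (1 / 4) *\<^sub>R v) ` macbeath C p) X"
      unfolding disjoint_family_on_def
    proof (intro ballI impI)
      fix p q assume pq: "p \<in> X" "q \<in> X" "p \<noteq> q"
      have "False" if z: "z \<in> (\<lambda>v. p + (1 / 4) *\<^sub>R v) ` macbeath C p"
        "z \<in> (\<lambda>v. q + (1 / 4) *\<^sub>R v) ` macbeath C q" for z
      proof -
        have "z \<in> C" "hilbert_dist C p z < 1 / 2" "hilbert_dist C z q < 1 / 2"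
          using z near[OF pq(1)] near[OF pq(2)] by (auto simp: hilbert_dist_commute)
        then have "hilbert_dist C p q < 1"
          using hilbert_dist_triangle[OF C'(1,2) XC[OF pq(1)] _ XC[OF pq(2)], of z] by linarith
        then show False using X pq by (force simp: packing_def)
      qed
      then show "(\<lambda>v. p + (1 / 4) *\<^sub>R v) ` macbeath C p \<inter> (\<lambda>v. q + (1 / 4) *\<^sub>R v) ` macbeath C q = {}"
        by blast
    qed
    fix p assume p: "p \<in> X"
    show "(\<lambda>v. p + (1 / 4) *\<^sub>R v) ` macbeath C p \<subseteq> hilbert_ball C x (r + 1)"
    proof
      fix z assume "z \<in> (\<lambda>v. p + (1 / 4) *\<^sub>R v) ` macbeath C p"
      then have z: "z \<in> C" "hilbert_dist C p z < 1 / 2" using near[OF p] by auto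
      have "hilbert_dist C x z \<le> hilbert_dist C x p + hilbert_dist C p z"
        by (rule hilbert_dist_triangle[OF C'(1,2) x XC[OF p] z(1)])
      also have "\<dots> < r + 1" using X p z by (force simp: packing_def)
      finally show "z \<in> hilbert_ball C x (r + 1)" using z by (simp add: hilbert_ball_def)
    qed
  qed auto
  then show ?thesis by simp
qed

section \<open>Separated points near the exposed points of a bounded convex set\<close>

text \<open>
  From y one can go through x a little beyond x without leaving C.
\<close>

lemma pos_aff_interior_domination:
  fixes C :: "'a::euclidean_space set"
  assumes C: "open C" "bounded C" and x: "x \<in> C"
  shows "\<exists>R\<ge>1. \<forall>g\<in>pos_aff C. \<forall>y\<in>closure C. g y \<le> R * g x"
proof -
  obtain e where e: "e > 0" "cball x e \<subseteq> C"
    using C(1) x open_contains_cball by blast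
  obtain B where B: "\<And>y. y \<in> closure C \<Longrightarrow> dist x y \<le> B"
    using bounded_any_center[of "closure C" x] bounded_closure[OF C(2)] by auto
  define D where "D = max B 1"
  have D: "D \<ge> 1" "\<And>y. y \<in> closure C \<Longrightarrow> dist x y \<le> D"
    using B by (force simp: D_def)+
  show ?thesis
  proof (intro exI[of _ "1 + D / e"] conjI ballI)
    show "1 \<le> 1 + D / e" using D e by simp
    fix g y assume g: "g \<in> pos_aff C" and y: "y \<in> closure C"
    have "norm (y - x) \<le> D" using D(2)[OF y] by (simp add: dist_norm norm_minus_commute)
    then have "norm ((e / D) *\<^sub>R (y - x)) \<le> e"
      using D(1) e(1) unfolding norm_scaleR by (simp add: field_simps)
    then have "x + (- (e / D)) *\<^sub>R (y - x) \<in> cball x e"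
      by (simp add: dist_norm)
    then have "0 < g (x + (- (e / D)) *\<^sub>R (y - x))"
      using e(2) pos_affD[OF g] by blast
    then have "(e / D) * g y < (1 + e / D) * g x"
      unfolding pos_aff_line[OF g] by simp
    then show "g y \<le> (1 + D / e) * g x"
      using D(1) e(1) by (simp add: field_simps)
  qed
qed

text \<open>
  An open set lies strictly on one side of a hyperplane that meets its closure in a single
  point.
\<close>

lemma exposed_point_pos_aff:
  fixes C :: "'a::euclidean_space set"
  assumes C: "open C" "convex C" "C \<noteq> {}" and v: "{v} exposed_face_of closure C" and nt: "\<exists>y\<in>C. y \<noteq> v"
  shows "\<exists>f\<in>pos_aff C. f v = 0 \<and> (\<forall>y\<in>closure C. y \<noteq> v \<longrightarrow> 0 < f y)"
proof -
  obtain a b where ab: "closure C \<subseteq> {x. a \<bullet> x \<le> b}" "{v} = closure C \<inter> {x. a \<bullet> x = b}"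
    using v unfolding exposed_face_of_def by blast
  define f where "f y = b + (- a) \<bullet> y" for y
  have f0: "f v = 0" using ab(2) by (auto simp: f_def)
  have fpos: "0 < f y" if "y \<in> closure C" "y \<noteq> v" for y
    using ab that by (force simp: f_def)
  have "v \<notin> C"
  proof
    assume v: "v \<in> C"
    obtain y where y: "y \<in> C" "y \<noteq> v" using nt by blast
    obtain e where e: "e > 0" "cball v e \<subseteq> C"
      using C(1) v open_contains_cball by blast
    define t where "t = e / norm (y - v)"
    have t: "t > 0" using e y by (simp add: t_def)
    have "v + (- t) *\<^sub>R (y - v) \<in> cball v e"
      using e y by (simp add: dist_norm t_def)
    then have "v + (- t) *\<^sub>R (y - v) \<in> closure C" using e closure_subset by blast
    moreover have "v + (- t) *\<^sub>R (y - v) \<noteq> v" using t y by simp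
    ultimately have "0 < f (v + (- t) *\<^sub>R (y - v))" by (rule fpos)
    moreover have "f (v + (- t) *\<^sub>R (y - v)) = f v - t * (f y - f v)"
      by (simp add: f_def algebra_simps inner_simps)
    moreover have "0 < t * f y" using t fpos[of y] y closure_subset[of C] by auto
    ultimately show False using f0 by simp
  qed
  then have "f \<in> pos_aff C"
    unfolding pos_aff_def f_def using fpos closure_subset unfolding f_def by blast
  then show ?thesis using f0 fpos by blast
qed

text \<open>
  Apply \<open>packing_of_sections\<close> at each exposed point v with a function f v that
  vanishes at v only. If n is large, the sections at v are so close to v that the function of
  another exposed point is bounded below on them, by compactness. So the families at different
  exposed points are separated from each other, and their sizes add up. Neither n nor K affects
  the leading term as m grows.
\<close>

lemma packing_near_exposed_points:
  fixes C :: "'a::euclidean_space set"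
  assumes C: "hilbert_geometry C" "bounded C" and x: "x \<in> C"
    and E: "finite E" "\<And>v. v \<in> E \<Longrightarrow> {v} exposed_face_of closure C"
  shows "\<exists>n K. \<forall>m\<ge>n. \<exists>X. packing C x (real m + K) X \<and>
    card X = card E * ((m - n + DIM('a)) choose DIM('a))"
proof -
  have C': "open C" "convex C" "C \<noteq> {}" using C by (auto simp: hilbert_geometry_def)
  have "\<exists>y\<in>C. y \<noteq> v" for v
  proof -
    have "infinite C"
      using C' finite_imp_not_open by blast
    then have "\<not> C \<subseteq> {v}" by (meson finite.emptyI finite_insert finite_subset)
    then show ?thesis by blast
  qed
  then have "\<forall>v\<in>E. \<exists>f\<in>pos_aff C. f v = 0 \<and> (\<forall>y\<in>closure C. y \<noteq> v \<longrightarrow> 0 < f y)"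
    using exposed_point_pos_aff[OF C' E(2)] by blast
  then obtain f where "\<forall>v\<in>E. f v \<in> pos_aff C \<and> f v v = 0 \<and> (\<forall>y\<in>closure C. y \<noteq> v \<longrightarrow> 0 < f v y)"
    unfolding bchoice_iff Bex_def by blast
  then have f: "\<And>v. v \<in> E \<Longrightarrow> f v \<in> pos_aff C" "\<And>v. v \<in> E \<Longrightarrow> f v v = 0"
    "\<And>v y. v \<in> E \<Longrightarrow> y \<in> closure C \<Longrightarrow> y \<noteq> v \<Longrightarrow> 0 < f v y"
    by blast+
  obtain R where R1: "R \<ge> 1" and R: "\<forall>g\<in>pos_aff C. \<forall>y\<in>closure C. g y \<le> R * g x"
    using pos_aff_interior_domination[OF C'(1) C(2) x] by (elim exE conjE)
  have cont: "continuous_on S (f v)" if v: "v \<in> E" for v S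
  proof -
    have "\<exists>a w. \<forall>y. f v y = a + w \<bullet> y" using f(1)[OF v] by (simp add: pos_aff_def)
    then obtain a w where aw: "\<forall>y. f v y = a + w \<bullet> y" by (elim exE)
    have "f v = (\<lambda>y. a + w \<bullet> y)" using aw by (intro ext) simp
    moreover have "continuous_on S (\<lambda>y. a + w \<bullet> y)" by (intro continuous_intros)
    ultimately show ?thesis by simp
  qed
  have compact: "compact (closure C)" using C(2) by simp
  have gap: "\<exists>h>0. \<forall>y\<in>closure C. h \<le> f v y \<or> h \<le> f v' y" if "v \<in> E" "v' \<in> E" "v \<noteq> v'" for v v'
  proof -
    have "continuous_on (closure C) (\<lambda>y. max (f v y) (f v' y))"
      using cont that by (intro continuous_on_max)
    moreover have "closure C \<noteq> {}" using C'(3) by simp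
    ultimately obtain z where z: "z \<in> closure C"
      "\<And>y. y \<in> closure C \<Longrightarrow> max (f v z) (f v' z) \<le> max (f v y) (f v' y)"
      using continuous_attains_inf[OF compact] by blast
    have "0 < max (f v z) (f v' z)"
      using f(3)[OF that(1) z(1)] f(3)[OF that(2) z(1)] that(3) by (cases "z = v") auto
    then show ?thesis
      using z(2) by (intro exI[of _ "max (f v z) (f v' z)"]) (auto simp: le_max_iff_disj)
  qed
  have small: "\<forall>\<^sub>F n in sequentially. exp (- 2 * real n) * c < h" if "h > 0" for h c :: real
  proof -
    have "((\<lambda>n. exp (- 2 * real n) * c) \<longlonglongrightarrow> 0 * c)"
    proof (intro tendsto_mult tendsto_const)
      have "filterlim (\<lambda>n. - 2 * real n) at_bot sequentially"
        by (intro filterlim_tendsto_neg_mult_at_bot[of _ "-2"] filterlim_real_sequentially) auto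
      then show "((\<lambda>n. exp (- 2 * real n)) \<longlonglongrightarrow> 0)"
        by (rule filterlim_compose[OF exp_at_bot])
    qed
    then show ?thesis using that by (intro order_tendstoD(2)) auto
  qed
  have pairsep: "\<forall>\<^sub>F n in sequentially. \<forall>p\<in>C. \<forall>q\<in>C.
      f v p \<le> exp (- 2 * real n) * f v x \<longrightarrow> f v' q \<le> exp (- 2 * real n) * f v' x \<longrightarrow>
      1 \<le> hilbert_dist C p q"
    if v: "v \<in> E" "v' \<in> E" "v \<noteq> v'" for v v'
  proof -
    obtain h where h: "h > 0" "\<And>y. y \<in> closure C \<Longrightarrow> h \<le> f v y \<or> h \<le> f v' y"
      using gap[OF v] by blast
    have "\<forall>\<^sub>F n in sequentially. exp (- 2 * real n) * f v x < h / exp 2"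
      "\<forall>\<^sub>F n in sequentially. exp (- 2 * real n) * f v' x < h"
      using small h(1) by auto
    then show ?thesis
    proof eventually_elim
      case (elim n)
      show ?case
      proof (intro ballI impI)
        fix p q assume pq: "p \<in> C" "q \<in> C"
          and le: "f v p \<le> exp (- 2 * real n) * f v x" "f v' q \<le> exp (- 2 * real n) * f v' x"
        have "h \<le> f v q" using h(2)[of q] pq le(2) elim(2) closure_subset by fastforce
        moreover have "f v p < h / exp 2" using le(1) elim(1) by simp
        then have "exp 2 * f v p \<le> h" by (simp add: field_simps)
        ultimately have "1 \<le> hilbert_dist C q p"
          by (intro hilbert_dist_ge_ln_ratio[OF C'(1,2) pq(2,1) f(1)[OF v(1)]]) auto
        then show "1 \<le> hilbert_dist C p q" by (simp add: hilbert_dist_commute)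
      qed
    qed
  qed
  have "\<forall>\<^sub>F n in sequentially. \<forall>v\<in>E. \<forall>v'\<in>E - {v}. \<forall>p\<in>C. \<forall>q\<in>C.
      f v p \<le> exp (- 2 * real n) * f v x \<longrightarrow> f v' q \<le> exp (- 2 * real n) * f v' x \<longrightarrow>
      1 \<le> hilbert_dist C p q"
    by (intro eventually_ball_finite ballI pairsep) (use E(1) in auto)
  then obtain n where n: "\<And>v v' p q. v \<in> E \<Longrightarrow> v' \<in> E \<Longrightarrow> v \<noteq> v' \<Longrightarrow> p \<in> C \<Longrightarrow> q \<in> C \<Longrightarrow>
      f v p \<le> exp (- 2 * real n) * f v x \<Longrightarrow> f v' q \<le> exp (- 2 * real n) * f v' x \<Longrightarrow>
      1 \<le> hilbert_dist C p q"
    unfolding eventually_sequentially by (metis DiffI order_refl singletonD)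
  obtain d where d: "DIM('a) = Suc d" using DIM_positive[where 'a = 'a] by (metis gr0_implies_Suc)
  show ?thesis
  proof (intro exI[of _ n] exI[of _ "real d + ln R / 2"] allI impI)
    fix m assume m: "n \<le> m"
    have "\<forall>v\<in>E. \<exists>X. packing C x (real (m + d) + ln R / 2) X \<and> X \<subseteq> UNIV \<and>
        card X = Suc (m - n + d) choose Suc d \<and> (\<forall>p\<in>X. f v p \<le> exp (- 2 * real n) * f v x)"
    proof
      fix v assume v: "v \<in> E"
      have vcl: "v \<in> closure C"
        using E(2)[OF v] by (meson exposed_face_of_def face_of_imp_subset insert_subset)
      show "\<exists>X. packing C x (real (m + d) + ln R / 2) X \<and> X \<subseteq> UNIV \<and>
        card X = Suc (m - n + d) choose Suc d \<and> (\<forall>p\<in>X. f v p \<le> exp (- 2 * real n) * f v x)"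
      proof (rule packing_of_sections[OF C'(1,2) x vcl R1 _ f(1,2)[OF v]])
        show "g v \<le> R * g x" if "g \<in> pos_aff C" for g using R that vcl by blast
        show "\<exists>X. packing C y (real (m + d)) X \<and> X \<subseteq> H' \<and> card X = m + d choose d"
          if "y \<in> C" "affine H'" "y \<in> H'" "aff_dim H' = int d" for y H' m
          by (rule packing_in_affine_section[OF C(1) that])
      qed (use m d in auto)
    qed
    then obtain X where X: "\<And>v. v \<in> E \<Longrightarrow> packing C x (real (m + d) + ln R / 2) (X v)"
      "\<And>v. v \<in> E \<Longrightarrow> card (X v) = Suc (m - n + d) choose Suc d"
      "\<And>v p. v \<in> E \<Longrightarrow> p \<in> X v \<Longrightarrow> f v p \<le> exp (- 2 * real n) * f v x"
      by metis
    have XC: "p \<in> C" if "v \<in> E" "p \<in> X v" for p v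
      using X(1)[OF that(1)] that(2) by (auto simp: packing_def)
    have sep: "1 \<le> hilbert_dist C p q"
      if "v \<in> E" "v' \<in> E" "v \<noteq> v'" "p \<in> X v" "q \<in> X v'" for v v' p q
      using n[OF that(1-3) XC[OF that(1,4)] XC[OF that(2,5)]] X(3) that by blast
    have "packing C x (real m + (real d + ln R / 2)) (\<Union>v\<in>E. X v)"
      unfolding packing_def
    proof (intro conjI ballI impI)
      show "finite (\<Union>v\<in>E. X v)" "(\<Union>v\<in>E. X v) \<subseteq> C"
        using X(1) XC E(1) by (auto simp: packing_def)
      fix p assume "p \<in> (\<Union>v\<in>E. X v)"
      then obtain v where v: "v \<in> E" "p \<in> X v" by blast
      then show "hilbert_dist C x p \<le> real m + (real d + ln R / 2)"
        using X(1)[OF v(1)] by (auto simp: packing_def add.assoc)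
      fix q assume "q \<in> (\<Union>v\<in>E. X v)" and ne: "p \<noteq> q"
      then obtain v' where v': "v' \<in> E" "q \<in> X v'" by blast
      show "1 \<le> hilbert_dist C p q"
      proof (cases "v = v'")
        case True
        then show ?thesis using X(1)[OF v(1)] v(2) v'(2) ne by (auto simp: packing_def)
      next
        case False
        then show ?thesis using sep v v' by blast
      qed
    qed
    moreover have "card (\<Union>v\<in>E. X v) = card E * ((m - n + DIM('a)) choose DIM('a))"
    proof -
      have "card (\<Union>v\<in>E. X v) = (\<Sum>v\<in>E. card (X v))"
      proof (rule card_UN_disjoint[OF E(1)])
        show "\<forall>v\<in>E. finite (X v)" using X(1) by (auto simp: packing_def)
        show "\<forall>v\<in>E. \<forall>v'\<in>E. v \<noteq> v' \<longrightarrow> X v \<inter> X v' = {}"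
        proof (intro ballI impI)
          fix v v' assume v: "v \<in> E" "v' \<in> E" "v \<noteq> v'"
          show "X v \<inter> X v' = {}" using sep[OF v] by fastforce
        qed
      qed
      then show ?thesis using X(2) by (simp add: d)
    qed
    ultimately show "\<exists>X. packing C x (real m + (real d + ln R / 2)) X \<and>
        card X = card E * ((m - n + DIM('a)) choose DIM('a))" by blast
  qed
qed

text \<open>
  The tangent hyperplane at z of the sphere with centre c through z meets the ball, hence S, in
  z only.
\<close>

lemma farthest_point_exposed:
  fixes S :: "'a::euclidean_space set"
  assumes S: "convex S" and z: "z \<in> S" "\<And>y. y \<in> S \<Longrightarrow> dist c y \<le> dist c z"
  shows "{z} exposed_face_of S"
proof -
  let ?a = "z - c"
  have key: "?a \<bullet> y \<le> ?a \<bullet> z - (dist y z)\<^sup>2 / 2" if "y \<in> S" for y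
  proof -
    have "(norm (y - c))\<^sup>2 \<le> (norm (z - c))\<^sup>2"
      using z(2)[OF that] by (simp add: dist_norm norm_minus_commute power_mono)
    moreover have "(norm (y - c))\<^sup>2 = (norm (y - z))\<^sup>2 + 2 * (?a \<bullet> (y - z)) + (norm (z - c))\<^sup>2"
      by (simp add: power2_norm_eq_inner algebra_simps inner_simps inner_commute)
    ultimately show ?thesis by (simp add: dist_norm inner_diff_right)
  qed
  have "S \<inter> {x. ?a \<bullet> x = ?a \<bullet> z} = {z}"
    using key z(1) by (force simp: power2_less_eq_zero_iff)
  moreover have "(S \<inter> {x. ?a \<bullet> x = ?a \<bullet> z}) exposed_face_of S"
  proof (rule exposed_face_of_Int_supporting_hyperplane_le[OF S])
    fix y assume "y \<in> S"
    show "?a \<bullet> y \<le> ?a \<bullet> z" using key[OF \<open>y \<in> S\<close>] zero_le_power2[of "dist y z"] by linarith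
  qed
  ultimately show ?thesis by simp
qed

text \<open>
  If z were outside the hull, a ball with far away centre c would contain the hull but not z.
  The point of S farthest from c would then be an exposed point outside the hull.
\<close>

lemma hull_of_finitely_many_exposed_points:
  fixes S :: "'a::euclidean_space set"
  assumes S: "compact S" "convex S" and fin: "finite {v. {v} exposed_face_of S}"
  shows "S = convex hull {v. {v} exposed_face_of S}"
proof
  let ?E = "{v. {v} exposed_face_of S}"
  have "?E \<subseteq> S"
    by (auto simp: exposed_face_of_def dest: face_of_imp_subset)
  then show "convex hull ?E \<subseteq> S" using S(2) by (rule hull_minimal)
  show "S \<subseteq> convex hull ?E"
  proof
    fix z assume z: "z \<in> S"
    show "z \<in> convex hull ?E"
    proof (rule ccontr)
      assume nz: "z \<notin> convex hull ?E"
      have "closed (convex hull ?E)"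
        using finite_imp_compact_convex_hull[OF fin] compact_imp_closed by blast
      then obtain a b where ab: "a \<bullet> z < b" "\<And>y. y \<in> convex hull ?E \<Longrightarrow> b < a \<bullet> y"
        using separating_hyperplane_closed_point[of "convex hull ?E" z] nz convex_convex_hull by blast
      obtain D where D: "\<And>y. y \<in> S \<Longrightarrow> dist z y \<le> D"
        using bounded_any_center[of S z] compact_imp_bounded[OF S(1)] by auto
      \<comment> \<open>So far from z that a point at distance at most D from z is nearer to c than z is, if it
        lies beyond the separating hyperplane.\<close>
      define l where "l = (D\<^sup>2 + 1) / (2 * (b - a \<bullet> z))"
      define c where "c = z + l *\<^sub>R a"
      obtain y where y: "y \<in> S" "\<And>y'. y' \<in> S \<Longrightarrow> dist c y' \<le> dist c y"
        using distance_attains_sup[OF S(1), of c] z by blast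
      have "{y} exposed_face_of S" by (rule farthest_point_exposed[OF S(2) y])
      then have "y \<in> convex hull ?E" by (intro hull_inc) simp
      then have "b < a \<bullet> y" by (rule ab(2))
      have l: "l > 0" using ab(1) by (simp add: l_def add_nonneg_pos)
      have "dist c z \<le> dist c y" by (rule y(2)[OF z])
      then have "(norm (z - c))\<^sup>2 \<le> (norm (y - c))\<^sup>2"
        by (simp add: dist_norm norm_minus_commute power_mono)
      also have "\<dots> = (norm (y - z))\<^sup>2 + 2 * ((z - c) \<bullet> (y - z)) + (norm (z - c))\<^sup>2"
        by (simp add: power2_norm_eq_inner algebra_simps inner_simps inner_commute)
      finally have "0 \<le> (norm (y - z))\<^sup>2 - 2 * l * (a \<bullet> (y - z))"
        by (simp add: c_def)
      also have "(norm (y - z))\<^sup>2 \<le> D\<^sup>2"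
        using D[OF y(1)] by (intro power_mono) (auto simp: dist_norm norm_minus_commute)
      finally have "2 * l * (a \<bullet> (y - z)) \<le> D\<^sup>2" by simp
      moreover have "2 * l * (b - a \<bullet> z) = D\<^sup>2 + 1"
        using ab(1) unfolding l_def by (simp add: field_simps del: right_diff_distrib left_diff_distrib)
      moreover have "2 * l * (b - a \<bullet> z) < 2 * l * (a \<bullet> (y - z))"
        using l \<open>b < a \<bullet> y\<close> by (simp add: inner_diff_right)
      ultimately show False by linarith
    qed
  qed
qed

section \<open>Projective transformations\<close>

lemma linear_functional_inner:
  fixes \<phi> :: "'a::euclidean_space \<Rightarrow> real"
  assumes "linear \<phi>"
  shows "\<exists>w. \<forall>y. \<phi> y = w \<bullet> y"
proof (intro exI[of _ "adjoint \<phi> 1"] allI)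
  fix y
  show "\<phi> y = adjoint \<phi> 1 \<bullet> y"
    using adjoint_works[OF assms, of y 1] by (simp add: inner_commute)
qed

text \<open>
  The condition of \<open>polytopal\<close> on a projective transformation, as a predicate in
  its own right: L is invertible and sends no point of S to infinity.
\<close>

definition proj_admissible :: "('a::euclidean_space \<times> real \<Rightarrow> 'a \<times> real) \<Rightarrow> 'a set \<Rightarrow> bool" where
  "proj_admissible L S \<longleftrightarrow> linear L \<and> bij L \<and> (\<forall>y\<in>S. 0 < snd (L (y, 1)))"

lemma proj_admissible_homogeneous:
  assumes "proj_admissible L S" "y \<in> S"
  shows "L (y, 1) = snd (L (y, 1)) *\<^sub>R (proj_map L y, 1)"
proof -
  have "snd (L (y, 1)) \<noteq> 0" using assms by (force simp: proj_admissible_def)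
  then show ?thesis by (simp add: proj_map_def prod_eq_iff)
qed

lemma proj_inverse:
  assumes L: "proj_admissible L S" and y: "y \<in> S"
  shows "inv L (proj_map L y, 1) = (1 / snd (L (y, 1))) *\<^sub>R (y, 1)"
proof -
  have lin: "linear L" and bij: "bij L" and pos: "0 < snd (L (y, 1))"
    using L y by (auto simp: proj_admissible_def)
  have "L ((1 / snd (L (y, 1))) *\<^sub>R (y, 1)) = (1 / snd (L (y, 1))) *\<^sub>R L (y, 1)"
    by (rule linear_cmul[OF lin])
  also have "\<dots> = (proj_map L y, 1)"
    by (subst (2) proj_admissible_homogeneous[OF L y]) (use pos in simp)
  finally show ?thesis using bij by (metis bij_inv_eq_iff)
qed

lemma proj_map_inverse:
  assumes L: "proj_admissible L S"
  shows "proj_admissible (inv L) (proj_map L ` S)"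
    and "\<And>y. y \<in> S \<Longrightarrow> proj_map (inv L) (proj_map L y) = y"
    and "proj_map (inv L) ` proj_map L ` S = S"
proof -
  have pos: "0 < snd (L (y, 1))" if "y \<in> S" for y
    using L that by (auto simp: proj_admissible_def)
  have lin: "linear L" and bij: "bij L" using L by (auto simp: proj_admissible_def)
  have "linear (inv L)"
  proof (rule linearI)
    fix u v c
    have "L (inv L u + inv L v) = u + v" "L (c *\<^sub>R inv L u) = c *\<^sub>R u"
      using bij by (simp_all add: linear_add[OF lin] linear_cmul[OF lin] bij_is_surj surj_f_inv_f)
    then show "inv L (u + v) = inv L u + inv L v" "inv L (c *\<^sub>R u) = c *\<^sub>R inv L u"
      using bij_inv_eq_iff[OF bij] by metis+
  qed
  moreover have "bij (inv L)" using bij by (rule bij_imp_bij_inv)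
  ultimately show "proj_admissible (inv L) (proj_map L ` S)"
    using proj_inverse[OF L] pos by (auto simp: proj_admissible_def)
  show inv: "proj_map (inv L) (proj_map L y) = y" if "y \<in> S" for y
    unfolding proj_map_def[of "inv L"] proj_inverse[OF L that] using pos[OF that] by simp
  show "proj_map (inv L) ` proj_map L ` S = S"
    using inv by force
qed

text \<open>
  In homogeneous coordinates an affine function is a linear form, which can be composed with L.
  The affine function so obtained is the pullback of g up to the denominator of the projective
  map.
\<close>

lemma pos_aff_pullback:
  fixes L :: "'a::euclidean_space \<times> real \<Rightarrow> 'a \<times> real"
  assumes L: "proj_admissible L S" and g: "g \<in> pos_aff (proj_map L ` S)"
  shows "\<exists>h\<in>pos_aff S. \<forall>y\<in>S. h y = snd (L (y, 1)) * g (proj_map L y)"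
proof -
  obtain a w where aw: "\<forall>z. g z = a + w \<bullet> z" using g by (auto simp: pos_aff_def)
  have lin: "linear L" using L by (simp add: proj_admissible_def)
  define \<psi> where "\<psi> v = a * snd (L v) + w \<bullet> fst (L v)" for v
  have "linear (\<lambda>y. \<psi> (y, 0))"
  proof (rule linearI)
    fix y z :: 'a and c :: real
    have "L (y + z, 0) = L (y, 0) + L (z, 0)" using linear_add[OF lin, of "(y, 0)" "(z, 0)"] by simp
    then show "\<psi> (y + z, 0) = \<psi> (y, 0) + \<psi> (z, 0)" by (simp add: \<psi>_def algebra_simps inner_simps)
    have "L (c *\<^sub>R y, 0) = c *\<^sub>R L (y, 0)" using linear_cmul[OF lin, of c "(y, 0)"] by simp
    then show "\<psi> (c *\<^sub>R y, 0) = c *\<^sub>R \<psi> (y, 0)" by (simp add: \<psi>_def algebra_simps)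
  qed
  then obtain u where u: "\<forall>y. \<psi> (y, 0) = u \<bullet> y" using linear_functional_inner by blast
  have \<psi>1: "\<psi> (y, 1) = \<psi> (0, 1) + u \<bullet> y" for y
  proof -
    have "L (y, 1) = L (y, 0) + L (0, 1)" using linear_add[OF lin, of "(y, 0)" "(0, 1)"] by simp
    then show ?thesis using u by (simp add: \<psi>_def algebra_simps inner_simps)
  qed
  have eq: "\<psi> (y, 1) = snd (L (y, 1)) * g (proj_map L y)" if "y \<in> S" for y
  proof -
    have "0 < snd (L (y, 1))" using L that by (simp add: proj_admissible_def)
    then show ?thesis using aw by (simp add: \<psi>_def proj_map_def field_simps)
  qed
  show ?thesis
  proof (intro bexI[of _ "\<lambda>y. \<psi> (y, 1)"] ballI eq)
    show "(\<lambda>y. \<psi> (y, 1)) \<in> pos_aff S"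
      unfolding pos_aff_def
    proof (intro CollectI conjI ballI)
      show "\<exists>a w. \<forall>y. \<psi> (y, 1) = a + w \<bullet> y" using \<psi>1 by blast
      fix y assume y: "y \<in> S"
      have "0 < g (proj_map L y)" using pos_affD[OF g] y by blast
      then show "0 < \<psi> (y, 1)" unfolding eq[OF y] using L y by (simp add: proj_admissible_def)
    qed
  qed
qed

text \<open>
  In the cross ratio f p g q / (f q g p) of two pulled back functions the denominators cancel.
\<close>

lemma hilbert_dist_proj_map_le:
  fixes L :: "'a::euclidean_space \<times> real \<Rightarrow> 'a \<times> real"
  assumes L: "proj_admissible L S" and S: "open S" "convex S"
    and T: "open (proj_map L ` S)" "convex (proj_map L ` S)" and pq: "p \<in> S" "q \<in> S"
  shows "hilbert_dist (proj_map L ` S) (proj_map L p) (proj_map L q) \<le> hilbert_dist S p q"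
proof -
  let ?T = "proj_map L ` S" and ?p = "proj_map L p" and ?q = "proj_map L q"
  have pqT: "?p \<in> ?T" "?q \<in> ?T" using pq by auto
  obtain f where f: "f \<in> pos_aff ?T" "f ?p = exit_ratio ?T ?p ?q * f ?q"
    using exit_ratio_attained[OF T pqT] .
  obtain g where g: "g \<in> pos_aff ?T" "g ?q = exit_ratio ?T ?q ?p * g ?p"
    using exit_ratio_attained[OF T pqT(2,1)] .
  obtain f' where f': "f' \<in> pos_aff S" "\<forall>y\<in>S. f' y = snd (L (y, 1)) * f (proj_map L y)"
    using pos_aff_pullback[OF L f(1)] by blast
  obtain g' where g': "g' \<in> pos_aff S" "\<forall>y\<in>S. g' y = snd (L (y, 1)) * g (proj_map L y)"
    using pos_aff_pullback[OF L g(1)] by blast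
  have pos: "0 < snd (L (p, 1))" "0 < snd (L (q, 1))"
    using L pq by (auto simp: proj_admissible_def)
  have fg: "0 < f ?q" "0 < g ?p" using pos_affD[OF f(1)] pos_affD[OF g(1)] pqT by auto
  have "f' p / f' q * (g' q / g' p) = f ?p / f ?q * (g ?q / g ?p)"
    using f'(2) g'(2) pq pos fg by (simp add: field_simps)
  also have "\<dots> = exit_ratio ?T ?q ?p * exit_ratio ?T ?p ?q"
    using f(2) g(2) fg by simp
  finally show ?thesis
    using hilbert_dist_ge[OF S pq f'(1) g'(1)] unfolding hilbert_dist_eq[of ?T] by simp
qed

lemma hilbert_dist_proj_map:
  fixes L :: "'a::euclidean_space \<times> real \<Rightarrow> 'a \<times> real"
  assumes L: "proj_admissible L S" and S: "open S" "convex S"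
    and T: "open (proj_map L ` S)" "convex (proj_map L ` S)" and pq: "p \<in> S" "q \<in> S"
  shows "hilbert_dist (proj_map L ` S) (proj_map L p) (proj_map L q) = hilbert_dist S p q"
proof (rule antisym)
  note inv = proj_map_inverse[OF L]
  show "hilbert_dist (proj_map L ` S) (proj_map L p) (proj_map L q) \<le> hilbert_dist S p q"
    by (rule hilbert_dist_proj_map_le[OF assms])
  have "hilbert_dist (proj_map (inv L) ` proj_map L ` S)
      (proj_map (inv L) (proj_map L p)) (proj_map (inv L) (proj_map L q))
    \<le> hilbert_dist (proj_map L ` S) (proj_map L p) (proj_map L q)"
    by (rule hilbert_dist_proj_map_le[OF inv(1) T]) (use S pq inv(3) in auto)
  then show "hilbert_dist S p q \<le> hilbert_dist (proj_map L ` S) (proj_map L p) (proj_map L q)"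
    unfolding inv(3) inv(2)[OF pq(1)] inv(2)[OF pq(2)] .
qed

lemma packing_proj_map:
  fixes L :: "'a::euclidean_space \<times> real \<Rightarrow> 'a \<times> real"
  assumes L: "proj_admissible L S" and S: "open S" "convex S"
    and T: "open (proj_map L ` S)" "convex (proj_map L ` S)" and x: "x \<in> S" and X: "packing S x r X"
  shows "packing (proj_map L ` S) (proj_map L x) r (proj_map L ` X)"
    and "card (proj_map L ` X) = card X"
proof -
  note iso = hilbert_dist_proj_map[OF L S T]
  have XS: "X \<subseteq> S" using X by (simp add: packing_def)
  have "inj_on (proj_map L) S"
    using proj_map_inverse(2)[OF L] by (rule inj_on_inverseI)
  then show "card (proj_map L ` X) = card X"
    using XS by (intro card_image) (rule inj_on_subset)
  show "packing (proj_map L ` S) (proj_map L x) r (proj_map L ` X)"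
    unfolding packing_def
  proof (intro conjI ballI impI)
    show "finite (proj_map L ` X)" "proj_map L ` X \<subseteq> proj_map L ` S"
      using X by (auto simp: packing_def)
  next
    fix z assume "z \<in> proj_map L ` X"
    then obtain p where p: "p \<in> X" "z = proj_map L p" by blast
    then show "hilbert_dist (proj_map L ` S) (proj_map L x) z \<le> r"
      using iso[OF x, of p] XS X by (auto simp: packing_def)
  next
    fix z z' assume "z \<in> proj_map L ` X" "z' \<in> proj_map L ` X" and ne: "z \<noteq> z'"
    then obtain p q where p: "p \<in> X" "z = proj_map L p" "q \<in> X" "z' = proj_map L q" by blast
    then have "hilbert_dist (proj_map L ` S) z z' = hilbert_dist S p q"
      using iso[of p q] XS by auto
    then show "1 \<le> hilbert_dist (proj_map L ` S) z z'"
      using X p ne by (auto simp: packing_def)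
  qed
qed

text \<open>
  A projective map sends segments to segments but changes the weights: the weight u at z1
  becomes u / D y1, up to normalisation, where D is the denominator.
\<close>

lemma convex_proj_map:
  assumes L: "proj_admissible L S" and S: "convex S"
  shows "convex (proj_map L ` S)"
proof (rule convexI)
  fix z1 z2 and u v :: real
  assume z: "z1 \<in> proj_map L ` S" "z2 \<in> proj_map L ` S" and uv: "0 \<le> u" "0 \<le> v" "u + v = 1"
  obtain y1 y2 where y: "y1 \<in> S" "z1 = proj_map L y1" "y2 \<in> S" "z2 = proj_map L y2" using z by blast
  have lin: "linear L" using L by (simp add: proj_admissible_def)
  define D where "D y = snd (L (y, 1))" for y
  have D: "0 < D y1" "0 < D y2" using L y by (auto simp: proj_admissible_def D_def)
  have hom: "L (y1, 1) = D y1 *\<^sub>R (z1, 1)" "L (y2, 1) = D y2 *\<^sub>R (z2, 1)"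
    using proj_admissible_homogeneous[OF L] y by (auto simp: D_def)
  define s where "s = u / D y1 + v / D y2"
  have s: "0 < s"
  proof (cases "u = 0")
    case True then show ?thesis using uv D by (simp add: s_def)
  next
    case False then show ?thesis using uv D by (simp add: s_def add_pos_nonneg)
  qed
  \<comment> \<open>The weights of y1 and y2 whose image under the projective map is u z1 + v z2.\<close>
  define a b where "a = u / D y1 / s" and "b = v / D y2 / s"
  have ab: "0 \<le> a" "0 \<le> b"
    using uv D s by (auto simp: a_def b_def)
  have ab1: "a + b = 1"
    unfolding a_def b_def add_divide_distrib[symmetric] s_def[symmetric] using s by simp
  define y where "y = a *\<^sub>R y1 + b *\<^sub>R y2"
  have yS: "y \<in> S" unfolding y_def using S ab ab1 y by (intro convexD) auto
  have "(y, 1::real) = a *\<^sub>R (y1, 1) + b *\<^sub>R (y2, 1)" using ab1 by (simp add: y_def)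
  then have "L (y, 1) = a *\<^sub>R L (y1, 1) + b *\<^sub>R L (y2, 1)"
    using lin by (simp only: linear_add linear_cmul)
  moreover have "a * D y1 = u / s" "b * D y2 = v / s"
    using D by (simp_all add: a_def b_def)
  ultimately have Ly: "L (y, 1) = (u / s) *\<^sub>R (z1, 1) + (v / s) *\<^sub>R (z2, 1)"
    unfolding hom scaleR_scaleR by simp
  then have "snd (L (y, 1)) = 1 / s" using uv(3) by (simp add: add_divide_distrib[symmetric])
  moreover have "fst (L (y, 1)) = (1 / s) *\<^sub>R (u *\<^sub>R z1 + v *\<^sub>R z2)"
    using Ly by (simp add: scaleR_add_right)
  ultimately have "proj_map L y = u *\<^sub>R z1 + v *\<^sub>R z2"
    using s by (simp add: proj_map_def)
  then show "u *\<^sub>R z1 + v *\<^sub>R z2 \<in> proj_map L ` S" using yS by (metis imageI)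
qed

text \<open>
  The image is the preimage under the inverse transformation, which is continuous where its
  denominator is positive.
\<close>

lemma open_proj_map:
  fixes L :: "'a::euclidean_space \<times> real \<Rightarrow> 'a \<times> real"
  assumes L: "proj_admissible L S" and S: "open S"
  shows "open (proj_map L ` S)"
proof -
  let ?M = "inv L"
  note inv = proj_map_inverse[OF L]
  have linM: "linear ?M" using inv(1) by (simp add: proj_admissible_def)
  have bij: "bij L" using L by (simp add: proj_admissible_def)
  define U where "U = {z. 0 < snd (?M (z, 1))}"
  have cont: "continuous_on A (\<lambda>z. ?M (z, 1))" for A
    by (rule continuous_on_compose2[OF linear_continuous_on[of ?M UNIV]])
      (use linM in \<open>auto intro!: continuous_intros simp: linear_conv_bounded_linear\<close>)
  have openU: "open U"
    unfolding U_def by (intro open_Collect_less continuous_intros cont)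
  have contM: "continuous_on U (proj_map ?M)"
    unfolding proj_map_def U_def by (intro continuous_intros cont) auto
  have "proj_map L ` S = U \<inter> proj_map ?M -` S"
  proof (intro set_eqI iffI)
    fix z assume "z \<in> proj_map L ` S"
    then show "z \<in> U \<inter> proj_map ?M -` S"
      using inv(1,2) by (auto simp: U_def proj_admissible_def)
  next
    fix z assume z: "z \<in> U \<inter> proj_map ?M -` S"
    have adm: "proj_admissible ?M U"
      using inv(1) by (auto simp: proj_admissible_def U_def)
    have "proj_map (inv ?M) (proj_map ?M z) = z"
      using proj_map_inverse(2)[OF adm, of z] z by auto
    then have "proj_map L (proj_map ?M z) = z" by (simp add: inv_inv_eq[OF bij])
    then show "z \<in> proj_map L ` S" using z by (metis IntD2 imageI vimageD)
  qed
  then show ?thesis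
    using continuous_open_preimage[OF contM openU S] by simp
qed

lemma bounded_hilbert_geometry:
  fixes C :: "'a::euclidean_space set"
  assumes "C \<noteq> {}" "open C" "convex C" "bounded C"
  shows "hilbert_geometry C"
proof -
  have False if v: "v \<noteq> 0" and sub: "range (\<lambda>t. p + t *\<^sub>R v) \<subseteq> C" for p v
  proof -
    obtain B where B: "\<And>y. y \<in> C \<Longrightarrow> norm y \<le> B" using assms(4) by (auto simp: bounded_iff)
    define t where "t = (B + norm p + 1) / norm v"
    have "norm (t *\<^sub>R v) = \<bar>B + norm p + 1\<bar>" using v by (simp add: t_def)
    moreover have "norm (p + t *\<^sub>R v) \<le> B" using sub by (intro B) blast
    moreover have "norm (t *\<^sub>R v) \<le> norm (p + t *\<^sub>R v) + norm p"
      by (metis add_diff_cancel_left' norm_triangle_ineq4)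
    ultimately show False by linarith
  qed
  then show ?thesis using assms unfolding hilbert_geometry_def by blast
qed

text \<open>
  Divide by a positive affine function that dominates the norm.
\<close>

lemma projectively_bounded:
  fixes C :: "'a::euclidean_space set"
  assumes C: "hilbert_geometry C"
  shows "\<exists>L. proj_admissible L C \<and> bounded (proj_map L ` C)"
proof -
  obtain a w K where "a \<noteq> 0" and D: "\<forall>y\<in>C. 0 < a + w \<bullet> y \<and> norm y \<le> K * (a + w \<bullet> y)"
    using hilbert_geometry_pos_aff_dominates_norm[OF C] by (elim exE conjE)
  define L :: "'a \<times> real \<Rightarrow> 'a \<times> real" where "L v = (fst v, a * snd v + w \<bullet> fst v)" for v
  have lin: "linear L"
    by (rule linearI) (auto simp: L_def algebra_simps inner_simps)
  have "bij L"
  proof (rule bij_betw_byWitness[where f' = "\<lambda>v. (fst v, (snd v - w \<bullet> fst v) / a)"])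
  qed (use \<open>a \<noteq> 0\<close> in \<open>auto simp: L_def\<close>)
  then have adm: "proj_admissible L C" using lin D by (simp add: proj_admissible_def L_def)
  have "norm z \<le> K" if z: "z \<in> proj_map L ` C" for z
  proof -
    obtain y where y: "y \<in> C" "z = proj_map L y" using z by blast
    have "0 < a + w \<bullet> y" "norm y \<le> K * (a + w \<bullet> y)" using D y by auto
    then show ?thesis
      unfolding y by (simp add: proj_map_def L_def field_simps)
  qed
  then show ?thesis using adm by (auto simp: bounded_iff)
qed

section \<open>Lower bounds for the volume growth\<close>

lemma busemann_vol_mono: "A \<subseteq> B \<Longrightarrow> busemann_vol C A \<le> busemann_vol C B"
  unfolding busemann_vol_def
  by (intro nn_integral_mono mult_left_mono) (auto simp: indicator_def)

lemma hilbert_ball_mono: "r \<le> s \<Longrightarrow> hilbert_ball C x r \<subseteq> hilbert_ball C x s"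
  by (auto simp: hilbert_ball_def)

text \<open>
  Up to the volume of the unit ball, the product of (1 / 16) \<open>^\<close> d, from
  \<open>busemann_vol_ge_packing\<close>, with (1 / (2 d)) \<open>^\<close> d, from the estimate
  of the binomial coefficient in \<open>busemann_vol_ge_binomial_packing\<close>.
\<close>

definition packing_const :: "'a::euclidean_space itself \<Rightarrow> real" where
  "packing_const T = unit_ball_vol (real DIM('a)) * (1 / (32 * real DIM('a))) ^ DIM('a)"

text \<open>
  The inequality (n / d) \<open>^\<close> d \<open>\<le>\<close> n choose d turns the size of a
  packing into a power of r.
\<close>

lemma busemann_vol_ge_binomial_packing:
  fixes C :: "'a::euclidean_space set"
  assumes C: "hilbert_geometry C" and x: "x \<in> C" and X: "packing C x s X" and sr: "s + 1 \<le> r" and r: "0 \<le> r"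
    and card: "card X = N * ((j + DIM('a)) choose DIM('a))" and j: "r / 2 \<le> real (j + DIM('a))"
  shows "ennreal (packing_const TYPE('a) * real N * r ^ DIM('a)) \<le> busemann_vol C (hilbert_ball C x r)"
proof -
  let ?d = "DIM('a)"
  have d: "0 < ?d" by (rule DIM_positive)
  have "(r / (2 * real ?d)) ^ ?d \<le> (real (j + ?d) / real ?d) ^ ?d"
    using j r d by (intro power_mono) (auto simp: field_simps)
  also have "\<dots> \<le> real ((j + ?d) choose ?d)"
    using binomial_ge_n_over_k_pow_k[of ?d "j + ?d", where 'a = real] by simp
  finally have "real N * (r / (2 * real ?d)) ^ ?d \<le> real (card X)"
    unfolding card of_nat_mult by (intro mult_left_mono) auto
  then have "real N * (r / (2 * real ?d)) ^ ?d * (unit_ball_vol (real ?d) * (1 / 16) ^ ?d)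
      \<le> real (card X) * (unit_ball_vol (real ?d) * (1 / 16) ^ ?d)"
    by (intro mult_right_mono) auto
  note le = ennreal_leI[OF this]
  have eq: "packing_const TYPE('a) * real N * r ^ ?d
      = real N * (r / (2 * real ?d)) ^ ?d * (unit_ball_vol (real ?d) * (1 / 16) ^ ?d)"
  proof -
    have "(32::real) ^ ?d = 2 ^ ?d * 16 ^ ?d"
      using power_mult_distrib[of "2::real" 16 ?d] by simp
    then show ?thesis
      by (simp add: packing_const_def power_divide power_mult_distrib ac_simps)
  qed
  have "ennreal (packing_const TYPE('a) * real N * r ^ ?d)
      \<le> ennreal (real (card X) * (unit_ball_vol (real ?d) * (1 / 16) ^ ?d))"
    unfolding eq by (rule le)
  also have "\<dots> \<le> busemann_vol C (hilbert_ball C x (s + 1))"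
    by (rule busemann_vol_ge_packing[OF C x X])
  also have "\<dots> \<le> busemann_vol C (hilbert_ball C x r)"
    by (intro busemann_vol_mono hilbert_ball_mono sr)
  finally show ?thesis .
qed

text \<open>
  For large r the packing is used. For small r the packing may have only one point; then one
  Macbeath piece at x itself, of size proportional to r, has enough volume.
\<close>

lemma busemann_vol_ball_ge:
  fixes C :: "'a::euclidean_space set"
  assumes C: "hilbert_geometry C" and x: "x \<in> C" and r: "0 < r"
  shows "ennreal (min (packing_const TYPE('a))
      (unit_ball_vol (real DIM('a)) * (1 / (8 * (real DIM('a) + 4))) ^ DIM('a)) * r ^ DIM('a))
    \<le> busemann_vol C (hilbert_ball C x r)"
proof -
  let ?d = "DIM('a)"
  let ?c2 = "unit_ball_vol (real ?d) * (1 / (8 * (real ?d + 4))) ^ ?d"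
  have C': "open C" "convex C" "C \<noteq> {}" using C by (auto simp: hilbert_geometry_def)
  have d: "0 < ?d" by (rule DIM_positive)
  show ?thesis
  proof (cases "real ?d + 4 \<le> r")
    case True
    define m where "m = nat \<lfloor>r - 1 - real ?d\<rfloor>"
    have m: "real m \<le> r - 1 - real ?d" "r - 2 - real ?d \<le> real m"
      using True by (simp_all add: m_def) linarith
    obtain X where X: "packing C x (real (m + ?d)) X" "card X = (m + ?d) choose ?d"
      using packing_in_affine_section[OF C x, of UNIV ?d m] by (auto simp: aff_dim_UNIV)
    have "min (packing_const TYPE('a)) ?c2 * r ^ ?d \<le> packing_const TYPE('a) * real 1 * r ^ ?d"
      using r by (simp add: mult_right_mono)
    then have "ennreal (min (packing_const TYPE('a)) ?c2 * r ^ ?d)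
        \<le> ennreal (packing_const TYPE('a) * real 1 * r ^ ?d)"
      by (rule ennreal_leI)
    also have "\<dots> \<le> busemann_vol C (hilbert_ball C x r)"
      by (rule busemann_vol_ge_binomial_packing[OF C x X(1) _ _ _, where j = m]) (use X m r True in auto)
    finally show ?thesis .
  next
    case False
    \<comment> \<open>Less than 1/2 for r below d + 4; the distance from x is then at most 2 k, which is less than r.\<close>
    define k where "k = r / (2 * (real ?d + 4))"
    have k: "0 < k" "k < 1 / 2" using r False by (auto simp: k_def field_simps)
    have "ln ((1 + k) / (1 - k)) / 2 < r"
    proof -
      have "ln ((1 + k) / (1 - k)) \<le> (1 + k) / (1 - k) - 1"
        using k by (intro ln_le_minus_one) auto
      also have "\<dots> = 2 * k / (1 - k)" using k by (simp add: field_simps)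
      also have "\<dots> \<le> 4 * k"
      proof -
        have "2 * k \<le> 4 * k * (1 - k)" using k by (simp add: algebra_simps)
        then show ?thesis using k by (simp add: pos_divide_le_eq)
      qed
      also have "\<dots> < 2 * r" using r by (simp add: k_def field_simps add_pos_nonneg)
      finally show ?thesis by simp
    qed
    then have sub: "(\<lambda>v. x + k *\<^sub>R v) ` macbeath C x \<subseteq> hilbert_ball C x r"
      using macbeath_translate_comparison(1)[OF C', of k] hilbert_dist_macbeath_translate[OF C' x, of k] k
      by (force simp: hilbert_ball_def)
    have "ennreal (real (card {x}) * (unit_ball_vol (real ?d) * (k / 4) ^ ?d))
        \<le> busemann_vol C (hilbert_ball C x r)"
      using sub x k by (intro busemann_vol_ge_disjoint_macbeath[OF C]) (auto simp: disjoint_family_on_def)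
    then have vol: "ennreal (?c2 * r ^ ?d) \<le> busemann_vol C (hilbert_ball C x r)"
      if "?c2 * r ^ ?d = real (card {x}) * (unit_ball_vol (real ?d) * (k / 4) ^ ?d)"
      unfolding that .
    have "min (packing_const TYPE('a)) ?c2 * r ^ ?d \<le> ?c2 * r ^ ?d"
      using r by (intro mult_right_mono) auto
    then have "ennreal (min (packing_const TYPE('a)) ?c2 * r ^ ?d) \<le> ennreal (?c2 * r ^ ?d)"
      by (rule ennreal_leI)
    also have "\<dots> \<le> busemann_vol C (hilbert_ball C x r)"
    proof (rule vol)
      show "?c2 * r ^ ?d = real (card {x}) * (unit_ball_vol (real ?d) * (k / 4) ^ ?d)"
      proof -
        have "k / 4 = (1 / (8 * (real ?d + 4))) * r" by (simp add: k_def)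
        then show ?thesis by (simp only: power_mult_distrib) simp
      qed
    qed
    finally show ?thesis .
  qed
qed

lemma asvol_ge_packing:
  fixes C :: "'a::euclidean_space set"
  assumes C: "hilbert_geometry C" and x: "x \<in> C"
    and X: "\<exists>n K. \<forall>m\<ge>n. \<exists>X. packing C x (real m + K) X \<and>
        card X = N * ((m - n + DIM('a)) choose DIM('a))"
  shows "ennreal (packing_const TYPE('a) * real N) \<le> asvol C x"
proof -
  let ?d = "DIM('a)"
  obtain n K where nK: "\<And>m. m \<ge> n \<Longrightarrow> \<exists>X. packing C x (real m + K) X \<and>
        card X = N * ((m - n + ?d) choose ?d)" using X by blast
  have pc: "0 \<le> packing_const TYPE('a)" by (simp add: packing_const_def)
  have "ennreal (packing_const TYPE('a) * real N)
      \<le> busemann_vol C (hilbert_ball C x r) / ennreal (r ^ ?d)"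
    if r: "4 + 2 * \<bar>K\<bar> + 2 * real n \<le> r" for r
  proof -
    have Kn: "K \<le> \<bar>K\<bar>" "- K \<le> \<bar>K\<bar>" "0 \<le> real n" by auto
    have r0: "0 < r" using r Kn by linarith
    define m where "m = nat \<lfloor>r - 1 - K\<rfloor>"
    have m: "real m \<le> r - 1 - K" "r - 2 - K \<le> real m"
      using r Kn by (simp_all add: m_def) linarith+
    have mn: "n \<le> m" using m r Kn by linarith
    obtain X where X: "packing C x (real m + K) X" "card X = N * ((m - n + ?d) choose ?d)"
      using nK[OF mn] by blast
    have "real (m - n + ?d) \<ge> real m - real n" using mn by simp
    then have "ennreal (packing_const TYPE('a) * real N * r ^ ?d)
        \<le> busemann_vol C (hilbert_ball C x r)"
      by (intro busemann_vol_ge_binomial_packing[OF C x X(1) _ _ X(2)]) (use m r r0 Kn in linarith)+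
    then have "ennreal (packing_const TYPE('a) * real N * r ^ ?d) / ennreal (r ^ ?d)
        \<le> busemann_vol C (hilbert_ball C x r) / ennreal (r ^ ?d)"
      by (rule divide_right_mono_ennreal)
    moreover have "ennreal (packing_const TYPE('a) * real N * r ^ ?d) / ennreal (r ^ ?d)
        = ennreal (packing_const TYPE('a) * real N)"
      using r0 pc by (subst divide_ennreal) auto
    ultimately show ?thesis by simp
  qed
  then have "\<forall>\<^sub>F r in at_top. ennreal (packing_const TYPE('a) * real N)
      \<le> busemann_vol C (hilbert_ball C x r) / ennreal (r ^ ?d)"
    unfolding eventually_at_top_linorder by blast
  then show ?thesis unfolding asvol_def by (rule Liminf_bounded)
qed

text \<open>
  The packing is constructed in the bounded set S and transported by the isometry; each of its
  points contributes the same amount of volume in every Hilbert geometry.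
\<close>

lemma asvol_ge_exposed_points:
  fixes S :: "'a::euclidean_space set"
  assumes L: "proj_admissible L S" and S: "hilbert_geometry S" "bounded S"
    and C: "hilbert_geometry (proj_map L ` S)" and x: "x \<in> proj_map L ` S"
    and E: "finite E" "\<And>v. v \<in> E \<Longrightarrow> {v} exposed_face_of closure S"
  shows "ennreal (packing_const TYPE('a) * real (card E)) \<le> asvol (proj_map L ` S) x"
proof (rule asvol_ge_packing[OF C x])
  have S': "open S" "convex S" and C': "open (proj_map L ` S)" "convex (proj_map L ` S)"
    using S C by (auto simp: hilbert_geometry_def)
  obtain y where y: "y \<in> S" "x = proj_map L y" using x by blast
  obtain n K where nK: "\<forall>m\<ge>n. \<exists>X. packing S y (real m + K) X \<and>
    card X = card E * ((m - n + DIM('a)) choose DIM('a))"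
    using packing_near_exposed_points[OF S y(1) E] by blast
  have "\<exists>X. packing (proj_map L ` S) x (real m + K) X \<and>
      card X = card E * ((m - n + DIM('a)) choose DIM('a))" if m: "n \<le> m" for m
  proof -
    obtain X where X: "packing S y (real m + K) X"
      "card X = card E * ((m - n + DIM('a)) choose DIM('a))" using nK m by blast
    show ?thesis
      using packing_proj_map[OF L S' C' y(1) X(1)] X(2)
      unfolding y(2) by (intro exI[of _ "proj_map L ` X"]) simp
  qed
  then show "\<exists>n K. \<forall>m\<ge>n. \<exists>X. packing (proj_map L ` S) x (real m + K) X \<and>
      card X = card E * ((m - n + DIM('a)) choose DIM('a))" by blast
qed

section \<open>Covering the balls of a polytope\<close>

text \<open>
  The largest of at most d + 1 weights with sum 1 is at least 1 / (d + 1). The d other vertices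
  are listed with repetitions, the padding having weight 0, so that the list always has length
  d. The representation is stated for the values of positive affine functions, since only these
  are used.
\<close>

lemma caratheodory_dominant_vertex:
  fixes V :: "'a::euclidean_space set"
  assumes V: "finite V" and p: "p \<in> convex hull V"
  shows "\<exists>v ws l \<mu>. v \<in> V \<and> set ws \<subseteq> V \<and> length ws = DIM('a) \<and> 1 / (real DIM('a) + 1) \<le> l \<and> l \<le> 1 \<and>
    (\<forall>i<DIM('a). 0 \<le> \<mu> i \<and> \<mu> i \<le> 1) \<and>
    (\<forall>C. \<forall>f\<in>pos_aff C. f p = l * f v + (\<Sum>i<DIM('a). \<mu> i * f (ws ! i)))"
proof -
  let ?d = "DIM('a)"
  obtain T where T: "finite T" "T \<subseteq> V" "card T \<le> ?d + 1" "p \<in> convex hull T"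
    using p unfolding caratheodory[of V] by blast
  obtain u where u: "\<forall>t\<in>T. 0 \<le> u t" "sum u T = 1" "(\<Sum>t\<in>T. u t *\<^sub>R t) = p"
    using T(4) unfolding convex_hull_finite[OF T(1)] by blast
  have u1: "u t \<le> 1" if "t \<in> T" for t
    using member_le_sum[of t T u] u(1,2) T(1) that by simp
  have "T \<noteq> {}" using u(2) by auto
  then have "Max (u ` T) \<in> u ` T" using T(1) by (intro Max_in) auto
  then obtain v where v: "v \<in> T" and umax: "Max (u ` T) = u v" by blast
  have vmax: "u t \<le> u v" if "t \<in> T" for t
    using Max_ge[of "u ` T" "u t"] T(1) that umax by simp
  have "1 \<le> real (card T) * u v"
    using sum_bounded_above[of T u "u v"] vmax u(2) by simp
  also have "\<dots> \<le> (real ?d + 1) * u v"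
    using T(3) u(1) v by (intro mult_right_mono) auto
  finally have uv: "1 / (real ?d + 1) \<le> u v" by (simp add: field_simps)
  obtain ts where ts: "set ts = T - {v}" "distinct ts"
    using finite_distinct_list[of "T - {v}"] T(1) by auto
  have len: "length ts \<le> ?d"
    using distinct_card[OF ts(2)] ts(1) T(1,3) v by simp
  define ws where "ws = ts @ replicate (?d - length ts) v"
  define \<mu> where "\<mu> i = (if i < length ts then u (ts ! i) else 0)" for i
  have repr: "f p = u v * f v + (\<Sum>i<?d. \<mu> i * f (ws ! i))" if f: "f \<in> pos_aff C" for f and C :: "'a set"
  proof -
    obtain a w where aw: "\<forall>y. f y = a + w \<bullet> y" using f by (auto simp: pos_aff_def)
    have "f p = a * sum u T + w \<bullet> (\<Sum>t\<in>T. u t *\<^sub>R t)" using aw u by simp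
    also have "\<dots> = (\<Sum>t\<in>T. u t * f t)"
      using aw by (simp add: inner_sum_right sum_distrib_left sum.distrib[symmetric] algebra_simps)
    also have "\<dots> = u v * f v + (\<Sum>t\<in>set ts. u t * f t)"
      unfolding ts(1) using T(1) v by (rule sum.remove)
    also have "(\<Sum>t\<in>set ts. u t * f t) = (\<Sum>i<length ts. u (ts ! i) * f (ts ! i))"
      by (rule sum.reindex_bij_betw[symmetric]) (use bij_betw_nth[OF ts(2)] in blast)
    also have "\<dots> = (\<Sum>i<?d. \<mu> i * f (ws ! i))"
      by (rule sum.mono_neutral_cong_left) (use len in \<open>auto simp: \<mu>_def ws_def nth_append\<close>)
    finally show ?thesis .
  qed
  show ?thesis
  proof (intro exI conjI)
    show "v \<in> V" using v T by blast
    show "set ws \<subseteq> V" using ts v T by (auto simp: ws_def)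
    show "length ws = ?d" using len by (simp add: ws_def)
    show "1 / (real ?d + 1) \<le> u v" by (rule uv)
    show "u v \<le> 1" by (rule u1[OF v])
    show "\<forall>i<?d. 0 \<le> \<mu> i \<and> \<mu> i \<le> 1"
    proof (intro allI impI)
      fix i
      show "0 \<le> \<mu> i \<and> \<mu> i \<le> 1"
      proof (cases "i < length ts")
        case True
        then have "ts ! i \<in> T" using ts(1) nth_mem by blast
        then show ?thesis using True u(1) u1 by (simp add: \<mu>_def)
      qed (simp add: \<mu>_def)
    qed
    show "\<forall>C. \<forall>f\<in>pos_aff C. f p = u v * f v + (\<Sum>i<?d. \<mu> i * f (ws ! i))"
      using repr by blast
  qed
qed

text \<open>
  The weights of a convex combination are recorded on a logarithmic scale that is cut off at e:
  weights below e need not be distinguished.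
\<close>

definition log_level :: "real \<Rightarrow> real \<Rightarrow> nat" where
  "log_level e t = nat \<lfloor>ln (1 + t / e)\<rfloor>"

text \<open>
  The constant 3 bounds exp 1.
\<close>

lemma log_level_eqD:
  assumes e: "0 < e" and ab: "0 \<le> a" "0 \<le> b" and eq: "log_level e a = log_level e b"
  shows "a \<le> 3 * (b + e)"
proof -
  have nn: "0 \<le> ln (1 + a / e)" "0 \<le> ln (1 + b / e)" using e ab by auto
  then have "0 \<le> \<lfloor>ln (1 + a / e)\<rfloor>" "0 \<le> \<lfloor>ln (1 + b / e)\<rfloor>" by (simp_all only: zero_le_floor)
  then have "\<lfloor>ln (1 + a / e)\<rfloor> = \<lfloor>ln (1 + b / e)\<rfloor>"
    using eq unfolding log_level_def by (simp only: eq_nat_nat_iff)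
  then have "ln (1 + a / e) \<le> 1 + ln (1 + b / e)" by linarith
  then have "exp (ln (1 + a / e)) \<le> exp (1 + ln (1 + b / e))" by simp
  then have "1 + a / e \<le> exp 1 * (1 + b / e)"
    using e ab by (simp add: exp_add add_pos_nonneg)
  also have "\<dots> \<le> 3 * (1 + b / e)"
    using exp_le e ab by (intro mult_right_mono) auto
  finally have "e * (1 + a / e) \<le> e * (3 * (1 + b / e))" using e by (intro mult_left_mono) auto
  then show ?thesis using e by (simp add: algebra_simps)
qed

lemma log_level_le:
  assumes e: "0 < e" and t: "0 \<le> t" "t \<le> 1"
  shows "log_level e t \<le> log_level e 1"
proof -
  have "0 < 1 + t / e" using e t by (simp add: add_pos_nonneg)
  moreover have "1 + t / e \<le> 1 + 1 / e" using e t by (simp add: divide_right_mono)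
  ultimately have "ln (1 + t / e) \<le> ln (1 + 1 / e)" by (subst ln_le_cancel_iff) auto
  then show ?thesis unfolding log_level_def by (intro nat_mono floor_mono)
qed

text \<open>
  The pieces of the cover consist of the points with the same dominant vertex, the same list of
  d other vertices and the same levels of their weights. There are only d levels to choose,
  since the weight of the dominant vertex is known up to the factor d + 1. This gives the
  exponent d rather than d + 1. The cutoff e = exp (-2 r) / M is harmless: a positive affine
  function f is at least exp (-2 r) f x on the ball, while the error caused by the cutoff is at
  most e times a sum of values of f at vertices, which are at most M f x.
\<close>

lemma polytope_ball_cover:
  fixes P :: "'a::euclidean_space set"
  assumes V: "finite V" "convex hull V = P" and x: "x \<in> interior P" and M: "M \<ge> 1"
    and MV: "\<And>g v. g \<in> pos_aff (interior P) \<Longrightarrow> v \<in> V \<Longrightarrow> g v \<le> M * g x"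
    and V0: "\<And>g v. g \<in> pos_aff (interior P) \<Longrightarrow> v \<in> V \<Longrightarrow> 0 \<le> g v"
  shows "\<exists>(I :: ('a \<times> ('a \<times> nat) list) set) K. finite I \<and>
    card I = card V * (card V * Suc (log_level (exp (- 2 * r) / M) 1)) ^ DIM('a) \<and>
    hilbert_ball (interior P) x r \<subseteq> (\<Union>i\<in>I. K i) \<and>
    (\<forall>i\<in>I. K i \<subseteq> interior P \<and> (\<forall>p\<in>K i. \<forall>q\<in>K i. \<forall>f\<in>pos_aff (interior P).
       f p \<le> 3 * (real DIM('a) + 1)\<^sup>2 * f q))"
proof -
  let ?d = "DIM('a)" and ?S = "interior P"
  define e where "e = exp (- 2 * r) / M"
  have e: "0 < e" using M by (simp add: e_def)
  have P: "open ?S" "convex ?S"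
    using V(2) by (auto intro!: convex_interior)
  define I where "I = V \<times> {xs. set xs \<subseteq> V \<times> {..log_level e 1} \<and> length xs = ?d}"
  define rep where "rep p v xs l \<mu> \<longleftrightarrow> 1 / (real ?d + 1) \<le> l \<and> l \<le> 1 \<and>
      (\<forall>i<?d. 0 \<le> \<mu> i \<and> log_level e (\<mu> i) = snd (xs ! i)) \<and>
      (\<forall>f\<in>pos_aff ?S. f p = l * f v + (\<Sum>i<?d. \<mu> i * f (fst (xs ! i))))"
    for p v l and xs :: "('a \<times> nat) list" and \<mu> :: "nat \<Rightarrow> real"
  define K where "K i = {p \<in> hilbert_ball ?S x r. \<exists>l \<mu>. rep p (fst i) (snd i) l \<mu>}" for i
  have fin: "finite I" using V(1) by (auto simp: I_def intro!: finite_lists_length_eq)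
  have card: "card I = card V * (card V * Suc (log_level e 1)) ^ ?d"
    using V(1) by (simp add: I_def card_cartesian_product card_lists_length_eq)
  have cover: "hilbert_ball ?S x r \<subseteq> (\<Union>i\<in>I. K i)"
  proof
    fix p assume p: "p \<in> hilbert_ball ?S x r"
    then have "p \<in> convex hull V" using V(2) interior_subset by (auto simp: hilbert_ball_def)
    from caratheodory_dominant_vertex[OF V(1) this]
    obtain v ws l \<mu> where w: "v \<in> V" "set ws \<subseteq> V" "length ws = ?d" "1 / (real ?d + 1) \<le> l" "l \<le> 1"
      "\<forall>i<?d. 0 \<le> \<mu> i \<and> \<mu> i \<le> 1"
      "\<forall>C. \<forall>f\<in>pos_aff C. f p = l * f v + (\<Sum>i<?d. \<mu> i * f (ws ! i))"
      by (elim exE conjE)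
    define xs where "xs = map (\<lambda>i. (ws ! i, log_level e (\<mu> i))) [0..<?d]"
    have xs: "xs ! i = (ws ! i, log_level e (\<mu> i))" if "i < ?d" for i using that by (simp add: xs_def)
    have "set xs \<subseteq> V \<times> {..log_level e 1}"
      using w(2,3,6) log_level_le[OF e] by (auto simp: xs_def)
    moreover have "length xs = ?d" by (simp add: xs_def)
    ultimately have "(v, xs) \<in> I" using w(1) by (simp add: I_def)
    moreover have "rep p v xs l \<mu>"
      unfolding rep_def using w(4-7) xs by simp
    then have "p \<in> K (v, xs)" using p by (auto simp: K_def)
    ultimately show "p \<in> (\<Union>i\<in>I. K i)" by blast
  qed
  have comp: "f p \<le> 3 * (real ?d + 1)\<^sup>2 * f q"
    if i: "i \<in> I" and pq: "p \<in> K i" "q \<in> K i" and f: "f \<in> pos_aff ?S" for i p q f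
  proof -
    obtain v xs where vx: "i = (v, xs)" by (cases i)
    have vV: "v \<in> V" and xs: "set xs \<subseteq> V \<times> {..log_level e 1}" "length xs = ?d"
      using i by (auto simp: vx I_def)
    have xsV: "fst (xs ! j) \<in> V" if "j < ?d" for j
    proof -
      have "xs ! j \<in> set xs" using that xs(2) by (intro nth_mem) simp
      then have "xs ! j \<in> V \<times> {..log_level e 1}" using xs(1) by (rule subsetD[rotated])
      then show ?thesis by (simp add: mem_Times_iff)
    qed
    obtain l \<mu> where lp: "rep p v xs l \<mu>" using pq(1) by (auto simp: K_def vx)
    obtain l' \<mu>' where lq: "rep q v xs l' \<mu>'" using pq(2) by (auto simp: K_def vx)
    have q: "q \<in> ?S" "hilbert_dist ?S x q < r" using pq(2) by (auto simp: K_def hilbert_ball_def)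
    let ?D = "real ?d + 1"
    define W where "W = (\<Sum>j<?d. f (fst (xs ! j)))"
    have fw: "0 \<le> f (fst (xs ! j))" if "j < ?d" for j using V0[OF f xsV[OF that]] .
    have fq: "f q = l' * f v + (\<Sum>j<?d. \<mu>' j * f (fst (xs ! j)))" using lq f by (simp add: rep_def)
    have "l \<le> ?D * l'" using lp lq by (simp add: rep_def field_simps)
    then have 1: "l * f v \<le> 3 * ?D * (l' * f v)"
    proof -
      have "0 \<le> l'" using lq by (auto simp: rep_def intro: order_trans[rotated])
      then have "1 * (?D * l') \<le> 3 * (?D * l')" by (intro mult_right_mono) auto
      then have "l \<le> 3 * ?D * l'" using \<open>l \<le> ?D * l'\<close> by linarith
      then show ?thesis using V0[OF f vV] by (simp add: mult_right_mono mult.assoc[symmetric])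
    qed
    have 2: "\<mu> j * f (fst (xs ! j)) \<le> 3 * ?D * ((\<mu>' j + e) * f (fst (xs ! j)))" if j: "j < ?d" for j
    proof -
      have "\<mu> j \<le> 3 * (\<mu>' j + e)"
        using lp lq j by (intro log_level_eqD[OF e]) (auto simp: rep_def)
      also have "\<dots> \<le> 3 * ?D * (\<mu>' j + e)"
        using lq j e by (intro mult_right_mono) (auto simp: rep_def)
      finally show ?thesis using fw[OF j] by (simp add: mult_right_mono mult.assoc[symmetric])
    qed
    have "f p = l * f v + (\<Sum>j<?d. \<mu> j * f (fst (xs ! j)))" using lp f by (simp add: rep_def)
    also have "\<dots> \<le> 3 * ?D * (l' * f v) + (\<Sum>j<?d. 3 * ?D * ((\<mu>' j + e) * f (fst (xs ! j))))"
      using 1 2 by (intro add_mono sum_mono) auto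
    also have "\<dots> = 3 * ?D * (f q + e * W)"
      unfolding fq W_def by (simp add: sum_distrib_left[symmetric] distrib_right sum.distrib distrib_left)
    also have "\<dots> \<le> 3 * ?D * (f q + real ?d * f q)"
    proof (intro mult_left_mono add_left_mono)
      \<comment> \<open>The cutoff e was chosen to cancel M and the factor exp (2 r) by which f may drop on the ball.\<close>
      have "W \<le> (\<Sum>j<?d. M * f x)" unfolding W_def using MV[OF f xsV] by (intro sum_mono) auto
      then have "e * W \<le> e * (real ?d * (M * f x))" using e by simp
      also have "\<dots> = real ?d * (exp (- 2 * r) * f x)" using M by (simp add: e_def)
      also have "\<dots> \<le> real ?d * f q"
      proof (intro mult_left_mono)
        have "f x \<le> exp (2 * hilbert_dist ?S x q) * f q"
          by (rule pos_aff_le_exp_dist[OF P x q(1) f])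
        also have "\<dots> \<le> exp (2 * r) * f q"
          using q pos_affD[OF f q(1)] by (intro mult_right_mono) auto
        finally have "exp (- 2 * r) * f x \<le> exp (- 2 * r) * (exp (2 * r) * f q)" by simp
        then show "exp (- 2 * r) * f x \<le> f q" by (simp add: mult.assoc[symmetric] exp_add[symmetric])
      qed simp
      finally show "e * W \<le> real ?d * f q" .
    qed simp
    also have "\<dots> = 3 * ?D\<^sup>2 * f q" by (simp add: power2_eq_square algebra_simps)
    finally show ?thesis .
  qed
  show ?thesis
  proof (intro exI conjI ballI)
    show "finite I" by (rule fin)
    show "card I = card V * (card V * Suc (log_level (exp (- 2 * r) / M) 1)) ^ ?d"
      using card by (simp add: e_def)
    show "hilbert_ball ?S x r \<subseteq> (\<Union>i\<in>I. K i)" by (rule cover)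
    show "K i \<subseteq> ?S" for i by (auto simp: K_def hilbert_ball_def)
  qed (rule comp)
qed

text \<open>
  One factor A compares the pulled back functions, the other one the denominators.
\<close>

lemma pos_aff_proj_comparison:
  fixes L :: "'a::euclidean_space \<times> real \<Rightarrow> 'a \<times> real"
  assumes L: "proj_admissible L S" and pq: "p \<in> S" "q \<in> S" and A: "0 \<le> A"
    and le: "\<And>h. h \<in> pos_aff S \<Longrightarrow> h p \<le> A * h q" "\<And>h. h \<in> pos_aff S \<Longrightarrow> h q \<le> A * h p"
    and f: "f \<in> pos_aff (proj_map L ` S)"
  shows "f (proj_map L p) \<le> A\<^sup>2 * f (proj_map L q)"
proof -
  let ?D = "\<lambda>y. snd (L (y, 1))"
  obtain h where h: "h \<in> pos_aff S" "\<forall>y\<in>S. h y = ?D y * f (proj_map L y)"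
    using pos_aff_pullback[OF L f] by blast
  obtain k where k: "k \<in> pos_aff S" "\<forall>y\<in>S. k y = ?D y * 1"
    using pos_aff_pullback[OF L one_in_pos_aff] by blast
  have D: "0 < ?D p" "0 < ?D q" using L pq by (auto simp: proj_admissible_def)
  have fq: "0 < f (proj_map L q)" using pos_affD[OF f] pq by blast
  have "?D p * f (proj_map L p) \<le> A * (?D q * f (proj_map L q))"
    using le(1)[OF h(1)] h(2) pq by simp
  also have "\<dots> \<le> A * ((A * ?D p) * f (proj_map L q))"
    using le(2)[OF k(1)] k(2) pq fq A by (intro mult_left_mono mult_right_mono) auto
  also have "\<dots> = ?D p * (A\<^sup>2 * f (proj_map L q))"
    by (simp add: power2_eq_square)
  finally show ?thesis using D by simp
qed

text \<open>
  It depends only on the dimension and on the number k of vertices. This uniformity is what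
  bounds the asymptotic volume of all simplices and all base points at once.
\<close>

definition cover_const :: "'a::euclidean_space itself \<Rightarrow> nat \<Rightarrow> real" where
  "cover_const T k = real k * (3 * real k) ^ DIM('a) *
     (unit_ball_vol (real DIM('a)) * ((3 * (real DIM('a) + 1)\<^sup>2)\<^sup>2) ^ (2 * DIM('a)))"

lemma polytope_vertices:
  assumes "polytope P"
  shows "finite (vertices P)" "convex hull (vertices P) = P"
  using finite_polyhedron_extreme_points[OF polytope_imp_polyhedron[OF assms]]
    Krein_Milman_Minkowski[OF polytope_imp_compact[OF assms] polytope_imp_convex[OF assms]]
  by (simp_all add: vertices_def)

lemma polytope_interior:
  assumes P: "polytope P" and ne: "interior P \<noteq> {}"
  shows "closure (interior P) = P" "hilbert_geometry (interior P)" "bounded (interior P)"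
proof -
  note compact = polytope_imp_compact[OF P] and convex = polytope_imp_convex[OF P]
  show "closure (interior P) = P"
    using convex_closure_interior[OF convex ne] compact_imp_closed[OF compact] by simp
  show bdd: "bounded (interior P)"
    using compact_imp_bounded[OF compact] interior_subset by (rule bounded_subset)
  show "hilbert_geometry (interior P)"
    using bounded_hilbert_geometry[OF ne _ convex_interior[OF convex] bdd] by simp
qed

text \<open>
  The number of levels is 2 r up to an additive constant that depends on M. So the position of
  x, which enters through M, disappears in the limit.
\<close>

lemma log_level_exp_le:
  assumes M: "M \<ge> 1" and r: "ln (2 * M) + 1 \<le> r" "0 \<le> r"
  shows "real (Suc (log_level (exp (- 2 * r) / M) 1)) \<le> 3 * r"
proof -
  have "1 / (exp (- 2 * r) / M) = M * exp (2 * r)" by (simp add: exp_minus field_simps)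
  moreover have "1 \<le> M * exp (2 * r)"
    using M r mult_mono[of 1 M 1 "exp (2 * r)"] by simp
  ultimately have "1 + 1 / (exp (- 2 * r) / M) \<le> 2 * M * exp (2 * r)" by simp
  moreover have "0 < 1 + 1 / (exp (- 2 * r) / M)" using M by (simp add: add_pos_nonneg)
  ultimately have "ln (1 + 1 / (exp (- 2 * r) / M)) \<le> ln (2 * M * exp (2 * r))"
    using M by (subst ln_le_cancel_iff) auto
  also have "\<dots> = ln (2 * M) + 2 * r" using M by (simp add: ln_mult_pos)
  finally have le: "ln (1 + 1 / (exp (- 2 * r) / M)) \<le> ln (2 * M) + 2 * r" .
  have "0 \<le> ln (1 + 1 / (exp (- 2 * r) / M))" using M by simp
  then have "real (log_level (exp (- 2 * r) / M) 1) \<le> ln (1 + 1 / (exp (- 2 * r) / M))"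
    unfolding log_level_def by (simp only: of_nat_nat zero_le_floor of_int_floor_le)
  then show ?thesis using le r by simp
qed

text \<open>
  The cover of a ball in the interior of P is transported by the isometry, and
  \<open>busemann_vol_le_cover\<close> is applied to the image.
\<close>

lemma asvol_polytopal_le:
  fixes P :: "'a::euclidean_space set"
  assumes P: "polytope P" and L: "proj_admissible L (interior P)"
    and C: "hilbert_geometry (proj_map L ` interior P)" and x: "x \<in> proj_map L ` interior P"
  shows "asvol (proj_map L ` interior P) x \<le> ennreal (cover_const TYPE('a) (card (vertices P)))"
proof -
  let ?S = "interior P" and ?C = "proj_map L ` interior P" and ?d = "DIM('a)" and ?k = "card (vertices P)"
  obtain y where y: "y \<in> ?S" "x = proj_map L y" using x by blast
  have ne: "?S \<noteq> {}" using y by blast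
  note S = polytope_interior[OF P ne] and V = polytope_vertices[OF P]
  have S': "open ?S" "convex ?S" and C': "open ?C" "convex ?C"
    using S(2) C by (auto simp: hilbert_geometry_def)
  obtain M where M1: "M \<ge> 1" and M: "\<forall>g\<in>pos_aff ?S. \<forall>z\<in>closure ?S. g z \<le> M * g y"
    using pos_aff_interior_domination[OF S'(1) S(3) y(1)] by (elim exE conjE)
  have VP: "vertices P \<subseteq> closure ?S"
    unfolding S(1) by (auto simp: vertices_def extreme_point_of_def)
  let ?A = "3 * (real ?d + 1)\<^sup>2" and ?w = "unit_ball_vol (real ?d)"
  have A1: "1 \<le> ?A"
  proof -
    have "1 \<le> (real ?d + 1)\<^sup>2" by (intro one_le_power) simp
    then show ?thesis by linarith
  qed
  have "busemann_vol ?C (hilbert_ball ?C x r) / ennreal (r ^ ?d) \<le> ennreal (cover_const TYPE('a) ?k)"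
    if r: "max 1 (ln (2 * M) + 1) \<le> r" for r
  proof -
    have r0: "0 < r" using r by simp
    let ?N = "Suc (log_level (exp (- 2 * r) / M) 1)"
    have "\<exists>(I :: ('a \<times> ('a \<times> nat) list) set) K. finite I \<and>
      card I = ?k * (?k * ?N) ^ ?d \<and> hilbert_ball ?S y r \<subseteq> (\<Union>i\<in>I. K i) \<and>
      (\<forall>i\<in>I. K i \<subseteq> ?S \<and> (\<forall>p\<in>K i. \<forall>q\<in>K i. \<forall>f\<in>pos_aff ?S. f p \<le> ?A * f q))"
      by (rule polytope_ball_cover[OF V y(1) M1])
        (use M VP pos_aff_closure_nonneg in blast)+
    then obtain I :: "('a \<times> ('a \<times> nat) list) set" and K where I: "finite I"
      "card I = ?k * (?k * ?N) ^ ?d" "hilbert_ball ?S y r \<subseteq> (\<Union>i\<in>I. K i)"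
      and K: "\<forall>i\<in>I. K i \<subseteq> ?S \<and> (\<forall>p\<in>K i. \<forall>q\<in>K i. \<forall>f\<in>pos_aff ?S. f p \<le> ?A * f q)"
      by (elim exE conjE)
    have cover: "hilbert_ball ?C x r \<subseteq> (\<Union>i\<in>I. proj_map L ` K i)"
    proof
      fix z assume z: "z \<in> hilbert_ball ?C x r"
      then obtain p where p: "p \<in> ?S" "z = proj_map L p" by (auto simp: hilbert_ball_def)
      have "hilbert_dist ?S y p < r"
        using z hilbert_dist_proj_map[OF L S' C' y(1) p(1)] by (simp add: hilbert_ball_def y(2) p(2))
      then have "p \<in> hilbert_ball ?S y r" using p by (simp add: hilbert_ball_def)
      then show "z \<in> (\<Union>i\<in>I. proj_map L ` K i)" using I(3) p(2) by blast
    qed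
    have "busemann_vol ?C (hilbert_ball ?C x r)
        \<le> ennreal (real (card I) * (?w * (?A\<^sup>2) ^ (2 * ?d)))"
    proof (rule busemann_vol_le_cover[OF C I(1) cover])
      show "proj_map L ` K i \<subseteq> ?C" if "i \<in> I" for i using K that by blast
      show "1 \<le> ?A\<^sup>2" using A1 by (rule one_le_power)
      show "f p \<le> ?A\<^sup>2 * f q"
        if i: "i \<in> I" and pq: "p \<in> proj_map L ` K i" "q \<in> proj_map L ` K i" and f: "f \<in> pos_aff ?C"
        for i p q f
      proof -
        obtain p' q' where pq': "p' \<in> K i" "p = proj_map L p'" "q' \<in> K i" "q = proj_map L q'"
          using pq by blast
        show ?thesis
          unfolding pq'(2,4)
          by (rule pos_aff_proj_comparison[OF L _ _ _ _ _ f]) (use K i pq' in auto)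
      qed
    qed
    also have "\<dots> \<le> ennreal (cover_const TYPE('a) ?k * r ^ ?d)"
    proof (rule ennreal_leI)
      have "real ?N \<le> 3 * r" using r by (intro log_level_exp_le[OF M1]) auto
      then have "(real ?k * real ?N) ^ ?d \<le> (real ?k * (3 * r)) ^ ?d"
        by (intro power_mono mult_left_mono) auto
      then have "real ?k * (real ?k * real ?N) ^ ?d \<le> real ?k * (real ?k * (3 * r)) ^ ?d"
        by (intro mult_left_mono) auto
      moreover have "real (card I) = real ?k * (real ?k * real ?N) ^ ?d"
        unfolding I(2) by (simp only: of_nat_mult of_nat_power)
      moreover have "real ?k * (real ?k * (3 * r)) ^ ?d = real ?k * (3 * real ?k) ^ ?d * r ^ ?d"
        by (simp add: power_mult_distrib)
      ultimately have "real (card I) \<le> real ?k * (3 * real ?k) ^ ?d * r ^ ?d"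
        by linarith
      then have "real (card I) * (?w * (?A\<^sup>2) ^ (2 * ?d))
          \<le> real ?k * (3 * real ?k) ^ ?d * r ^ ?d * (?w * (?A\<^sup>2) ^ (2 * ?d))"
        by (intro mult_right_mono) auto
      also have "\<dots> = cover_const TYPE('a) ?k * r ^ ?d"
        unfolding cover_const_def by (simp only: ac_simps)
      finally show "real (card I) * (?w * (?A\<^sup>2) ^ (2 * ?d)) \<le> cover_const TYPE('a) ?k * r ^ ?d" .
    qed
    finally have "busemann_vol ?C (hilbert_ball ?C x r) / ennreal (r ^ ?d)
        \<le> ennreal (cover_const TYPE('a) ?k * r ^ ?d) / ennreal (r ^ ?d)"
      by (rule divide_right_mono_ennreal)
    also have "\<dots> = ennreal (cover_const TYPE('a) ?k)"
      using r0 by (subst divide_ennreal) (auto simp: cover_const_def)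
    finally show ?thesis .
  qed
  then have "\<forall>\<^sub>F r in at_top. busemann_vol ?C (hilbert_ball ?C x r) / ennreal (r ^ ?d)
      \<le> ennreal (cover_const TYPE('a) ?k)"
    unfolding eventually_at_top_linorder by blast
  then have "asvol ?C x \<le> Liminf at_top (\<lambda>r::real. ennreal (cover_const TYPE('a) ?k))"
    unfolding asvol_def by (rule Liminf_mono)
  then show ?thesis by (simp add: Liminf_const)
qed

section \<open>Finite asymptotic volume and polytopes\<close>

lemma polytopal_alt:
  "polytopal C P \<longleftrightarrow> polytope P \<and> (\<exists>L. proj_admissible L (interior P) \<and> C = proj_map L ` interior P)"
  by (auto simp: polytopal_def proj_admissible_def)

text \<open>
  For the lower bound, the vertices of a polytope are exposed points.
\<close>

lemma asvol_polytopal_bounds: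
  fixes C P :: "'a::euclidean_space set"
  assumes C: "hilbert_geometry C" and P: "polytopal C P" and x: "x \<in> C"
  shows "ennreal (packing_const TYPE('a) * real (card (vertices P))) \<le> asvol C x"
    and "asvol C x \<le> ennreal (cover_const TYPE('a) (card (vertices P)))"
proof -
  obtain L where poly: "polytope P" and L: "proj_admissible L (interior P)" and CL: "C = proj_map L ` interior P"
    using P unfolding polytopal_alt by blast
  show "asvol C x \<le> ennreal (cover_const TYPE('a) (card (vertices P)))"
    using asvol_polytopal_le[OF poly L] C x unfolding CL by blast
  have ne: "interior P \<noteq> {}" using x CL by blast
  note S = polytope_interior[OF poly ne]
  show "ennreal (packing_const TYPE('a) * real (card (vertices P))) \<le> asvol C x"
    unfolding CL
  proof (rule asvol_ge_exposed_points[OF L S(2,3)])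
    show "hilbert_geometry (proj_map L ` interior P)" "x \<in> proj_map L ` interior P"
      using C x CL by auto
    show "finite (vertices P)" by (rule polytope_vertices[OF poly])
    show "{v} exposed_face_of closure (interior P)" if "v \<in> vertices P" for v
      unfolding S(1) exposed_face_of_polyhedron[OF polytope_imp_polyhedron[OF poly]] face_of_singleton
      using that by (simp add: vertices_def)
  qed
qed

lemma packing_const_pos: "0 < packing_const TYPE('a::euclidean_space)"
  by (simp add: packing_const_def)

text \<open>
  Make C bounded by a projective transformation. A finite asymptotic volume bounds the number of
  exposed points of the closure, which is therefore their convex hull.
\<close>

lemma finite_asvol_imp_polytopal:
  fixes C :: "'a::euclidean_space set"
  assumes C: "hilbert_geometry C" and x: "x \<in> C" and fin: "asvol C x < \<infinity>"
  shows "\<exists>P. polytopal C P"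
proof -
  have C': "C \<noteq> {}" "open C" "convex C" using C by (auto simp: hilbert_geometry_def)
  obtain L where L: "proj_admissible L C" and bdd: "bounded (proj_map L ` C)"
    using projectively_bounded[OF C] by blast
  let ?S = "proj_map L ` C"
  note inv = proj_map_inverse[OF L]
  have S': "open ?S" "convex ?S" "?S \<noteq> {}"
    using open_proj_map[OF L C'(2)] convex_proj_map[OF L C'(3)] C' by auto
  have S: "hilbert_geometry ?S" by (rule bounded_hilbert_geometry[OF S'(3,1,2) bdd])
  let ?E = "{v. {v} exposed_face_of closure ?S}"
  have lower: "ennreal (packing_const TYPE('a) * real (card E)) \<le> asvol C x" if "finite E" "E \<subseteq> ?E" for E
  proof -
    have "ennreal (packing_const TYPE('a) * real (card E)) \<le> asvol (proj_map (inv L) ` ?S) x"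
      by (rule asvol_ge_exposed_points[OF inv(1) S bdd]) (use C x that in \<open>auto simp: inv(3)\<close>)
    then show ?thesis by (simp only: inv(3))
  qed
  have finE: "finite ?E"
  proof (rule ccontr)
    assume inf: "infinite ?E"
    obtain a where a: "asvol C x = ennreal a" "0 \<le> a"
      using fin by (cases "asvol C x") auto
    obtain N :: nat where N: "a / packing_const TYPE('a) < real N" using reals_Archimedean2 by blast
    obtain E where E: "E \<subseteq> ?E" "finite E" "card E = N" using infinite_arbitrarily_large[OF inf] by blast
    have "packing_const TYPE('a) * real N \<le> a"
      using lower[OF E(2,1)] a packing_const_pos[where 'a = 'a] E(3) by simp
    then show False using N packing_const_pos[where 'a = 'a] by (simp add: field_simps)
  qed
  have "compact (closure ?S)" using bdd by simp
  then have "closure ?S = convex hull ?E"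
    using hull_of_finitely_many_exposed_points[OF _ convex_closure[OF S'(2)] finE] by blast
  then have "polytope (closure ?S)" using finE unfolding polytope_def by blast
  moreover have "interior (closure ?S) = ?S"
    using convex_interior_closure[OF S'(2)] S'(1) by (simp add: interior_open)
  ultimately have "polytopal C (closure ?S)"
    unfolding polytopal_alt using inv(1,3) by metis
  then show ?thesis by blast
qed

text \<open>
  S is a copy of the face poset of P inside the power set of a fixed finite set, ordered by
  inclusion. There are finitely many such S, and S determines the combinatorial type.
\<close>

section \<open>Combinatorial types of polytopes\<close>

definition face_code :: "nat \<Rightarrow> 'a::euclidean_space set \<Rightarrow> nat set set \<Rightarrow> bool" where
  "face_code K P S \<longleftrightarrow> S \<subseteq> Pow {..<K} \<and>
     (\<exists>\<tau>. bij_betw \<tau> {F. F face_of P} S \<and>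
       (\<forall>F F'. F face_of P \<longrightarrow> F' face_of P \<longrightarrow> (F \<subseteq> F' \<longleftrightarrow> \<tau> F \<subseteq> \<tau> F')))"

lemma face_code_combinatorially_equivalent:
  assumes "face_code K P S" "face_code K Q S"
  shows "combinatorially_equivalent P Q"
proof -
  obtain \<tau> where \<tau>: "bij_betw \<tau> {F. F face_of P} S"
    "\<forall>F F'. F face_of P \<longrightarrow> F' face_of P \<longrightarrow> (F \<subseteq> F' \<longleftrightarrow> \<tau> F \<subseteq> \<tau> F')"
    using assms(1) by (auto simp: face_code_def)
  obtain \<sigma> where \<sigma>: "bij_betw \<sigma> {F. F face_of Q} S"
    "\<forall>F F'. F face_of Q \<longrightarrow> F' face_of Q \<longrightarrow> (F \<subseteq> F' \<longleftrightarrow> \<sigma> F \<subseteq> \<sigma> F')"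
    using assms(2) by (auto simp: face_code_def)
  let ?\<phi> = "the_inv_into {F. F face_of Q} \<sigma> \<circ> \<tau>"
  have inv: "the_inv_into {F. F face_of Q} \<sigma> s face_of Q" "\<sigma> (the_inv_into {F. F face_of Q} \<sigma> s) = s"
    if "s \<in> S" for s
  proof -
    have "the_inv_into {F. F face_of Q} \<sigma> s \<in> {F. F face_of Q}"
      using bij_betw_the_inv_into[OF \<sigma>(1)] that by (rule bij_betwE[rule_format])
    then show "the_inv_into {F. F face_of Q} \<sigma> s face_of Q" by simp
    show "\<sigma> (the_inv_into {F. F face_of Q} \<sigma> s) = s"
      using \<sigma>(1) that by (intro f_the_inv_into_f) (auto simp: bij_betw_def)
  qed
  have "bij_betw ?\<phi> {F. F face_of P} {G. G face_of Q}"
    by (rule bij_betw_trans[OF \<tau>(1) bij_betw_the_inv_into[OF \<sigma>(1)]])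
  moreover have "F \<subseteq> F' \<longleftrightarrow> ?\<phi> F \<subseteq> ?\<phi> F'" if F: "F face_of P" "F' face_of P" for F F'
  proof -
    have s: "\<tau> F \<in> S" "\<tau> F' \<in> S" using \<tau>(1) F by (auto simp: bij_betw_def)
    then show ?thesis using \<tau>(2) \<sigma>(2) F inv by simp
  qed
  ultimately show ?thesis unfolding combinatorially_equivalent_def by blast
qed

text \<open>
  Number the vertices. A face is the convex hull of the vertices that it contains, so inclusion
  of faces is inclusion of their sets of vertices.
\<close>

lemma polytope_face_code:
  assumes P: "polytope P" and K: "card (vertices P) \<le> K"
  shows "\<exists>S. face_code K P S"
proof -
  note V = polytope_vertices[OF P]
  obtain h where h: "inj_on h (vertices P)" "h ` vertices P \<subseteq> {..<K}"
    using card_le_inj[OF V(1), of "{..<K}"] K by auto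
  define \<tau> where "\<tau> F = h ` (vertices P \<inter> F)" for F
  have face_hull: "F = convex hull (vertices P \<inter> F)" if F: "F face_of P" for F
  proof -
    have "compact F" "convex F"
      using face_of_imp_compact[OF polytope_imp_convex[OF P] polytope_imp_compact[OF P] F]
        face_of_imp_convex[OF F] by auto
    then have "F = convex hull {v. v extreme_point_of F}" by (rule Krein_Milman_Minkowski)
    also have "{v. v extreme_point_of F} = vertices P \<inter> F"
      using extreme_point_of_face[OF F] by (auto simp: vertices_def)
    finally show ?thesis .
  qed
  have order: "F \<subseteq> F' \<longleftrightarrow> \<tau> F \<subseteq> \<tau> F'" if F: "F face_of P" "F' face_of P" for F F'
  proof
    assume "F \<subseteq> F'"
    then show "\<tau> F \<subseteq> \<tau> F'" unfolding \<tau>_def by blast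
  next
    assume "\<tau> F \<subseteq> \<tau> F'"
    then have "vertices P \<inter> F \<subseteq> vertices P \<inter> F'"
      unfolding \<tau>_def using h(1) by (subst (asm) inj_on_image_subset_iff) auto
    then have "convex hull (vertices P \<inter> F) \<subseteq> convex hull (vertices P \<inter> F')" by (rule hull_mono)
    then show "F \<subseteq> F'" using face_hull F by simp
  qed
  have "inj_on \<tau> {F. F face_of P}"
    by (rule inj_onI) (use order in blast)
  then have "bij_betw \<tau> {F. F face_of P} (\<tau> ` {F. F face_of P})" by (rule inj_on_imp_bij_betw)
  moreover have "\<tau> ` {F. F face_of P} \<subseteq> Pow {..<K}" using h(2) by (auto simp: \<tau>_def)
  ultimately show ?thesis unfolding face_code_def using order by blast
qed

text \<open>
  Choose one polytope for each code that occurs.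
\<close>

lemma finitely_many_combinatorial_types:
  "\<exists>\<F> :: 'a::euclidean_space set set. finite \<F> \<and> (\<forall>Q\<in>\<F>. polytope Q) \<and>
    (\<forall>P. polytope P \<and> card (vertices P) \<le> K \<longrightarrow> (\<exists>Q\<in>\<F>. combinatorially_equivalent P Q))"
proof -
  define T where "T = {S. \<exists>Q :: 'a set. polytope Q \<and> face_code K Q S}"
  define rep where "rep S = (SOME Q :: 'a set. polytope Q \<and> face_code K Q S)" for S
  have rep: "polytope (rep S) \<and> face_code K (rep S) S" if "S \<in> T" for S
    using that unfolding T_def rep_def by (intro someI_ex[of "\<lambda>Q. polytope Q \<and> face_code K Q S"]) simp
  have "T \<subseteq> Pow (Pow {..<K})" by (auto simp: T_def face_code_def)
  then have "finite T" by (rule finite_subset) simp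
  moreover have "\<exists>Q\<in>rep ` T. combinatorially_equivalent P Q"
    if P: "polytope P" "card (vertices P) \<le> K" for P
  proof -
    obtain S where S: "face_code K P S" using polytope_face_code[OF P] by blast
    then have "S \<in> T" using P by (auto simp: T_def)
    then show ?thesis using face_code_combinatorially_equivalent[OF S] rep by blast
  qed
  ultimately show ?thesis using rep by (intro exI[of _ "rep ` T"]) auto
qed

lemma simplex_vertices:
  assumes "int n simplex S"
  shows "polytope S" "card (vertices S) = n + 1"
proof -
  obtain B where B: "\<not> affine_dependent B" "int (card B) = int n + 1" "S = convex hull B"
    using assms by (auto simp: simplex)
  have finB: "finite B" using aff_independent_finite[OF B(1)] .
  then show "polytope S" using B(3) unfolding polytope_def by blast
  have "vertices S = B"
    using extreme_point_of_convex_hull_affine_independent[OF B(1)] B(3) by (auto simp: vertices_def)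
  then show "card (vertices S) = n + 1" using B(2) by simp
qed

section \<open>The volume growth theorem\<close>

theorem theorem2:
  shows "\<exists>c::real. c > 0 \<and>
    (\<forall>C :: (real ^ 'n) set. hilbert_geometry C \<longrightarrow>
      (\<forall>x\<in>C. \<forall>r>0. busemann_vol C (hilbert_ball C x r) \<ge> ennreal (c * r ^ CARD('n))) \<and>
      (\<forall>x\<in>C. asvol C x < \<infinity> \<longleftrightarrow> (\<exists>P. polytopal C P)) \<and>
      (\<forall>x\<in>C. \<forall>P k. polytopal C P \<and> card (vertices P) = k \<longrightarrow> asvol C x \<ge> ennreal (c * real k))) \<and>
    (\<exists>\<F> :: (real ^ 'n) set set. finite \<F> \<and> (\<forall>Q\<in>\<F>. polytope Q) \<and>
      (\<forall>(S :: (real ^ 'n) set) C P x y. int CARD('n) simplex S \<and> y \<in> interior S \<and>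
         hilbert_geometry C \<and> polytopal C P \<and> x \<in> C \<and> asvol C x < asvol (interior S) y \<longrightarrow>
         (\<exists>Q\<in>\<F>. combinatorially_equivalent P Q)))"
proof -
  let ?d = "CARD('n)" and ?pc = "packing_const TYPE(real ^ 'n)"
  define c where "c = min ?pc (unit_ball_vol (real ?d) * (1 / (8 * (real ?d + 4))) ^ ?d)"
  have c: "0 < c" "c \<le> ?pc" using packing_const_pos[where 'a = "real ^ 'n"] by (auto simp: c_def)
  define B where "B = cover_const TYPE(real ^ 'n) (?d + 1)"
  define K where "K = nat \<lceil>B / ?pc\<rceil>"
  have bound: "card (vertices P) \<le> K"
    if S: "int ?d simplex S" "y \<in> interior S" and C: "hilbert_geometry C" "polytopal C P" "x \<in> C"
      and less: "asvol C x < asvol (interior S) y" for S C P :: "(real ^ 'n) set" and x y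
  proof -
    note simplex = simplex_vertices[OF S(1)]
    have "hilbert_geometry (interior S)" using polytope_interior(2)[OF simplex(1)] S(2) by blast
    then have "asvol (interior S) y \<le> ennreal B"
      using asvol_polytopal_bounds(2)[OF _ polytopal_interior[OF simplex(1)] S(2)] simplex(2)
      by (simp add: B_def)
    moreover have "ennreal (?pc * real (card (vertices P))) \<le> asvol C x"
      by (rule asvol_polytopal_bounds(1)[OF C])
    ultimately have "ennreal (?pc * real (card (vertices P))) \<le> ennreal B"
      using less by simp
    moreover have "0 \<le> B" by (simp add: B_def cover_const_def)
    ultimately have "?pc * real (card (vertices P)) \<le> B" by simp
    then have "real (card (vertices P)) \<le> B / ?pc"
      using packing_const_pos[where 'a = "real ^ 'n"] by (simp add: field_simps)
    then show ?thesis unfolding K_def by linarith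
  qed
  obtain \<F> :: "(real ^ 'n) set set" where \<F>: "finite \<F>" "\<forall>Q\<in>\<F>. polytope Q"
    "\<forall>P. polytope P \<and> card (vertices P) \<le> K \<longrightarrow> (\<exists>Q\<in>\<F>. combinatorially_equivalent P Q)"
    using finitely_many_combinatorial_types[of K] by blast
  show ?thesis
  proof (rule exI[of _ c], intro conjI allI impI ballI)
    show "0 < c" by (rule c)
  next
    fix C :: "(real ^ 'n) set" and x r
    assume "hilbert_geometry C" "x \<in> C" "(0::real) < r"
    from busemann_vol_ball_ge[OF this]
    show "ennreal (c * r ^ ?d) \<le> busemann_vol C (hilbert_ball C x r)" by (simp add: c_def)
  next
    fix C :: "(real ^ 'n) set" and x
    assume C: "hilbert_geometry C" "x \<in> C"
    show "asvol C x < \<infinity> \<longleftrightarrow> (\<exists>P. polytopal C P)"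
    proof
      assume "\<exists>P. polytopal C P"
      then obtain P where "polytopal C P" by blast
      from asvol_polytopal_bounds(2)[OF C(1) this C(2)]
      show "asvol C x < \<infinity>" using le_less_trans ennreal_less_top by fastforce
    qed (rule finite_asvol_imp_polytopal[OF C])
  next
    fix C P :: "(real ^ 'n) set" and x k
    assume C: "hilbert_geometry C" "x \<in> C" and P: "polytopal C P \<and> card (vertices P) = k"
    have "ennreal (c * real k) \<le> ennreal (?pc * real k)"
      using c by (intro ennreal_leI mult_right_mono) auto
    also have "\<dots> \<le> asvol C x" using asvol_polytopal_bounds(1)[OF C(1) _ C(2)] P by blast
    finally show "ennreal (c * real k) \<le> asvol C x" .
  next
    show "\<exists>\<F> :: (real ^ 'n) set set. finite \<F> \<and> (\<forall>Q\<in>\<F>. polytope Q) \<and>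
      (\<forall>(S :: (real ^ 'n) set) C P x y. int CARD('n) simplex S \<and> y \<in> interior S \<and>
         hilbert_geometry C \<and> polytopal C P \<and> x \<in> C \<and> asvol C x < asvol (interior S) y \<longrightarrow>
         (\<exists>Q\<in>\<F>. combinatorially_equivalent P Q))"
    proof (intro exI[of _ \<F>] conjI allI impI \<F>(1,2); elim conjE)
      fix S C P :: "(real ^ 'n) set" and x y
      assume "int ?d simplex S" "y \<in> interior S" "hilbert_geometry C" and P: "polytopal C P"
        and "x \<in> C" "asvol C x < asvol (interior S) y"
      then have "card (vertices P) \<le> K" by (intro bound)
      then show "\<exists>Q\<in>\<F>. combinatorially_equivalent P Q"
        using \<F>(3) P by (auto simp: polytopal_def)
    qed
  qed
qed

end
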